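(* For every integer $\ell\geq 1$, every $2$-connected graph $G$ of pathwidth at least $2^{9\ell^2 - 3\ell +2}-2$ contains $\Gamma_{\ell}^{+}$ or $\nabla_\ell$ as a minor.
   Context: All graphs are finite and simple. For $\ell\ge 0$, $\Gamma_\ell$ denotes the complete binary tree of height $\ell$ (every non-leaf vertex has two children, $2^\ell$ leaves, every root-to-leaf path has $\ell$ edges). $\Gamma_\ell^+$ is obtained from $\Gamma_\ell$ by adding one new vertex adjacent to all leaves. The graphs $\nabla_\ell$ ($\ell\ge1$), each with a designated root edge, are defined recursively: $\nabla_1$ is a triangle with one edge designated as root edge; $\nabla_{\ell+1}$ is obtained by taking two disjoint copies of $\nabla_\ell$ with root edges $e_1,e_2$ and a triangle with edges $e_1',e_2',e_3$, identifying $e_i$ with $e_i'$ for $i=1,2$, and declaring $e_3$ the root edge. The pathwidth of $G$ is the minimum $k$ such that there are sets $B_1,\dots,B_n\subseteq V(G)$ with $|B_i|\le k+1$, each vertex lying in a non-empty interval of consecutive $B_i$'s, and each edge contained in some $B_i$. *)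

theory Defs
  imports "Graph_Theory.Graph_Theory"
begin

text \<open>
  A finite simple graph is a \<^locale>\<open>pair_graph\<close>: a finite, loop-free, symmetric digraph without
  parallel arcs, where the undirected edge \<open>uv\<close> is the pair of arcs \<open>(u, v)\<close>, \<open>(v, u)\<close>.
  \<^const>\<open>connected\<close> includes non-emptiness.
\<close>

definition k_connected :: "nat \<Rightarrow> 'a pair_pre_digraph \<Rightarrow> bool" where
  "k_connected k G \<longleftrightarrow> card (pverts G) > k \<and>
     (\<forall>X \<subseteq> pverts G. card X < k \<longrightarrow> connected (with_proj G \<restriction> (pverts G - X)))"

definition path_decomposition :: "'a pair_pre_digraph \<Rightarrow> 'a set list \<Rightarrow> bool" where
  "path_decomposition G Bs \<longleftrightarrow>
     (\<forall>B \<in> set Bs. B \<subseteq> pverts G) \<and>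
     (\<forall>v \<in> pverts G. \<exists>a b. a \<le> b \<and> {i. i < length Bs \<and> v \<in> Bs ! i} = {a..b}) \<and>
     (\<forall>(u, v) \<in> parcs G. \<exists>B \<in> set Bs. u \<in> B \<and> v \<in> B)"

definition pathwidth :: "'a pair_pre_digraph \<Rightarrow> nat" where
  "pathwidth G = (LEAST k. \<exists>Bs. path_decomposition G Bs \<and> (\<forall>B \<in> set Bs. card B \<le> k + 1))"

text \<open>
  Contraction of the edge \<open>uv\<close>: the merged vertex keeps the name \<open>u\<close>; the resulting loop is
  dropped and parallel edges coincide.
\<close>

definition contract_edge :: "'a \<Rightarrow> 'a \<Rightarrow> 'a pair_pre_digraph \<Rightarrow> 'a pair_pre_digraph" where
  "contract_edge u v G = (let f = id(v := u) in
     \<lparr> pverts = pverts G - {v},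
       parcs = {(f x, f y) | x y. (x, y) \<in> parcs G \<and> f x \<noteq> f y} \<rparr>)"

inductive contracts_to :: "'a pair_pre_digraph \<Rightarrow> 'a pair_pre_digraph \<Rightarrow> bool" for G where
  refl: "contracts_to G G"
| step: "contracts_to G H \<Longrightarrow> (u, v) \<in> parcs H \<Longrightarrow> contracts_to G (contract_edge u v H)"

definition is_minor :: "'b pair_pre_digraph \<Rightarrow> 'a pair_pre_digraph \<Rightarrow> bool" where
  "is_minor H G \<longleftrightarrow>
     (\<exists>S K. pair_graph S \<and> subgraph (with_proj S) (with_proj G) \<and> contracts_to S K \<and>
            digraph_iso (with_proj H) (with_proj K))"

text \<open>
  Vertices of the complete binary tree are words over \<^typ>\<open>bool\<close> of length at most \<open>l\<close>; the root is
  the empty word, the children of \<open>w\<close> are \<open>False # w\<close> and \<open>True # w\<close>, the leaves are the words of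
  length \<open>l\<close>. In \<open>Gamma_plus\<close> the added vertex is \<^const>\<open>None\<close>.
\<close>

definition Gamma :: "nat \<Rightarrow> bool list pair_pre_digraph" where
  "Gamma l = \<lparr> pverts = {w. length w \<le> l},
               parcs = symcl {(w, b # w) | w b. length w < l} \<rparr>"

definition Gamma_plus :: "nat \<Rightarrow> bool list option pair_pre_digraph" where
  "Gamma_plus l =
     \<lparr> pverts = insert None (Some ` pverts (Gamma l)),
       parcs = map_prod Some Some ` parcs (Gamma l) \<union>
               symcl {(None, Some w) | w. length w = l} \<rparr>"

text \<open>
  \<open>nabla l\<close> is realised on the vertices \<open>0, \<dots>, 2 ^ l\<close> with root edge joining \<open>0\<close> and \<open>2 ^ l\<close>.
  With \<open>n = 2 ^ l\<close>, the second copy of \<open>nabla l\<close> is its translate by \<open>n\<close>. It meets the first copy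
  only in \<open>n\<close>, and the root edges \<open>{0, n}\<close>, \<open>{n, 2 * n}\<close> of the two copies are edges of the triangle
  on \<open>0, n, 2 * n\<close>, whose third edge \<open>{0, 2 * n}\<close> is the new root edge. This is the identification
  up to isomorphism; the orientation in which root edges are identified is immaterial, as every
  \<open>nabla l\<close> has the automorphism \<open>i \<mapsto> 2 ^ l - i\<close>. \<open>nabla 0\<close> is left unspecified.
\<close>

definition triangle :: "'a \<Rightarrow> 'a \<Rightarrow> 'a \<Rightarrow> 'a pair_pre_digraph" where
  "triangle a b c = \<lparr> pverts = {a, b, c}, parcs = symcl {(a, b), (b, c), (a, c)} \<rparr>"

fun nabla :: "nat \<Rightarrow> nat pair_pre_digraph" where
  "nabla (Suc 0) = triangle 0 1 2"
| "nabla (Suc (Suc k)) =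
     (let H = nabla (Suc k); n = 2 ^ Suc k; T = triangle 0 n (2 * n) in
      \<lparr> pverts = pverts H \<union> (+) n ` pverts H \<union> pverts T,
        parcs = parcs H \<union> map_prod ((+) n) ((+) n) ` parcs H \<union> parcs T \<rparr>)"

lemma symcl_iff: "(x, y) \<in> symcl R \<longleftrightarrow> (x, y) \<in> R \<or> (y, x) \<in> R"
  by (auto simp: symcl_def)

lemma pair_graphI:
  assumes "finite (pverts G)"
    and "\<And>u v. (u, v) \<in> parcs G \<Longrightarrow> u \<in> pverts G \<and> u \<noteq> v \<and> (v, u) \<in> parcs G"
  shows "pair_graph G"
proof -
  have "parcs G \<subseteq> pverts G \<times> pverts G"
  proof (rule subrelI)
    fix u v assume "(u, v) \<in> parcs G"
    with assms(2)[of u v] assms(2)[of v u] show "(u, v) \<in> pverts G \<times> pverts G" by simp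
  qed
  moreover from this have "finite (parcs G)" using assms(1) finite_subset by blast
  ultimately show ?thesis using assms
    by unfold_locales (auto simp: symmetric_def intro!: symI)
qed

lemma finite_Gamma_verts: "finite (pverts (Gamma l))"
  using finite_lists_length_le[of "UNIV :: bool set" l] by (simp add: Gamma_def)

lemma pair_graph_Gamma_plus: "pair_graph (Gamma_plus l)"
  using finite_Gamma_verts[of l]
  by (intro pair_graphI) (auto simp: Gamma_plus_def Gamma_def symcl_iff map_prod_def)

lemma verts_nabla: "pverts (nabla (Suc k)) = {0..2 ^ Suc k}"
proof (induction k)
  case 0
  show ?case by (auto simp: triangle_def)
next
  case (Suc k)
  have "(+) n ` {0..n} = {n..2 * n}" for n :: nat by (simp add: mult_2)
  from this[of "2 ^ Suc k"] have "pverts (nabla (Suc (Suc k))) =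
      {0..2 ^ Suc k} \<union> {2 ^ Suc k..2 * 2 ^ Suc k} \<union> {0, 2 ^ Suc k, 2 * 2 ^ Suc k}"
    by (simp only: nabla.simps Let_def triangle_def pair_pre_digraph.simps Suc)
  then show ?case by (auto simp del: nabla.simps)
qed

lemma root_nabla: "(0, 2 ^ Suc k) \<in> parcs (nabla (Suc k))"
  by (cases k) (auto simp: triangle_def symcl_iff Let_def)

lemma pair_graph_nabla: "pair_graph (nabla (Suc k))"
proof (rule pair_graphI)
  show "finite (pverts (nabla (Suc k)))" by (simp only: verts_nabla finite_atLeastAtMost)
  show "u \<in> pverts (nabla (Suc k)) \<and> u \<noteq> v \<and> (v, u) \<in> parcs (nabla (Suc k))"
    if "(u, v) \<in> parcs (nabla (Suc k))" for u v
    using that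
  proof (induction k arbitrary: u v)
    case 0
    then show ?case by (auto simp: triangle_def symcl_iff)
  next
    case (Suc k)
    define n :: nat where "n = 2 ^ Suc k"
    define H where "H = nabla (Suc k)"
    have N: "nabla (Suc (Suc k)) =
      \<lparr> pverts = pverts H \<union> (+) n ` pverts H \<union> {0, n, 2 * n},
        parcs = parcs H \<union> map_prod ((+) n) ((+) n) ` parcs H \<union> symcl {(0, n), (n, 2 * n), (0, 2 * n)} \<rparr>"
      by (simp only: nabla.simps Let_def n_def H_def triangle_def pair_pre_digraph.simps)
    have "n > 0" by (simp add: n_def)
    from Suc.prems consider
        (first) "(u, v) \<in> parcs H"
      | (second) x y where "(x, y) \<in> parcs H" "u = n + x" "v = n + y"
      | (triangle) "(u, v) \<in> symcl {(0, n), (n, 2 * n), (0, 2 * n)}"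
      unfolding N by auto
    then show ?case
    proof cases
      case first
      from Suc.IH[OF this[unfolded H_def]] show ?thesis unfolding N H_def by auto
    next
      case second
      from Suc.IH[OF this(1)[unfolded H_def]] second(2,3) show ?thesis unfolding N H_def by force
    next
      case triangle
      with \<open>n > 0\<close> show ?thesis unfolding N by (auto simp: symcl_iff)
    qed
  qed
qed

lemma pair_graph_contract_edge:
  assumes "pair_graph G" "(u, v) \<in> parcs G"
  shows "pair_graph (contract_edge u v G)"
proof -
  interpret pair_graph G by fact
  have sym: "(y, x) \<in> parcs G" if "(x, y) \<in> parcs G" for x y
    using that pair_sym_arcs by (auto simp: symmetric_def dest: symD)
  have uv: "u \<noteq> v" "u \<in> pverts G" using assms(2) by (auto dest: no_loops' in_arcsD1)
  define f where "f = id(v := u)"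
  have C: "contract_edge u v G = \<lparr> pverts = pverts G - {v},
       parcs = {(f x, f y) | x y. (x, y) \<in> parcs G \<and> f x \<noteq> f y} \<rparr>"
    by (simp add: contract_edge_def f_def Let_def)
  have f: "f x \<in> pverts G - {v}" if "x \<in> pverts G" for x
    using that uv by (auto simp: f_def)
  show ?thesis
  proof (rule pair_graphI)
    show "finite (pverts (contract_edge u v G))" by (simp add: C pair_finite_verts)
    fix a b assume "(a, b) \<in> parcs (contract_edge u v G)"
    then obtain x y where "(x, y) \<in> parcs G" "a = f x" "b = f y" "f x \<noteq> f y"
      by (auto simp: C)
    then show "a \<in> pverts (contract_edge u v G) \<and> a \<noteq> b \<and>
        (b, a) \<in> parcs (contract_edge u v G)"
      using sym[of x y] in_arcsD1[of x y] f[of x] unfolding C by simp metis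
  qed
qed

lemma pathwidth_witness:
  assumes "finite (pverts G)" "parcs G \<subseteq> pverts G \<times> pverts G"
  shows "\<exists>Bs. path_decomposition G Bs \<and> (\<forall>B \<in> set Bs. card B \<le> pathwidth G + 1)"
  unfolding pathwidth_def
proof (rule LeastI)
  have "{i. i < length [pverts G] \<and> v \<in> [pverts G] ! i} = {0..0}" if "v \<in> pverts G" for v
    using that by auto
  then show "\<exists>Bs. path_decomposition G Bs \<and> (\<forall>B \<in> set Bs. card B \<le> card (pverts G) + 1)"
    using assms(2) by (intro exI[of _ "[pverts G]"]) (fastforce simp: path_decomposition_def)
qed

end

theory Submission
  imports Defs
begin

text \<open>
  By the path-width theorem (the short proof of Diestel, based on Menger's theorem), \<open>G\<close> contains a
  model of a complete binary tree of height \<open>k = 9 l\<^sup>2 - 3 l + 1\<close>. Assume that there is no \<open>\<Gamma>\<^sub>l\<^sup>+\<close> minor.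

  Let \<open>X\<close> consist of the top \<open>l + 3\<close> levels of a tree model in a 2-connected graph. If for some node \<open>v\<close>
  at depth 2 all components of the rest that hang below \<open>v\<close> had a neighbour in the part of \<open>X\<close> not below
  \<open>v\<close>, then contracting everything outside the \<open>l + 1\<close> levels of \<open>X\<close> below \<open>v\<close> to an apex would give a
  \<open>\<Gamma>\<^sub>l\<^sup>+\<close> minor. Hence at least four different components contain a large subtree, and two of them avoid
  two prescribed vertices \<open>a\<close>, \<open>b\<close>. At the expense of \<open>l\<close> further levels the subtrees lie in 2-connected
  subgraphs \<open>B1\<close>, \<open>B2\<close> of these components. There is a cycle through \<open>B1\<close> and \<open>B2\<close>, and \<open>a\<close>, \<open>b\<close> are joined
  to it by disjoint paths. So \<open>a\<close> and \<open>b\<close> are linked either through \<open>B1\<close> and \<open>B2\<close> in series, with a direct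
  connection besides, or through \<open>B1\<close> and \<open>B2\<close> in parallel.

  In the first case models of \<open>\<nabla>\<^sub>i\<close> in \<open>B1\<close> and \<open>B2\<close> with prescribed ends of the root edge combine to a model
  of \<open>\<nabla>\<^sub>i\<^sub>+\<^sub>1\<close> whose root edge has the ends \<open>a\<close>, \<open>b\<close>. In the second case models of \<open>\<Gamma>\<^sub>j\<^sup>+\<close> with prescribed
  vertices in the root and in the apex combine to such a model of \<open>\<Gamma>\<^sub>j\<^sub>+\<^sub>1\<^sup>+\<close>, with either \<open>a\<close> or \<open>b\<close> in the
  root. After \<open>3 l - 2\<close> steps, each of which costs \<open>2 l + 3\<close> levels, one of the three counters has reached
  \<open>l\<close>.
\<close>

section \<open>Connected sets and paths\<close>

text \<open>Models found inside two blocks can be glued only if the gluing vertices are known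
  beforehand. So the induction speaks of models rooted at two arbitrary vertices \<open>a\<close>
  and \<open>b\<close>. Whether \<open>a\<close> and \<open>b\<close> become linked in series or in
  parallel is not under control, hence three targets are pursued at once: \<open>i\<close> for
  \<open>nabla\<close>, \<open>j\<close> and \<open>j'\<close> for \<open>Gamma_plus\<close> with
  \<open>a\<close> or with \<open>b\<close> in the root. Trees need two counters as root and apex
  are not interchangeable; one is enough for \<open>nabla\<close>, since a reflection swaps the ends
  of its root edge. The kind of link decides which counter is lowered, and the induction hypothesis
  is then used in both blocks. Either both return the lowered target and are glued, or one block
  returns a target that was not lowered, and the rest merely connects its roots with
  \<open>a\<close> and \<open>b\<close>. The sum of the counters starts at \<open>3 * l\<close>, and
  a sum of 2 forces a counter 0, whence \<open>3 * l - 2\<close> steps. In each step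
  \<open>l + 3\<close> levels are spent on separating components and \<open>l\<close> on avoiding
  cutvertices.\<close>

definition conn :: "('a \<times> 'a) set \<Rightarrow> 'a set \<Rightarrow> bool" where
  "conn E S \<longleftrightarrow> S \<noteq> {} \<and> (\<forall>x\<in>S. \<forall>y\<in>S. (x, y) \<in> (E \<inter> S \<times> S)\<^sup>*)"

definition touches :: "('a \<times> 'a) set \<Rightarrow> 'a set \<Rightarrow> 'a set \<Rightarrow> bool" where
  "touches E A B \<longleftrightarrow> (\<exists>x\<in>A. \<exists>y\<in>B. (x, y) \<in> E)"

definition gpath :: "('a \<times> 'a) set \<Rightarrow> 'a set \<Rightarrow> 'a list \<Rightarrow> bool" where
  "gpath E S p \<longleftrightarrow> p \<noteq> [] \<and> distinct p \<and> set p \<subseteq> S \<and> successively (\<lambda>x y. (x, y) \<in> E) p"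

lemma gpathD:
  assumes "gpath E S p"
  shows "p \<noteq> []" "distinct p" "set p \<subseteq> S" "successively (\<lambda>x y. (x, y) \<in> E) p"
    "hd p \<in> set p" "last p \<in> set p"
  using assms by (auto simp: gpath_def)

lemma gpath_mono: "gpath E S p \<Longrightarrow> set p \<subseteq> T \<Longrightarrow> gpath E T p"
  by (auto simp: gpath_def)

lemma gpath_append_left: "gpath E S (p @ q) \<Longrightarrow> p \<noteq> [] \<Longrightarrow> gpath E S p"
  by (auto simp: gpath_def successively_append_iff)

lemma gpath_append_right: "gpath E S (p @ q) \<Longrightarrow> q \<noteq> [] \<Longrightarrow> gpath E S q"
  by (auto simp: gpath_def successively_append_iff)

lemma touches_mono: "touches E A B \<Longrightarrow> A \<subseteq> A' \<Longrightarrow> B \<subseteq> B' \<Longrightarrow> touches E A' B'"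
  by (auto simp: touches_def)

lemma reach_mono:
  assumes "(x, y) \<in> (E \<inter> S \<times> S)\<^sup>*" "S \<subseteq> T"
  shows "(x, y) \<in> (E \<inter> T \<times> T)\<^sup>*"
  using assms(1) by (rule rev_subsetD) (rule rtrancl_mono, use assms(2) in auto)

lemma reach_in:
  assumes "(x, y) \<in> (E \<inter> S \<times> S)\<^sup>*" "x \<in> S"
  shows "y \<in> S"
  using assms by (induction rule: rtrancl_induct) auto

lemma gpath_reach:
  assumes "successively (\<lambda>x y. (x, y) \<in> E) p" "p \<noteq> []" "set p \<subseteq> S"
  shows "(hd p, last p) \<in> (E \<inter> S \<times> S)\<^sup>*"
  using assms
proof (induction p rule: induct_list012)
  case (3 x y zs)
  then have "(hd (y # zs), last (y # zs)) \<in> (E \<inter> S \<times> S)\<^sup>*" by simp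
  moreover have "(x, y) \<in> E \<inter> S \<times> S" using 3 by simp
  ultimately show ?case
    by (metis converse_rtrancl_into_rtrancl last.simps list.sel(1) list.distinct(1))
qed auto

lemma reach_path:
  assumes "(x, y) \<in> (E \<inter> S \<times> S)\<^sup>*" "x \<in> S"
  shows "\<exists>p. gpath E S p \<and> hd p = x \<and> last p = y"
  using assms(1)
proof (induction rule: rtrancl_induct)
  case base
  show ?case using assms(2) by (intro exI[of _ "[x]"]) (simp add: gpath_def)
next
  case (step y z)
  then obtain p where p: "gpath E S p" "hd p = x" "last p = y" by blast
  show ?case
  proof (cases "z \<in> set p")
    case True
    then obtain u v where uv: "p = u @ z # v" by (auto simp: in_set_conv_decomp)
    have "gpath E S (u @ [z])" using gpath_append_left[of E S "u @ [z]" v] p(1) uv by simp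
    moreover have "hd (u @ [z]) = x" using p(2) uv by (cases u) auto
    ultimately show ?thesis by (intro exI[of _ "u @ [z]"]) simp
  next
    case False
    then have "gpath E S (p @ [z])"
      using p step.hyps by (auto simp: gpath_def successively_append_iff)
    then show ?thesis using p by (intro exI[of _ "p @ [z]"]) (auto simp: gpath_def)
  qed
qed

lemma conn_nonempty: "conn E S \<Longrightarrow> S \<noteq> {}"
  by (simp add: conn_def)

lemma conn_singleton [simp]: "conn E {x}"
  by (simp add: conn_def)

lemma conn_path:
  assumes "conn E S" "x \<in> S" "y \<in> S"
  shows "\<exists>p. gpath E S p \<and> hd p = x \<and> last p = y"
proof -
  have "(x, y) \<in> (E \<inter> S \<times> S)\<^sup>*" using assms by (simp add: conn_def)
  from reach_path[OF this assms(2)] show ?thesis .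
qed

text \<open>A shortest path between two sets meets each of them only at its end.\<close>

lemma conn_link:
  assumes "conn E X" "X \<inter> P \<noteq> {}" "X \<inter> Q \<noteq> {}"
  shows "\<exists>p. gpath E X p \<and> set p \<inter> P = {hd p} \<and> set p \<inter> Q = {last p}"
proof -
  define C where "C n \<longleftrightarrow> (\<exists>p. gpath E X p \<and> hd p \<in> P \<and> last p \<in> Q \<and> length p = n)" for n
  obtain x y where "x \<in> X \<inter> P" "y \<in> X \<inter> Q" using assms by blast
  with conn_path[OF assms(1)] have "\<exists>n. C n" unfolding C_def by (metis IntD1 IntD2)
  then have "C (LEAST n. C n)" by (rule LeastI_ex)
  then obtain p where p: "gpath E X p" "hd p \<in> P" "last p \<in> Q" "length p = (LEAST n. C n)"
    unfolding C_def by blast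
  have min: "length p \<le> length q" if "gpath E X q" "hd q \<in> P" "last q \<in> Q" for q
    unfolding p(4) using that by (intro Least_le) (auto simp: C_def)
  have "z = hd p" if z: "z \<in> set p" "z \<in> P" for z
  proof -
    obtain u v where uv: "p = u @ z # v" using split_list[OF z(1)] by blast
    have "length p \<le> length (z # v)"
      using gpath_append_right[of E X u "z # v"] p uv z(2) by (intro min) auto
    then show ?thesis using uv by simp
  qed
  moreover have "z = last p" if z: "z \<in> set p" "z \<in> Q" for z
  proof -
    obtain u v where uv: "p = u @ z # v" using split_list[OF z(1)] by blast
    have "length p \<le> length (u @ [z])"
      using gpath_append_left[of E X "u @ [z]" v] p uv z(2) by (intro min) (auto simp: hd_append)
    then show ?thesis using uv by simp
  qed
  ultimately have "set p \<inter> P = {hd p}" "set p \<inter> Q = {last p}"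
    using p gpathD(5,6)[OF p(1)] by blast+
  with p(1) show ?thesis by blast
qed

definition comp_of :: "('a \<times> 'a) set \<Rightarrow> 'a set \<Rightarrow> 'a \<Rightarrow> 'a set" where
  "comp_of E S x = {y. (x, y) \<in> (E \<inter> S \<times> S)\<^sup>*}"

lemma comp_of_refl: "x \<in> comp_of E S x"
  by (simp add: comp_of_def)

lemma comp_of_subset: "x \<in> S \<Longrightarrow> comp_of E S x \<subseteq> S"
  unfolding comp_of_def by (auto dest: reach_in)

lemma comp_of_step:
  assumes "y \<in> comp_of E S x" "(y, z) \<in> E" "z \<in> S" "x \<in> S"
  shows "z \<in> comp_of E S x"
proof -
  have "y \<in> S" using assms comp_of_subset by fastforce
  with assms show ?thesis unfolding comp_of_def by (auto intro: rtrancl_into_rtrancl)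
qed

lemma conn_subset_comp_of:
  assumes "conn E Y" "Y \<subseteq> S" "y \<in> Y" "y \<in> comp_of E S x"
  shows "Y \<subseteq> comp_of E S x"
proof
  fix z assume "z \<in> Y"
  then have "(y, z) \<in> (E \<inter> Y \<times> Y)\<^sup>*" using assms(1,3) by (simp add: conn_def)
  then have "(y, z) \<in> (E \<inter> S \<times> S)\<^sup>*" using assms(2) by (rule reach_mono)
  then show "z \<in> comp_of E S x" using assms(4) by (auto simp: comp_of_def)
qed

locale ugraph =
  fixes E :: "('a \<times> 'a) set"
  assumes sym_E: "sym E"
begin

lemma sym: "(x, y) \<in> E \<Longrightarrow> (y, x) \<in> E"
  using sym_E by (simp add: symD)

lemma reach_sym:
  assumes "(x, y) \<in> (E \<inter> S \<times> S)\<^sup>*"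
  shows "(y, x) \<in> (E \<inter> S \<times> S)\<^sup>*"
proof -
  have "sym (E \<inter> S \<times> S)" using sym_E by (auto simp: sym_def)
  with assms show ?thesis by (meson sym_rtrancl symD)
qed

lemma touches_sym: "touches E A B \<Longrightarrow> touches E B A"
  using sym by (auto simp: touches_def)

lemma connI:
  assumes "x \<in> S" "\<And>y. y \<in> S \<Longrightarrow> (x, y) \<in> (E \<inter> S \<times> S)\<^sup>*"
  shows "conn E S"
  unfolding conn_def using assms reach_sym by (meson empty_iff rtrancl_trans)

lemma conn_comp_of:
  assumes "x \<in> S" shows "conn E (comp_of E S x)"
proof (rule connI)
  show "x \<in> comp_of E S x" by (rule comp_of_refl)
  fix y assume "y \<in> comp_of E S x"
  then have "(x, y) \<in> (E \<inter> S \<times> S)\<^sup>*" by (simp add: comp_of_def)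
  then show "(x, y) \<in> (E \<inter> comp_of E S x \<times> comp_of E S x)\<^sup>*"
  proof (induction rule: rtrancl_induct)
    case (step y z)
    then have "y \<in> comp_of E S x" "z \<in> comp_of E S x"
      by (auto simp: comp_of_def intro: rtrancl_into_rtrancl)
    with step show ?case by (auto intro: rtrancl_into_rtrancl)
  qed simp
qed

lemma comp_of_eq:
  assumes "z \<in> comp_of E S x" "z \<in> comp_of E S y" "x \<in> S" "y \<in> S"
  shows "comp_of E S x = comp_of E S y"
proof -
  have "(x, y) \<in> (E \<inter> S \<times> S)\<^sup>*" "(y, x) \<in> (E \<inter> S \<times> S)\<^sup>*"
    using assms reach_sym unfolding comp_of_def by (blast intro: rtrancl_trans)+
  then show ?thesis unfolding comp_of_def by (auto intro: rtrancl_trans)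
qed

lemma conn_Un:
  assumes "conn E A" "conn E B" "A \<inter> B \<noteq> {}"
  shows "conn E (A \<union> B)"
proof -
  obtain x where x: "x \<in> A" "x \<in> B" using assms by blast
  show ?thesis
  proof (rule connI[of x])
    fix y assume "y \<in> A \<union> B"
    then have "(x, y) \<in> (E \<inter> A \<times> A)\<^sup>* \<or> (x, y) \<in> (E \<inter> B \<times> B)\<^sup>*"
      using assms x by (auto simp: conn_def)
    then show "(x, y) \<in> (E \<inter> (A \<union> B) \<times> (A \<union> B))\<^sup>*"
      using reach_mono by (metis Un_upper1 Un_upper2)
  qed (use x in simp)
qed

lemma conn_edge: "(x, y) \<in> E \<Longrightarrow> conn E {x, y}"
  by (rule connI[of x]) auto

lemma conn_Un_touches:
  assumes "conn E A" "conn E B" "touches E A B"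
  shows "conn E (A \<union> B)"
proof -
  obtain x y where xy: "x \<in> A" "y \<in> B" "(x, y) \<in> E" using assms(3) by (auto simp: touches_def)
  have "conn E (A \<union> {x, y})" using assms(1) conn_edge[OF xy(3)] xy by (blast intro: conn_Un)
  then have "conn E ((A \<union> {x, y}) \<union> B)" using assms(2) xy by (blast intro: conn_Un)
  moreover have "(A \<union> {x, y}) \<union> B = A \<union> B" using xy by auto
  ultimately show ?thesis by simp
qed

lemma conn_insert: "conn E A \<Longrightarrow> x \<in> A \<Longrightarrow> (x, y) \<in> E \<Longrightarrow> conn E (insert y A)"
  using conn_Un_touches[of A "{y}"] by (auto simp: touches_def)

lemma conn_UN:
  assumes "conn E A" "\<And>i. i \<in> I \<Longrightarrow> conn E (B i)"
    "\<And>i. i \<in> I \<Longrightarrow> A \<inter> B i \<noteq> {} \<or> touches E A (B i)"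
  shows "conn E (A \<union> (\<Union>i\<in>I. B i))"
proof -
  obtain x where x: "x \<in> A" using assms(1) by (auto simp: conn_def)
  show ?thesis
  proof (rule connI[of x])
    fix y assume "y \<in> A \<union> (\<Union>i\<in>I. B i)"
    then consider "y \<in> A" | i where "i \<in> I" "y \<in> B i" by auto
    then show "(x, y) \<in> (E \<inter> (A \<union> (\<Union>i\<in>I. B i)) \<times> (A \<union> (\<Union>i\<in>I. B i)))\<^sup>*"
    proof cases
      case 1
      then have "(x, y) \<in> (E \<inter> A \<times> A)\<^sup>*" using x assms(1) by (auto simp: conn_def)
      then show ?thesis by (rule reach_mono) auto
    next
      case 2
      have "conn E (A \<union> B i)" using assms(1) assms(2,3)[OF 2(1)] conn_Un conn_Un_touches by blast
      then have "(x, y) \<in> (E \<inter> (A \<union> B i) \<times> (A \<union> B i))\<^sup>*" using x 2 by (auto simp: conn_def)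
      then show ?thesis by (rule reach_mono) (use 2 in auto)
    qed
  qed (use x in simp)
qed

lemma conn_gpath:
  assumes "gpath E S p" shows "conn E (set p)"
proof (rule connI[of "hd p"])
  fix y assume "y \<in> set p"
  then obtain u v where uv: "p = u @ y # v" by (auto simp: in_set_conv_decomp)
  have "gpath E S (u @ [y])" using gpath_append_left[of E S "u @ [y]" v] assms uv by simp
  then have "(hd (u @ [y]), last (u @ [y])) \<in> (E \<inter> set p \<times> set p)\<^sup>*"
    using uv by (intro gpath_reach) (auto simp: gpath_def)
  moreover have "hd (u @ [y]) = hd p" using uv by (cases u) auto
  ultimately show "(hd p, y) \<in> (E \<inter> set p \<times> set p)\<^sup>*" by simp
qed (use gpathD(5)[OF assms] in simp)

lemma gpath_trim:
  assumes "gpath E S p" "hd p \<in> P" "last p \<in> Q"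
  shows "\<exists>q. gpath E S q \<and> set q \<subseteq> set p \<and> set q \<inter> P = {hd q} \<and> set q \<inter> Q = {last q}"
proof -
  have "\<exists>q. gpath E (set p) q \<and> set q \<inter> P = {hd q} \<and> set q \<inter> Q = {last q}"
    using assms gpathD(5,6)[OF assms(1)] by (intro conn_link conn_gpath) auto
  then show ?thesis using gpathD(3)[OF assms(1)] by (meson gpathD(3) gpath_mono subset_trans)
qed

end

section \<open>Menger's theorem\<close>

text \<open>\<open>Z\<close> may contain vertices of \<open>A\<close> and of \<open>B\<close>, as in
  the set version of Menger's theorem; it always contains \<open>A \<inter> B\<close>.\<close>

definition separates :: "('a \<times> 'a) set \<Rightarrow> 'a set \<Rightarrow> 'a set \<Rightarrow> 'a set \<Rightarrow> bool" where
  "separates E A B Z \<longleftrightarrow> (\<forall>x\<in>A - Z. \<forall>y\<in>B - Z. (x, y) \<notin> (E \<inter> (- Z) \<times> (- Z))\<^sup>*)"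

definition linkage :: "('a \<times> 'a) set \<Rightarrow> 'a set \<Rightarrow> 'a set \<Rightarrow> 'a list set \<Rightarrow> bool" where
  "linkage E A B P \<longleftrightarrow> finite P \<and>
     (\<forall>p\<in>P. gpath E UNIV p \<and> set p \<inter> A = {hd p} \<and> set p \<inter> B = {last p}) \<and>
     (\<forall>p\<in>P. \<forall>q\<in>P. p \<noteq> q \<longrightarrow> set p \<inter> set q = {})"

lemma linkageD:
  assumes "linkage E A B P" "p \<in> P"
  shows "gpath E UNIV p" "set p \<inter> A = {hd p}" "set p \<inter> B = {last p}" "hd p \<in> A" "last p \<in> B"
  using assms by (auto simp: linkage_def)

lemma gpath_mono_edges: "gpath E S p \<Longrightarrow> E \<subseteq> E' \<Longrightarrow> gpath E' S p"
  unfolding gpath_def by (metis (mono_tags, lifting) subsetD successively_mono)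

lemma linkage_mono: "linkage E A B P \<Longrightarrow> E \<subseteq> E' \<Longrightarrow> linkage E' A B P"
  unfolding linkage_def by (metis gpath_mono_edges)

lemma linkage_last_bij:
  assumes "linkage E A B P" "finite B" "card P = card B"
  shows "bij_betw last P B"
proof -
  have "inj_on last P"
  proof (rule inj_onI, rule ccontr)
    fix p q assume pq: "p \<in> P" "q \<in> P" "last p = last q" "p \<noteq> q"
    then have "set p \<inter> set q = {}" using assms(1) by (simp add: linkage_def)
    then show False using pq gpathD(6)[OF linkageD(1)[OF assms(1)]] by (metis disjoint_iff)
  qed
  moreover have "last ` P \<subseteq> B" using linkageD[OF assms(1)] by blast
  ultimately show ?thesis
    using assms(2,3) by (metis bij_betw_def card_image card_subset_eq)
qed

lemma linkage_hd_bij: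
  assumes "linkage E A B P" "finite A" "card P = card A"
  shows "bij_betw hd P A"
proof -
  have "inj_on hd P"
  proof (rule inj_onI, rule ccontr)
    fix p q assume pq: "p \<in> P" "q \<in> P" "hd p = hd q" "p \<noteq> q"
    then have "set p \<inter> set q = {}" using assms(1) by (simp add: linkage_def)
    then show False using pq gpathD(5)[OF linkageD(1)[OF assms(1)]] by (metis disjoint_iff)
  qed
  moreover have "hd ` P \<subseteq> A" using linkageD[OF assms(1)] by blast
  ultimately show ?thesis
    using assms(2,3) by (metis bij_betw_def card_image card_subset_eq)
qed

text \<open>Shortening each path by \<open>gpath_trim\<close> makes it meet \<open>A\<close> and
  \<open>B\<close> in its ends only and keeps the family disjoint. Nonempty disjoint paths are
  different, so none is lost when the family becomes a set.\<close>

lemma (in ugraph) linkageI: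
  assumes "finite I"
    and "\<And>i. i \<in> I \<Longrightarrow> gpath E UNIV (f i) \<and> hd (f i) \<in> A \<and> last (f i) \<in> B"
    and "\<And>i j. i \<in> I \<Longrightarrow> j \<in> I \<Longrightarrow> i \<noteq> j \<Longrightarrow> set (f i) \<inter> set (f j) = {}"
  shows "\<exists>P. linkage E A B P \<and> card P = card I"
proof -
  have "\<forall>i\<in>I. \<exists>q. gpath E UNIV q \<and> set q \<subseteq> set (f i) \<and> set q \<inter> A = {hd q} \<and> set q \<inter> B = {last q}"
    using assms(2) gpath_trim by meson
  then obtain g where g: "\<And>i. i \<in> I \<Longrightarrow> gpath E UNIV (g i) \<and> set (g i) \<subseteq> set (f i) \<and>
      set (g i) \<inter> A = {hd (g i)} \<and> set (g i) \<inter> B = {last (g i)}"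
    by metis
  have dis: "set (g i) \<inter> set (g j) = {}" if "i \<in> I" "j \<in> I" "i \<noteq> j" for i j
    using assms(3)[OF that] g that by blast
  have "inj_on g I"
  proof (rule inj_onI)
    fix i j assume ij: "i \<in> I" "j \<in> I" "g i = g j"
    show "i = j"
    proof (rule ccontr)
      assume "i \<noteq> j"
      with dis[of i j] ij g[of i] show False by (auto simp: gpath_def)
    qed
  qed
  moreover have "linkage E A B (g ` I)"
    unfolding linkage_def using g dis assms(1) by (auto; blast)
  ultimately show ?thesis using card_image by blast
qed

lemma rtrancl_Un_edge:
  assumes "(u, w) \<in> (R \<union> {(a, b), (b, a)})\<^sup>*"
  shows "(u, w) \<in> R\<^sup>* \<or> (u, a) \<in> R\<^sup>* \<and> (b, w) \<in> R\<^sup>* \<or> (u, b) \<in> R\<^sup>* \<and> (a, w) \<in> R\<^sup>*"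
  using assms
proof (induction rule: rtrancl_induct)
  case (step y z)
  then consider "(y, z) \<in> R" | "y = a" "z = b" | "y = b" "z = a" by auto
  then show ?case
  proof cases
    case 1
    with step.IH show ?thesis by (meson rtrancl_into_rtrancl)
  qed (use step.IH in auto)
qed simp

context ugraph
begin

lemma separates_sym: "separates E A B Z \<longleftrightarrow> separates E B A Z"
  unfolding separates_def using reach_sym by blast

text \<open>The end \<open>y\<close> lies on the \<open>B\<close>-side of \<open>Z\<close>. A path
  from \<open>A\<close> to \<open>B\<close> avoiding \<open>W\<close> is followed up to its first
  vertex in \<open>insert x Z\<close>. This stretch lies in \<open>E'\<close> unless it enters
  \<open>x\<close> from \<open>y\<close>; but then \<open>A\<close> would reach \<open>y\<close>,
  and with it \<open>w\<close>, around \<open>Z\<close>. So \<open>W\<close> would not even separate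
  \<open>A\<close> from \<open>insert x Z\<close>.\<close>

lemma separates_delete_edge:
  assumes E': "E' = E - {(x, y), (y, x)}"
    and sep: "separates E' A B Z" and x: "x \<notin> Z" and y: "y \<notin> Z"
    and w: "w \<in> B - Z" "(y, w) \<in> (E' \<inter> (- Z) \<times> (- Z))\<^sup>*"
    and W: "separates E' A (insert x Z) W"
  shows "separates E A B W"
proof (rule ccontr)
  assume "\<not> separates E A B W"
  then obtain u v where uv: "u \<in> A - W" "v \<in> B - W" "(u, v) \<in> (E \<inter> (- W) \<times> (- W))\<^sup>*"
    by (auto simp: separates_def)
  then obtain p where p: "gpath E (- W) p" "hd p = u" "last p = v"
    using reach_path[of u v E "- W"] by auto
  have "set p \<inter> insert x Z \<noteq> {}"
  proof
    assume dis: "set p \<inter> insert x Z = {}"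
    have "successively (\<lambda>x y. (x, y) \<in> E') p"
      using gpathD(4)[OF p(1)] by (rule successively_mono) (use dis E' in auto)
    then have "(u, v) \<in> (E' \<inter> (- Z) \<times> (- Z))\<^sup>*"
      using gpath_reach[of E' p "- Z"] p dis gpathD(1) by fastforce
    moreover have "u \<in> A - Z" "v \<in> B - Z" using dis p uv gpathD(5,6)[OF p(1)] by auto
    ultimately show False using sep by (auto simp: separates_def)
  qed
  then have "\<exists>z\<in>set p. z \<in> insert x Z" by auto
  then obtain r z s where rzs: "p = r @ z # s" "z \<in> insert x Z" "\<forall>t\<in>set r. t \<notin> insert x Z"
    by (auto dest!: split_list_first_prop)
  have sr: "successively (\<lambda>x y. (x, y) \<in> E) (r @ [z])"
    using gpathD(4)[OF p(1)] rzs by (simp add: successively_append_iff)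
  have xr: "x \<notin> set r" using rzs by auto
  have hr: "hd (r @ [z]) = u" using p rzs by (cases r) auto
  have sr': "successively (\<lambda>x y. (x, y) \<in> E') r"
    using sr xr E' successively_mono[of "\<lambda>x y. (x, y) \<in> E" r "\<lambda>x y. (x, y) \<in> E'"]
    by (auto simp: successively_append_iff)
  show False
  proof (cases "r \<noteq> [] \<and> last r = y \<and> z = x")
    case True
    then have "(u, y) \<in> (E' \<inter> (- Z) \<times> (- Z))\<^sup>*"
      using gpath_reach[OF sr', of "- Z"] hr rzs by auto
    then have "(u, w) \<in> (E' \<inter> (- Z) \<times> (- Z))\<^sup>*" using w(2) by simp
    moreover have "u \<notin> Z" using True hr rzs by (cases r) auto
    ultimately show False using sep uv w(1) by (auto simp: separates_def)
  next
    case False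
    have "successively (\<lambda>x y. (x, y) \<in> E') (r @ [z])"
    proof (cases "r = []")
      case False
      then have "last r \<noteq> x" using xr last_in_set by metis
      with sr sr' \<open>\<not> (r \<noteq> [] \<and> last r = y \<and> z = x)\<close> False show ?thesis
        by (auto simp: successively_append_iff E')
    qed simp
    then have "(u, z) \<in> (E' \<inter> (- W) \<times> (- W))\<^sup>*"
      using gpath_reach[of E' "r @ [z]" "- W"] hr gpathD(3)[OF p(1)] rzs by simp
    moreover have "z \<notin> W" using gpathD(3)[OF p(1)] rzs by auto
    ultimately show False using W uv rzs(2) by (auto simp: separates_def)
  qed
qed

end

lemma gpath_join:
  assumes "gpath E UNIV p" "gpath E UNIV q" "last p = hd q" "set p \<inter> set q = {hd q}"
  shows "gpath E UNIV (p @ tl q) \<and> last (p @ tl q) = last q"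
proof -
  obtain a r where q: "q = a # r" using assms(2) by (cases q) (auto simp: gpath_def)
  have "a \<notin> set r" using assms(2) q by (auto simp: gpath_def)
  then have "set p \<inter> set r = {}" using assms(4) q by auto
  then show ?thesis using assms q
    by (cases r) (auto simp: gpath_def successively_append_iff)
qed

text \<open>Induction on the number of edges. If deleting the edge \<open>xy\<close> creates a
  separator \<open>Z\<close> with fewer than \<open>k\<close> elements, then
  \<open>insert x Z\<close> and \<open>insert y Z\<close> have exactly \<open>k\<close> elements,
  and by \<open>separates_delete_edge\<close> the induction hypothesis yields \<open>k\<close> paths
  in \<open>E'\<close> from \<open>A\<close> to the former and from the latter to \<open>B\<close>.
  They are spliced at the vertices of \<open>Z\<close> and along \<open>xy\<close>.\<close>

lemma menger:
  assumes "finite E" "sym E" "finite A" "finite B"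
    and "\<And>Z. finite Z \<Longrightarrow> separates E A B Z \<Longrightarrow> k \<le> card Z"
  shows "\<exists>P. linkage E A B P \<and> card P = k"
  using assms
proof (induction "card E" arbitrary: E A B rule: less_induct)
  case less
  interpret ugraph E using less.prems by unfold_locales
  show ?case
  proof (cases "E = {}")
    case True
    \<comment> \<open>Without edges \<open>A \<inter> B\<close> is a separator, and its vertices are
      the required paths.\<close>
    then have "k \<le> card (A \<inter> B)" using less.prems by (intro less.prems(5)) (auto simp: separates_def)
    then obtain C where C: "C \<subseteq> A \<inter> B" "card C = k" by (meson obtain_subset_with_card_n)
    have "finite C" using C less.prems finite_subset by blast
    then have "\<exists>P. linkage E A B P \<and> card P = card C"
      by (rule linkageI[of _ "\<lambda>v. [v]"]) (use C in \<open>auto simp: gpath_def\<close>)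
    then show ?thesis using C by simp
  next
    case False
    then obtain x0 y0 where e: "(x0, y0) \<in> E" by auto
    define E' where "E' = E - {(x0, y0), (y0, x0)}"
    have E': "finite E'" "E' \<subseteq> E" "card E' < card E"
      using less.prems(1) e by (auto simp: E'_def intro!: psubset_card_mono)
    have symE': "sym E'" using less.prems(2) by (auto simp: E'_def sym_def)
    interpret E': ugraph E' using symE' by unfold_locales
    show ?thesis
    proof (cases "\<forall>Z. finite Z \<longrightarrow> separates E' A B Z \<longrightarrow> k \<le> card Z")
      case True
      then have "\<exists>P. linkage E' A B P \<and> card P = k"
        using less.hyps[OF E'(3) E'(1) symE' less.prems(3,4)] by blast
      then show ?thesis using linkage_mono[OF _ E'(2)] by blast
    next
      case False
      then obtain Z where Z: "finite Z" "separates E' A B Z" "card Z < k" by fastforce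
      then have "\<not> separates E A B Z" using less.prems(5) by fastforce
      then obtain u w where uw: "u \<in> A - Z" "w \<in> B - Z" "(u, w) \<in> (E \<inter> (- Z) \<times> (- Z))\<^sup>*"
        by (auto simp: separates_def)
      define R where "R = E' \<inter> (- Z) \<times> (- Z)"
      have nR: "(u, w) \<notin> R\<^sup>*" using Z(2) uw by (auto simp: separates_def R_def)
      \<comment> \<open>If \<open>Z\<close> contained an end of the edge, deleting the edge would
        change nothing off \<open>Z\<close>.\<close>
      have nZ: "x0 \<notin> Z \<and> y0 \<notin> Z"
      proof (rule ccontr)
        assume "\<not> (x0 \<notin> Z \<and> y0 \<notin> Z)"
        then have "E \<inter> (- Z) \<times> (- Z) = R" unfolding R_def E'_def by auto
        with uw(3) nR show False by simp
      qed
      have "E \<inter> (- Z) \<times> (- Z) \<subseteq> R \<union> {(x0, y0), (y0, x0)}" by (auto simp: R_def E'_def)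
      with uw(3) have "(u, w) \<in> (R \<union> {(x0, y0), (y0, x0)})\<^sup>*" by (meson rtrancl_mono subsetD)
      with nR have "(u, x0) \<in> R\<^sup>* \<and> (y0, w) \<in> R\<^sup>* \<or> (u, y0) \<in> R\<^sup>* \<and> (x0, w) \<in> R\<^sup>*"
        using rtrancl_Un_edge by metis
      \<comment> \<open>\<open>x\<close> is the end that is reached from \<open>A\<close> off
        \<open>Z\<close>, and \<open>y\<close> the end from which \<open>B\<close> is
        reached.\<close>
      then obtain x y where xy: "(u, x) \<in> R\<^sup>*" "(y, w) \<in> R\<^sup>*" "(x, y) = (x0, y0) \<or> (x, y) = (y0, x0)"
        by blast
      have Exy: "(x, y) \<in> E" "E' = E - {(x, y), (y, x)}" "E' = E - {(y, x), (x, y)}"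
        using xy(3) e sym by (auto simp: E'_def)
      have nxy: "x \<notin> Z" "y \<notin> Z" using xy(3) nZ by auto
      have xu: "(x, u) \<in> R\<^sup>*" using E'.reach_sym xy(1) by (simp add: R_def)
      have ZBA: "separates E' B A Z" using Z(2) E'.separates_sym by blast
      have sx: "k \<le> card W" if "finite W" "separates E' A (insert x Z) W" for W
        using separates_delete_edge[OF Exy(2) Z(2) nxy uw(2) xy(2)[unfolded R_def] that(2)]
          less.prems(5) that(1) by blast
      have sy: "k \<le> card W" if "finite W" "separates E' (insert y Z) B W" for W
      proof -
        have "separates E' B (insert y Z) W" using that(2) E'.separates_sym by blast
        from separates_delete_edge[OF Exy(3) ZBA nxy(2,1) uw(1) xu[unfolded R_def] this]
        show ?thesis using separates_sym less.prems(5) that(1) by blast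
      qed
      have "separates E' A (insert x Z) (insert x Z)" "separates E' (insert y Z) B (insert y Z)"
        by (auto simp: separates_def)
      then have "k \<le> card (insert x Z)" "k \<le> card (insert y Z)" using sx sy Z(1) by auto
      with Z nxy have cZ: "card (insert x Z) = k" "card (insert y Z) = k" by auto
      obtain P1 where P1: "linkage E' A (insert x Z) P1" "card P1 = k"
        using less.hyps[OF E'(3) E'(1) symE' less.prems(3), of "insert x Z"] sx Z(1) by blast
      obtain P2 where P2: "linkage E' (insert y Z) B P2" "card P2 = k"
        using less.hyps[OF E'(3) E'(1) symE' _ less.prems(4), of "insert y Z"] sy Z(1) by blast
      have b1: "bij_betw last P1 (insert x Z)" using linkage_last_bij[OF P1(1)] P1(2) cZ Z(1) by simp
      have b2: "bij_betw hd P2 (insert y Z)" using linkage_hd_bij[OF P2(1)] P2(2) cZ Z(1) by simp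
      have "\<forall>z\<in>insert x Z. \<exists>p\<in>P1. last p = z" using bij_betw_imp_surj_on[OF b1] by (metis imageE)
      then obtain p where p: "\<And>z. z \<in> insert x Z \<Longrightarrow> p z \<in> P1 \<and> last (p z) = z" by metis
      have "\<forall>z\<in>insert y Z. \<exists>p\<in>P2. hd p = z" using bij_betw_imp_surj_on[OF b2] by (metis imageE)
      then obtain q where q: "\<And>z. z \<in> insert y Z \<Longrightarrow> q z \<in> P2 \<and> hd (q z) = z" by metis
      have pl: "gpath E' UNIV (p z)" "hd (p z) \<in> A" "set (p z) \<inter> insert x Z = {z}"
        if "z \<in> insert x Z" for z
        using linkageD[OF P1(1)] p[OF that] by auto
      have ql: "gpath E' UNIV (q z)" "last (q z) \<in> B" "set (q z) \<inter> insert y Z = {z}"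
        if "z \<in> insert y Z" for z
        using linkageD[OF P2(1)] q[OF that] by auto
      \<comment> \<open>The paths of the first linkage meet \<open>Z\<close> at most in their last
        vertex, those of the second at most in their first. So a common vertex outside
        \<open>Z\<close> would connect \<open>A\<close> with \<open>B\<close> in \<open>E'\<close>
        around \<open>Z\<close>.\<close>
      have cross: "v = z \<and> v = z' \<and> v \<in> Z"
        if z: "z \<in> insert x Z" "z' \<in> insert y Z" "v \<in> set (p z)" "v \<in> set (q z')" for z z' v
      proof (cases "v \<in> Z")
        case True
        then show ?thesis using pl(3)[OF z(1)] ql(3)[OF z(2)] z by auto
      next
        case False
        obtain r s where rs: "p z = r @ v # s" using split_list[OF z(3)] by blast
        obtain r' s' where rs': "q z' = r' @ v # s'" using split_list[OF z(4)] by blast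
        have "t \<notin> Z" if t: "t \<in> set (r @ [v])" for t
        proof
          assume "t \<in> Z"
          then have "t = z" using pl(3)[OF z(1)] t rs by auto
          moreover have "z \<noteq> v" using False \<open>t \<in> Z\<close> \<open>t = z\<close> by auto
          ultimately have "z \<in> set r" using t by auto
          moreover have "z \<in> set (v # s)" using p[OF z(1)] rs by (metis last_appendR last_in_set list.distinct(1))
          ultimately show False using gpathD(2)[OF pl(1)[OF z(1)]] rs by auto
        qed
        then have "(hd (r @ [v]), v) \<in> R\<^sup>*"
          using gpath_reach[of E' "r @ [v]" "- Z"] gpathD(4)[OF pl(1)[OF z(1)]] rs
          by (auto simp: R_def successively_append_iff)
        moreover have "hd (r @ [v]) = hd (p z)" using rs by (cases r) auto
        ultimately have 1: "(hd (p z), v) \<in> R\<^sup>*" by simp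
        have "t \<notin> Z" if t: "t \<in> set (v # s')" for t
        proof
          assume "t \<in> Z"
          then have "t = z'" using ql(3)[OF z(2)] t rs' by auto
          moreover have "z' \<noteq> v" using False \<open>t \<in> Z\<close> \<open>t = z'\<close> by auto
          ultimately have "z' \<in> set s'" using t by auto
          moreover have "z' \<in> set (r' @ [v])" using q[OF z(2)] rs' by (cases r') auto
          ultimately show False using gpathD(2)[OF ql(1)[OF z(2)]] rs' by auto
        qed
        then have "set (v # s') \<subseteq> - Z" by blast
        moreover have "successively (\<lambda>x y. (x, y) \<in> E') (v # s')"
          using gpathD(4)[OF ql(1)[OF z(2)]] rs' by (simp add: successively_append_iff)
        ultimately have "(v, last (v # s')) \<in> R\<^sup>*"
          using gpath_reach[of E' "v # s'" "- Z"] by (simp add: R_def)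
        moreover have "last (v # s') = last (q z')" using rs' by simp
        ultimately have 2: "(v, last (q z')) \<in> R\<^sup>*" by simp
        have "(hd (p z), last (q z')) \<in> R\<^sup>*" using 1 2 by simp
        moreover have "hd (p z) \<notin> Z" "last (q z') \<notin> Z"
          using 1 2 False by (metis R_def reach_in E'.reach_sym ComplD ComplI)+
        ultimately have False using Z(2) pl(2)[OF z(1)] ql(2)[OF z(2)]
          by (auto simp: separates_def R_def)
        then show ?thesis ..
      qed
      define f where "f z = (if z = x then y else z)" for z
      have f: "f z \<in> insert y Z" if "z \<in> insert x Z" for z using that by (auto simp: f_def)
      \<comment> \<open>The path ending in \<open>x\<close> continues along the deleted edge to
        \<open>y\<close>. At the other vertices the two paths share \<open>z\<close>, hence the
        \<open>tl\<close>.\<close>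
      define J where "J z = (if z = x then p x @ q y else p z @ tl (q z))" for z
      have Jset: "set (J z) \<subseteq> set (p z) \<union> set (q (f z))" for z
      proof -
        have "set (tl r) \<subseteq> set r" for r :: "'a list" by (cases r) auto
        then show ?thesis by (auto simp: J_def f_def)
      qed
      have Jpath: "gpath E UNIV (J z) \<and> hd (J z) \<in> A \<and> last (J z) \<in> B" if z: "z \<in> insert x Z" for z
      proof -
        have pE: "gpath E UNIV (p z)" and qE: "gpath E UNIV (q (f z))"
          using pl(1)[OF z] ql(1)[OF f[OF z]] E'(2) gpath_mono_edges by blast+
        show ?thesis
        proof (cases "z = x")
          case True
          then have "set (p x) \<inter> set (q y) = {}" using cross[of x y] nxy by auto
          then show ?thesis using True pE qE pl(2)[OF z] ql(2)[of y] p[of x] q[of y] Exy(1)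
            by (auto simp: J_def f_def gpath_def successively_append_iff)
        next
          case False
          then have zZ: "z \<in> Z" using z by auto
          have "set (p z) \<inter> set (q z) = {z}"
            using cross[of z z] pl(3)[of z] ql(3)[of z] zZ by blast
          then have "gpath E UNIV (p z @ tl (q z)) \<and> last (p z @ tl (q z)) = last (q z)"
            using pE qE False p[of z] q[of z] zZ by (intro gpath_join) (auto simp: f_def)
          then show ?thesis using False zZ pl(1,2)[OF z] ql(2)[of z] by (auto simp: J_def gpath_def)
        qed
      qed
      have Jdis: "set (J z) \<inter> set (J z') = {}"
        if z: "z \<in> insert x Z" "z' \<in> insert x Z" "z \<noteq> z'" for z z'
      proof -
        note fz = f[OF z(1)] f[OF z(2)]
        have "p z \<noteq> p z'" using p[OF z(1)] p[OF z(2)] z(3) by metis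
        then have "set (p z) \<inter> set (p z') = {}"
          using P1(1) p[OF z(1)] p[OF z(2)] by (simp add: linkage_def)
        moreover have "f z \<noteq> f z'" using z nxy by (auto simp: f_def)
        then have "q (f z) \<noteq> q (f z')" using q[OF fz(1)] q[OF fz(2)] by metis
        then have "set (q (f z)) \<inter> set (q (f z')) = {}"
          using P2(1) q[OF fz(1)] q[OF fz(2)] by (simp add: linkage_def)
        moreover have "z \<noteq> f z' \<or> z \<notin> Z" "z' \<noteq> f z \<or> z' \<notin> Z"
          using z nxy by (auto simp: f_def)
        then have "set (p z) \<inter> set (q (f z')) = {}" "set (p z') \<inter> set (q (f z)) = {}"
          using cross[OF z(1) fz(2)] cross[OF z(2) fz(1)] by blast+
        ultimately show ?thesis using Jset[of z] Jset[of z'] by blast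
      qed
      have "\<exists>P. linkage E A B P \<and> card P = card (insert x Z)"
        using Z(1) Jpath Jdis by (intro linkageI[of _ J]) auto
      then show ?thesis using cZ by simp
    qed
  qed
qed

section \<open>Tree models and components\<close>

definition biconn :: "('a \<times> 'a) set \<Rightarrow> 'a set \<Rightarrow> bool" where
  "biconn E S \<longleftrightarrow> conn E S \<and> (\<forall>v. conn E (S - {v}))"

lemma gpath_restrict:
  assumes "gpath (E \<inter> S \<times> S) UNIV p" "hd p \<in> S"
  shows "gpath E S p"
proof -
  have "set p \<subseteq> S \<and> successively (\<lambda>x y. (x, y) \<in> E) p"
    if "successively (\<lambda>x y. (x, y) \<in> E \<inter> S \<times> S) p" "p \<noteq> []" "hd p \<in> S"
    using that by (induction p rule: induct_list012) auto
  then show ?thesis using assms by (auto simp: gpath_def)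
qed

lemma conn_edge_out:
  assumes "conn E K" "J \<subseteq> K" "J \<noteq> {}" "J \<noteq> K"
  shows "\<exists>x\<in>J. \<exists>y\<in>K - J. (x, y) \<in> E"
proof (rule ccontr)
  assume neg: "\<not> ?thesis"
  obtain x z where x: "x \<in> J" "z \<in> K" "z \<notin> J" using assms by blast
  have "(x, z) \<in> (E \<inter> K \<times> K)\<^sup>*" using assms x by (auto simp: conn_def)
  then have "z \<in> J"
    by (induction rule: rtrancl_induct) (use x neg in auto)
  with x show False by simp
qed

text \<open>Menger for two paths in the graph induced on \<open>S\<close>: a set of at most one
  vertex neither disconnects \<open>S\<close> nor covers \<open>P\<close> or
  \<open>Q\<close>.\<close>

lemma (in ugraph) biconn_two_paths:
  assumes "finite S" "biconn E S" "P \<subseteq> S" "Q \<subseteq> S" "2 \<le> card P" "2 \<le> card Q"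
  shows "\<exists>p q. gpath E S p \<and> gpath E S q \<and> set p \<inter> set q = {} \<and> set p \<inter> P = {hd p} \<and>
     set p \<inter> Q = {last p} \<and> set q \<inter> P = {hd q} \<and> set q \<inter> Q = {last q}"
proof -
  define E0 where "E0 = E \<inter> S \<times> S"
  have fin: "finite E0" "finite P" "finite Q"
    using assms(1,3,4) finite_subset by (auto simp: E0_def)
  have symE0: "sym E0" using sym_E by (auto simp: E0_def sym_def)
  have sep: "2 \<le> card Z" if Z: "finite Z" "separates E0 P Q Z" for Z
  proof (rule ccontr)
    assume "\<not> 2 \<le> card Z"
    then have "card Z = 0 \<or> card Z = 1" by linarith
    then have "Z = {} \<or> (\<exists>v. Z = {v})" using Z(1) by (auto simp: card_1_singleton_iff)
    then have co: "conn E (S - Z)" using assms(2) unfolding biconn_def by (metis Diff_empty)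
    have "\<not> P \<subseteq> Z" "\<not> Q \<subseteq> Z"
      using card_mono[OF Z(1), of P] card_mono[OF Z(1), of Q] assms(5,6) \<open>\<not> 2 \<le> card Z\<close> by linarith+
    then obtain x y where xy: "x \<in> P - Z" "y \<in> Q - Z" by blast
    then have "(x, y) \<in> (E \<inter> (S - Z) \<times> (S - Z))\<^sup>*" using co assms(3,4) by (auto simp: conn_def)
    moreover have "E \<inter> (S - Z) \<times> (S - Z) \<subseteq> E0 \<inter> (- Z) \<times> (- Z)" by (auto simp: E0_def)
    ultimately have "(x, y) \<in> (E0 \<inter> (- Z) \<times> (- Z))\<^sup>*" by (meson rtrancl_mono subsetD)
    with xy Z(2) show False by (auto simp: separates_def)
  qed
  obtain L where L: "linkage E0 P Q L" "card L = 2"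
    using menger[OF fin(1) symE0 fin(2,3) sep] by blast
  then obtain p q where pq: "L = {p, q}" "p \<noteq> q" by (auto simp: card_2_iff)
  have "gpath E S r" if "r \<in> L" for r
    using linkageD(1,4)[OF L(1) that] assms(3) by (rule_tac gpath_restrict) (auto simp: E0_def)
  moreover have "set p \<inter> set q = {}" using L(1) pq by (auto simp: linkage_def)
  moreover have "p \<in> L" "q \<in> L" using pq by auto
  moreover note linkageD(2,3)[OF L(1) \<open>p \<in> L\<close>] linkageD(2,3)[OF L(1) \<open>q \<in> L\<close>]
  ultimately show ?thesis by (intro exI[of _ p] exI[of _ q] conjI) simp_all
qed

section \<open>Branch set models of trees and of \<open>Gamma_plus\<close>\<close>

abbreviation words :: "nat \<Rightarrow> bool list set" where
  "words k \<equiv> {w. length w \<le> k}"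

text \<open>
  A model of the forest induced by a set of words: as in \<^const>\<open>Gamma\<close>, the parent of \<open>b # w\<close>
  is \<open>w\<close>, so the descendants of \<open>v\<close> are the words \<open>u @ v\<close>.
\<close>

definition tmodel :: "('a \<times> 'a) set \<Rightarrow> bool list set \<Rightarrow> (bool list \<Rightarrow> 'a set) \<Rightarrow> 'a set \<Rightarrow> bool" where
  "tmodel E W \<psi> S \<longleftrightarrow> (\<forall>w\<in>W. conn E (\<psi> w) \<and> \<psi> w \<subseteq> S) \<and>
     (\<forall>w\<in>W. \<forall>w'\<in>W. w \<noteq> w' \<longrightarrow> \<psi> w \<inter> \<psi> w' = {}) \<and>
     (\<forall>w b. w \<in> W \<longrightarrow> b # w \<in> W \<longrightarrow> touches E (\<psi> w) (\<psi> (b # w)))"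

definition subtree :: "(bool list \<Rightarrow> 'a set) \<Rightarrow> nat \<Rightarrow> bool list \<Rightarrow> 'a set" where
  "subtree \<psi> m v = (\<Union>u\<in>words m. \<psi> (u @ v))"

text \<open>A model of \<open>Gamma_plus l\<close> in which \<open>Q\<close> is the branch set of
  the added vertex. The prescribed vertices in the root set and in \<open>Q\<close> are the points
  at which two such models can be glued.\<close>

definition rgplus :: "('a \<times> 'a) set \<Rightarrow> nat \<Rightarrow> 'a \<Rightarrow> 'a \<Rightarrow> 'a set \<Rightarrow> bool" where
  "rgplus E l a b S \<longleftrightarrow> (\<exists>\<psi> Q. tmodel E (words l) \<psi> S \<and> conn E Q \<and> Q \<subseteq> S \<and>
     (\<forall>w\<in>words l. \<psi> w \<inter> Q = {}) \<and> (\<forall>w. length w = l \<longrightarrow> touches E (\<psi> w) Q) \<and>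
     a \<in> \<psi> [] \<and> b \<in> Q)"

definition gplus :: "('a \<times> 'a) set \<Rightarrow> nat \<Rightarrow> 'a set \<Rightarrow> bool" where
  "gplus E l S \<longleftrightarrow> (\<exists>a b. rgplus E l a b S)"

lemma gplusI:
  assumes "tmodel E (words l) \<psi> S" "conn E Q" "Q \<subseteq> S"
    "\<And>w. length w \<le> l \<Longrightarrow> \<psi> w \<inter> Q = {}" "\<And>w. length w = l \<Longrightarrow> touches E (\<psi> w) Q"
  shows "gplus E l S"
proof -
  obtain b where "b \<in> Q" using assms(2) by (auto simp: conn_def)
  moreover obtain a where "a \<in> \<psi> []" using assms(1) by (fastforce simp: tmodel_def conn_def)
  ultimately show ?thesis using assms unfolding gplus_def rgplus_def by blast
qed

lemma tmodelD:
  assumes "tmodel E W \<psi> S"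
  shows "w \<in> W \<Longrightarrow> conn E (\<psi> w)" "w \<in> W \<Longrightarrow> \<psi> w \<subseteq> S"
    "w \<in> W \<Longrightarrow> w' \<in> W \<Longrightarrow> w \<noteq> w' \<Longrightarrow> \<psi> w \<inter> \<psi> w' = {}"
    "w \<in> W \<Longrightarrow> b # w \<in> W \<Longrightarrow> touches E (\<psi> w) (\<psi> (b # w))"
  using assms by (auto simp: tmodel_def)

lemma tmodel_mono: "tmodel E W \<psi> S \<Longrightarrow> S \<subseteq> S' \<Longrightarrow> tmodel E W \<psi> S'"
  unfolding tmodel_def by (meson subset_trans)

lemma rgplus_mono: "rgplus E l a b S \<Longrightarrow> S \<subseteq> S' \<Longrightarrow> rgplus E l a b S'"
  unfolding rgplus_def by (meson subset_trans tmodel_mono)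

lemma gplus_mono: "gplus E l S \<Longrightarrow> S \<subseteq> S' \<Longrightarrow> gplus E l S'"
  unfolding gplus_def by (meson rgplus_mono)

lemma subtree_subset:
  assumes "tmodel E (words k) \<psi> S" "m + length v \<le> k"
  shows "subtree \<psi> m v \<subseteq> S"
  unfolding subtree_def by (rule UN_least, rule tmodelD(2)[OF assms(1)]) (use assms(2) in auto)

lemma tmodel_subtree:
  assumes "tmodel E (words k) \<psi> S" "m + length v \<le> k" "subtree \<psi> m v \<subseteq> T"
  shows "tmodel E (words m) (\<lambda>u. \<psi> (u @ v)) T"
  using assms(2,3) tmodelD[OF assms(1)] unfolding tmodel_def subtree_def
  by (auto simp del: append_Cons simp: append_Cons[symmetric]) (simp add: append_Cons)

context ugraph
begin

text \<open>By \<open>anc\<close>, dropping letters leads from any word of \<open>W'\<close> to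
  \<open>r\<close> inside \<open>W'\<close>, so an induction on words reaches every branch set from
  \<open>r\<close>. This serves both for the words below a node and for those not below it.\<close>

lemma conn_subtree:
  assumes T: "tmodel E W \<psi> S" "W' \<subseteq> W" "r \<in> W'"
    and anc: "\<And>w. w \<in> W' \<Longrightarrow> w = r \<or> (\<exists>b u. w = b # u \<and> u \<in> W')"
  shows "conn E (\<Union>w\<in>W'. \<psi> w)"
proof -
  define U where "U = (\<Union>w\<in>W'. \<psi> w)"
  have co: "conn E (\<psi> w)" if "w \<in> W'" for w using tmodelD(1)[OF T(1)] T(2) that by blast
  obtain x where x: "x \<in> \<psi> r" using co[OF T(3)] by (auto simp: conn_def)
  have inner: "(y, z) \<in> (E \<inter> U \<times> U)\<^sup>*" if "w \<in> W'" "y \<in> \<psi> w" "z \<in> \<psi> w" for w y z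
  proof -
    have "(y, z) \<in> (E \<inter> \<psi> w \<times> \<psi> w)\<^sup>*" using co that by (auto simp: conn_def)
    then show ?thesis by (rule reach_mono) (use that in \<open>auto simp: U_def\<close>)
  qed
  have "\<forall>y\<in>\<psi> w. (x, y) \<in> (E \<inter> U \<times> U)\<^sup>*" if "w \<in> W'" for w
    using that
  proof (induction w)
    case Nil
    then have "r = []" using anc by blast
    then show ?case using inner[OF T(3) x] by blast
  next
    case (Cons b u)
    show ?case
    proof (cases "b # u = r")
      case True
      then show ?thesis using inner[OF T(3) x] by blast
    next
      case False
      then have u: "u \<in> W'" using anc[OF Cons.prems] by blast
      then have "touches E (\<psi> u) (\<psi> (b # u))" using tmodelD(4)[OF T(1)] T(2) Cons.prems by blast
      then obtain s t where st: "s \<in> \<psi> u" "t \<in> \<psi> (b # u)" "(s, t) \<in> E" by (auto simp: touches_def)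
      then have "(s, t) \<in> E \<inter> U \<times> U" using u Cons.prems by (auto simp: U_def)
      moreover have "(x, s) \<in> (E \<inter> U \<times> U)\<^sup>*" using Cons.IH[OF u] st by blast
      ultimately have "(x, t) \<in> (E \<inter> U \<times> U)\<^sup>*" by (rule rtrancl_into_rtrancl[rotated])
      then show ?thesis using inner[OF Cons.prems st(2)] by (meson rtrancl_trans)
    qed
  qed
  then have "conn E U"
    using x T(3) by (intro connI[of x]) (auto simp: U_def)
  then show ?thesis by (simp add: U_def)
qed

lemma conn_subtree_below:
  assumes "tmodel E (words k) \<psi> S" "m + length v \<le> k"
  shows "conn E (subtree \<psi> m v)"
proof -
  have "conn E (\<Union>w\<in>(\<lambda>u. u @ v) ` words m. \<psi> w)"
  proof (rule conn_subtree[OF assms(1), of _ v])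
    show "v \<in> (\<lambda>u. u @ v) ` words m" by (auto intro: image_eqI[of _ _ "[]"])
    fix w assume "w \<in> (\<lambda>u. u @ v) ` words m"
    then obtain u where u: "w = u @ v" "length u \<le> m" by auto
    then show "w = v \<or> (\<exists>b ua. w = b # ua \<and> ua \<in> (\<lambda>u. u @ v) ` words m)"
      by (cases u) auto
  qed (use assms in auto)
  then show ?thesis by (simp add: subtree_def)
qed

lemma conn_subtree_rest:
  assumes "tmodel E (words k) \<psi> S" "m \<le> k" "v \<noteq> []"
  shows "conn E (\<Union>w\<in>{w. length w \<le> m \<and> (\<nexists>u. w = u @ v)}. \<psi> w)"
proof (rule conn_subtree[OF assms(1), of _ "[]"])
  fix w assume w: "w \<in> {w. length w \<le> m \<and> (\<nexists>u. w = u @ v)}"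
  then show "w = [] \<or> (\<exists>b u. w = b # u \<and> u \<in> {w. length w \<le> m \<and> (\<nexists>u. w = u @ v)})"
  proof (cases w)
    case (Cons b u)
    have "\<nexists>u'. u = u' @ v"
    proof
      assume "\<exists>u'. u = u' @ v"
      then obtain u' where "w = (b # u') @ v" using Cons by auto
      with w show False by blast
    qed
    with w Cons show ?thesis by auto
  qed simp
qed (use assms in auto)

end

text \<open>Connected and closed under the edges inside \<open>S - X\<close>: exactly a component of
  the graph induced on \<open>S - X\<close>.\<close>

definition piece :: "('a \<times> 'a) set \<Rightarrow> 'a set \<Rightarrow> 'a set \<Rightarrow> 'a set \<Rightarrow> bool" where
  "piece E S X K \<longleftrightarrow> conn E K \<and> K \<subseteq> S - X \<and> (\<forall>x\<in>K. \<forall>y\<in>S - X. (x, y) \<in> E \<longrightarrow> y \<in> K)"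

context ugraph
begin

lemma piece_comp_of:
  assumes "x \<in> S - X" shows "piece E S X (comp_of E (S - X) x)"
  unfolding piece_def using conn_comp_of[OF assms] comp_of_subset[OF assms] comp_of_step[OF _ _ _ assms]
  by blast

text \<open>Depth 2 is chosen because it has four nodes: the components selected below them are
  disjoint, each of \<open>a\<close> and \<open>b\<close> spoils at most one, and two
  remain.\<close>

lemma split_pieces:
  assumes T: "tmodel E (words k) \<psi> S" and k: "l + 3 \<le> k" and no: "\<not> gplus E l S"
  shows "\<exists>X K1 K2 \<psi>1 \<psi>2. conn E X \<and> X \<subseteq> S \<and> piece E S X K1 \<and> piece E S X K2 \<and> K1 \<inter> K2 = {} \<and>
    a \<notin> K1 \<union> K2 \<and> b \<notin> K1 \<union> K2 \<and>
    tmodel E (words (k - l - 3)) \<psi>1 K1 \<and> tmodel E (words (k - l - 3)) \<psi>2 K2"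
proof -
  define U where "U = subtree \<psi> (l + 2) []"
  \<comment> \<open>The \<open>False\<close>-child of a node \<open>u @ v\<close> of depth
    \<open>l + 2\<close>. One subtree below each lowest node of \<open>U\<close> is enough, and it
    has height \<open>k - l - 3\<close>.\<close>
  define N where "N v u = False # u @ v" for v u :: "bool list"
  define P where "P v u = (SOME x. x \<in> \<psi> (N v u))" for v u
  define K where "K v u = comp_of E (S - U) (P v u)" for v u
  have US: "U \<subseteq> S" unfolding U_def using k by (intro subtree_subset[OF T]) simp
  have U_up: "\<psi> w \<subseteq> U" if "length w \<le> l + 2" for w
    unfolding U_def subtree_def using that by (intro order_trans[OF _ UN_upper[of w]]) auto
  have below: "subtree \<psi> (k - l - 3) (N v u) \<subseteq> S - U" "conn E (subtree \<psi> (k - l - 3) (N v u))"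
    "P v u \<in> \<psi> (N v u)" "\<psi> (N v u) \<subseteq> subtree \<psi> (k - l - 3) (N v u)"
    if "length v = 2" "length u = l" for u v
  proof -
    have len: "length (N v u) = l + 3" using that by (simp add: N_def)
    show "conn E (subtree \<psi> (k - l - 3) (N v u))"
      using len k by (intro conn_subtree_below[OF T]) auto
    show "subtree \<psi> (k - l - 3) (N v u) \<subseteq> S - U"
    proof
      fix x assume "x \<in> subtree \<psi> (k - l - 3) (N v u)"
      then obtain w where w: "length w \<le> k - l - 3" "x \<in> \<psi> (w @ N v u)" by (auto simp: subtree_def)
      have wk: "w @ N v u \<in> words k" using w(1) len k by auto
      have "x \<notin> \<psi> w'" if "length w' \<le> l + 2" for w'
      proof -
        have "length (w @ N v u) \<noteq> length w'" using that len by simp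
        then have "w @ N v u \<noteq> w'" by metis
        then show ?thesis using tmodelD(3)[OF T wk, of w'] that k w(2) by auto
      qed
      then have "x \<notin> U" by (auto simp: U_def subtree_def)
      with tmodelD(2)[OF T wk] w(2) show "x \<in> S - U" by blast
    qed
    have "\<psi> (N v u) \<noteq> {}" using conn_nonempty[OF tmodelD(1)[OF T]] len k by auto
    then show "P v u \<in> \<psi> (N v u)" unfolding P_def by (simp add: some_in_eq)
    show "\<psi> (N v u) \<subseteq> subtree \<psi> (k - l - 3) (N v u)"
      unfolding subtree_def by (rule order_trans[OF _ UN_upper[of "[]"]]) auto
  qed
  have PS: "P v u \<in> S - U" if "length v = 2" "length u = l" for u v
    using below[OF that] by blast
  have pK: "piece E S U (K v u)" if "length v = 2" "length u = l" for u v
    unfolding K_def using PS[OF that] by (rule piece_comp_of)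
  have subK: "subtree \<psi> (k - l - 3) (N v u) \<subseteq> K v u" if "length v = 2" "length u = l" for u v
    unfolding K_def using below[OF that] comp_of_refl by (intro conn_subset_comp_of[of _ _ _ "P v u"]) auto
  have tK: "touches E (\<psi> (u @ v)) (K v u)" if "length v = 2" "length u = l" for u v
  proof -
    have "touches E (\<psi> (u @ v)) (\<psi> (N v u))"
      unfolding N_def using that k tmodelD(4)[OF T, of "u @ v" False] by simp
    then show ?thesis by (rule touches_mono) (use below(4)[OF that] subK[OF that] in auto)
  qed
  have "\<exists>u. length u = l \<and> \<not> touches E (K v u) (U - subtree \<psi> l v)" if v: "length v = 2" for v
  proof (rule ccontr)
    assume "\<not> ?thesis"
    then have tch: "touches E (K v u) (U - subtree \<psi> l v)" if "length u = l" for u using that by blast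
    \<comment> \<open>\<open>U - subtree \<psi> l v\<close>, written as a union of branch sets so
      that \<open>conn_subtree_rest\<close> shows it connected. It is the core of the apex.\<close>
    define D where "D = (\<Union>w\<in>{w. length w \<le> l + 2 \<and> (\<nexists>u. w = u @ v)}. \<psi> w)"
    have D_eq: "D = U - subtree \<psi> l v"
    proof
      have "\<psi> w \<inter> \<psi> (u @ v) = {}" if "length w \<le> l + 2" "\<nexists>u. w = u @ v" "length u \<le> l" for w u
        using that v k by (intro tmodelD(3)[OF T]) auto
      then show "D \<subseteq> U - subtree \<psi> l v" unfolding D_def U_def subtree_def by fastforce
      show "U - subtree \<psi> l v \<subseteq> D"
      proof
        fix x assume x: "x \<in> U - subtree \<psi> l v"
        then obtain w where w: "length w \<le> l + 2" "x \<in> \<psi> w" by (auto simp: U_def subtree_def)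
        have "\<nexists>u. w = u @ v"
        proof
          assume "\<exists>u. w = u @ v"
          then obtain u where "w = u @ v" by blast
          then have "x \<in> subtree \<psi> l v" using w v by (auto simp: subtree_def)
          with x show False by simp
        qed
        with w show "x \<in> D" by (auto simp: D_def)
      qed
    qed
    have "conn E D" unfolding D_def using v k by (intro conn_subtree_rest[OF T]) auto
    then have "conn E (D \<union> (\<Union>u\<in>{u. length u = l}. K v u))"
      using pK[OF v] touches_sym[OF tch] D_eq by (intro conn_UN) (auto simp: piece_def)
    moreover have "tmodel E (words l) (\<lambda>u. \<psi> (u @ v)) S"
      using v k by (intro tmodel_subtree[OF T] subtree_subset[OF T]) auto
    moreover have "D \<union> (\<Union>u\<in>{u. length u = l}. K v u) \<subseteq> S"
      using pK[OF v] US D_eq by (auto simp: piece_def)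
    moreover have "\<psi> (w @ v) \<inter> (D \<union> (\<Union>u\<in>{u. length u = l}. K v u)) = {}" if "length w \<le> l" for w
    proof -
      have "\<psi> (w @ v) \<subseteq> U" using that v by (intro U_up) simp
      moreover have "\<psi> (w @ v) \<subseteq> subtree \<psi> l v" using that by (auto simp: subtree_def)
      moreover have "K v u \<inter> U = {}" if "length u = l" for u using pK[OF v that] by (auto simp: piece_def)
      ultimately show ?thesis using D_eq by blast
    qed
    moreover have "touches E (\<psi> (w @ v)) (D \<union> (\<Union>u\<in>{u. length u = l}. K v u))" if "length w = l" for w
      using tK[OF v that] by (rule touches_mono) (use that in auto)
    ultimately have "gplus E l S" by (intro gplusI[of E l "\<lambda>u. \<psi> (u @ v)" S]) auto
    with no show False ..
  qed
  then obtain u where u: "\<And>v. length v = 2 \<Longrightarrow> length (u v) = l \<and> \<not> touches E (K v (u v)) (U - subtree \<psi> l v)"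
    by metis
  define C where "C v = K v (u v)" for v
  \<comment> \<open>If the components selected for \<open>v\<close> and \<open>v'\<close> coincided,
    \<open>C v\<close> would have a neighbour in the branch set from which \<open>C v'\<close>
    hangs, and this set lies in \<open>U\<close> but not below \<open>v\<close>.\<close>
  have dis: "C v \<inter> C v' = {}" if v: "length v = 2" "length v' = 2" "v \<noteq> v'" for v v'
  proof (rule ccontr)
    assume "C v \<inter> C v' \<noteq> {}"
    then have "C v = C v'"
      unfolding C_def K_def using PS u v comp_of_eq by (metis disjoint_iff)
    then have tC: "touches E (C v) (\<psi> (u v' @ v'))"
      using tK[OF v(2)] u[OF v(2)] touches_sym by (metis C_def)
    have "\<psi> (u v' @ v') \<inter> \<psi> (w @ v) = {}" if "length w \<le> l" for w
      using that v u[OF v(2)] k by (intro tmodelD(3)[OF T]) auto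
    then have "\<psi> (u v' @ v') \<inter> subtree \<psi> l v = {}" by (auto simp: subtree_def)
    moreover have "\<psi> (u v' @ v') \<subseteq> U" using u[OF v(2)] v by (intro U_up) simp
    ultimately have "\<psi> (u v' @ v') \<subseteq> U - subtree \<psi> l v" by blast
    with tC have "touches E (C v) (U - subtree \<psi> l v)" by (meson order_refl touches_mono)
    with u[OF v(1)] show False by (simp add: C_def)
  qed
  have "\<exists>v v'. length v = 2 \<and> length v' = 2 \<and> v \<noteq> v' \<and> a \<notin> C v \<union> C v' \<and> b \<notin> C v \<union> C v'"
  proof -
    define V where "V = {v :: bool list. length v = 2}"
    define Va where "Va x = {v \<in> V. x \<in> C v}" for x
    have V: "finite V" "card V = 4"
      unfolding V_def using finite_lists_length_eq[of "UNIV :: bool set" 2]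
        card_lists_length_eq[of "UNIV :: bool set" 2] by simp_all
    have finV: "finite (Va x)" for x using V(1) by (auto simp: Va_def)
    have Va: "card (Va x) \<le> Suc 0" for x
    proof -
      have "\<forall>v\<in>Va x. \<forall>v'\<in>Va x. v = v'" using dis unfolding Va_def V_def by blast
      then show ?thesis using card_le_Suc0_iff_eq[OF finV] by blast
    qed
    have "card (Va a \<union> Va b) \<le> 2" using card_Un_le[of "Va a" "Va b"] Va[of a] Va[of b] by linarith
    moreover have "card V - card (Va a \<union> Va b) \<le> card (V - (Va a \<union> Va b))"
      using finV by (intro diff_card_le_card_Diff) auto
    ultimately have "\<not> card (V - (Va a \<union> Va b)) \<le> Suc 0" using V(2) by linarith
    moreover have "finite (V - (Va a \<union> Va b))" using V(1) by simp
    ultimately obtain v v' where "v \<in> V - (Va a \<union> Va b)" "v' \<in> V - (Va a \<union> Va b)" "v \<noteq> v'"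
      using card_le_Suc0_iff_eq by blast
    then show ?thesis by (intro exI[of _ v] exI[of _ v']) (auto simp: V_def Va_def)
  qed
  then obtain v v' where v: "length v = 2" "length v' = 2" "v \<noteq> v'"
    and ab: "a \<notin> C v \<union> C v'" "b \<notin> C v \<union> C v'" by blast
  have "conn E U" unfolding U_def using k by (intro conn_subtree_below[OF T]) simp
  moreover have "piece E S U (C v)" "piece E S U (C v')" using pK u v by (auto simp: C_def)
  moreover have "\<exists>\<psi>'. tmodel E (words (k - l - 3)) \<psi>' (C w)" if "length w = 2" for w
  proof
    have "length (N w (u w)) = l + 3" using u[OF that] that by (simp add: N_def)
    then show "tmodel E (words (k - l - 3)) (\<lambda>x. \<psi> (x @ N w (u w))) (C w)"
      using subK[OF that] u[OF that] k by (intro tmodel_subtree[OF T]) (auto simp: C_def)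
  qed
  then obtain \<psi>1 \<psi>2 where "tmodel E (words (k - l - 3)) \<psi>1 (C v)" "tmodel E (words (k - l - 3)) \<psi>2 (C v')"
    using v by meson
  ultimately show ?thesis using US dis[OF v] ab
    by (intro exI[of _ U] exI[of _ "C v"] exI[of _ "C v'"] exI[of _ \<psi>1] exI[of _ \<psi>2] conjI)
qed

end

section \<open>Blocks\<close>

context ugraph
begin

text \<open>Induction on the size of \<open>K\<close>. A cutvertex \<open>c\<close> of
  \<open>K\<close> lies outside \<open>T\<close>, so \<open>T\<close> stays in one component
  \<open>J\<close> of \<open>K - {c}\<close>, and \<open>insert c J\<close> is smaller than
  \<open>K\<close>. The hypothesis on \<open>T\<close> is inherited: for \<open>s\<close> in
  \<open>T\<close>, a part of \<open>insert c J - {s}\<close> not joined to \<open>c\<close> would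
  have no way out in \<open>K - {s}\<close> either.\<close>

lemma block_exists:
  assumes "finite K" "conn E K" "T \<subseteq> K" "conn E T" "x \<in> T" "y \<in> T" "x \<noteq> y"
    and "\<And>c. c \<in> T \<Longrightarrow> conn E (K - {c})"
  shows "\<exists>B. T \<subseteq> B \<and> B \<subseteq> K \<and> biconn E B"
  using assms
proof (induction "card K" arbitrary: K rule: less_induct)
  case less
  show ?case
  proof (cases "\<forall>c\<in>K. conn E (K - {c})")
    case True
    have "conn E (K - {c})" for c
      using True less.prems(2) by (cases "c \<in> K") auto
    then have "biconn E K" using less.prems(2) by (simp add: biconn_def)
    then show ?thesis using less.prems(3) by blast
  next
    case False
    then obtain c where c: "c \<in> K" "\<not> conn E (K - {c})" by blast
    then have cT: "c \<notin> T" using less.prems(8) by blast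
    define J where "J = comp_of E (K - {c}) x"
    have x: "x \<in> K - {c}" using less.prems cT by blast
    have J: "J \<subseteq> K - {c}" "conn E J" "x \<in> J"
      unfolding J_def using comp_of_subset[OF x] conn_comp_of[OF x] comp_of_refl by auto
    have TJ: "T \<subseteq> J"
      unfolding J_def using less.prems cT comp_of_refl by (intro conn_subset_comp_of[of _ _ _ x]) auto
    have Jclosed: "v \<in> J" if "u \<in> J" "(u, v) \<in> E" "v \<in> K" "v \<noteq> c" for u v
      using that comp_of_step[OF _ _ _ x] unfolding J_def by blast
    define K' where "K' = insert c J"
    have JK: "J \<noteq> K - {c}" using J(2) c(2) by blast
    have K': "K' \<subseteq> K" "K' \<noteq> K" using J(1) c(1) JK by (auto simp: K'_def)
    have "\<exists>u\<in>J. \<exists>v\<in>K - J. (u, v) \<in> E"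
      using J c(1) less.prems(2) by (intro conn_edge_out) auto
    then obtain u where u: "u \<in> J" "(u, c) \<in> E" using Jclosed by blast
    have cK': "conn E K'" unfolding K'_def using J(2) u by (intro conn_insert) auto
    have step: "conn E (K' - {s})" if s: "s \<in> T" for s
    proof -
      have sc: "s \<noteq> c" using s cT by blast
      define C where "C = comp_of E (K' - {s}) c"
      have c': "c \<in> K' - {s}" using sc by (simp add: K'_def)
      have C: "C \<subseteq> K' - {s}" "c \<in> C" unfolding C_def using comp_of_subset[OF c'] comp_of_refl by auto
      have "C = K' - {s}"
      proof (rule ccontr)
        assume ne: "C \<noteq> K' - {s}"
        define R where "R = K' - {s} - C"
        have "\<exists>r\<in>R. \<exists>v\<in>K - {s} - R. (r, v) \<in> E"
          using less.prems(8)[OF s] ne C K'(1) c(1) sc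
          by (intro conn_edge_out) (auto simp: R_def)
        then obtain r v where rv: "r \<in> R" "v \<in> K - {s} - R" "(r, v) \<in> E" by blast
        have rJ: "r \<in> J" using rv(1) C(2) by (auto simp: R_def K'_def)
        have "v \<in> K'"
          using Jclosed[OF rJ rv(3)] rv(2) by (auto simp: K'_def)
        then have "v \<in> C" using rv(2) by (auto simp: R_def)
        then have "r \<in> C" using comp_of_step[of v E "K' - {s}" c r] sym[OF rv(3)] rv(1) c'
          by (auto simp: C_def R_def)
        with rv(1) show False by (simp add: R_def)
      qed
      then show ?thesis using conn_comp_of[OF c'] by (simp add: C_def)
    qed
    have "\<exists>B. T \<subseteq> B \<and> B \<subseteq> K' \<and> biconn E B"
    proof (rule less.hyps)
      show "card K' < card K" using K' less.prems(1) by (simp add: psubset_card_mono psubsetI)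
      show "finite K'" using K'(1) less.prems(1) finite_subset by blast
      show "T \<subseteq> K'" using TJ by (auto simp: K'_def)
    qed (use cK' step less.prems in auto)
    then show ?thesis using K'(1) by blast
  qed
qed

text \<open>
  If every subtree rooted at depth \<open>l\<close> contained a cutvertex of \<open>K\<close>, then the part of \<open>K\<close> cut off
  by that vertex could be added to the subtree, and it has a neighbour in \<open>X\<close>; contracting \<open>X\<close>
  would give the apex vertex.
\<close>

lemma block_in_piece:
  assumes S: "finite S" "biconn E S" and X: "conn E X" "X \<subseteq> S" and K: "piece E S X K"
    and T: "tmodel E (words n) \<psi> K" and l: "1 \<le> l" "l < n" and no: "\<not> gplus E l S"
  shows "\<exists>B \<psi>'. B \<subseteq> K \<and> biconn E B \<and> tmodel E (words (n - l)) \<psi>' B"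
proof -
  have KS: "K \<subseteq> S - X" "conn E K" using K by (auto simp: piece_def)
  have finK: "finite K" using KS S(1) finite_subset by blast
  define V where "V t = subtree \<psi> (n - l) t" for t
  have V: "V t \<subseteq> K" "conn E (V t)" "\<psi> t \<subseteq> V t" if "length t = l" for t
  proof -
    show "V t \<subseteq> K" unfolding V_def using that l by (intro subtree_subset[OF T]) auto
    show "conn E (V t)" unfolding V_def using that l by (intro conn_subtree_below[OF T]) auto
    show "\<psi> t \<subseteq> V t"
      unfolding V_def subtree_def by (rule order_trans[OF _ UN_upper[of "[]"]]) auto
  qed
  show ?thesis
  proof (cases "\<exists>t. length t = l \<and> (\<forall>c\<in>V t. conn E (K - {c}))")
    case True
    then obtain t where t: "length t = l" "\<And>c. c \<in> V t \<Longrightarrow> conn E (K - {c})" by blast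
    \<comment> \<open>By \<open>l < n\<close> the node \<open>t\<close> still has a child in the
      model, which supplies a second vertex of \<open>V t\<close>.\<close>
    have w: "t \<in> words n" "False # t \<in> words n" using t l by auto
    obtain x where x: "x \<in> \<psi> t" using conn_nonempty[OF tmodelD(1)[OF T w(1)]] by blast
    obtain y where y: "y \<in> \<psi> (False # t)" using conn_nonempty[OF tmodelD(1)[OF T w(2)]] by blast
    have "t \<noteq> False # t" by (metis not_Cons_self)
    then have "x \<noteq> y" using tmodelD(3)[OF T w] x y by blast
    moreover have "\<psi> (False # t) \<subseteq> V t"
      unfolding V_def subtree_def using l by (intro order_trans[OF _ UN_upper[of "[False]"]]) auto
    ultimately obtain B where B: "V t \<subseteq> B" "B \<subseteq> K" "biconn E B"
      using block_exists[OF finK KS(2) V(1,2)[OF t(1)] _ _ _ t(2), of x y] x y V(3)[OF t(1)] by blast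
    have "tmodel E (words (n - l)) (\<lambda>u. \<psi> (u @ t)) B"
      using t l B(1) by (intro tmodel_subtree[OF T]) (auto simp: V_def)
    with B show ?thesis by blast
  next
    case False
    then have "\<forall>t. \<exists>c. length t = l \<longrightarrow> c \<in> V t \<and> \<not> conn E (K - {c})" by blast
    then obtain c where c: "\<And>t. length t = l \<Longrightarrow> c t \<in> V t \<and> \<not> conn E (K - {c t})" by metis
    define R where "R t = (\<Union>w\<in>{w. length w \<le> n \<and> (\<nexists>u. w = u @ t)}. \<psi> w)" for t
    have R: "conn E (R t)" if "length t = l" for t
      unfolding R_def using that l by (intro conn_subtree_rest[OF T]) auto
    have RV: "R t \<inter> V t = {}" if t: "length t = l" for t
    proof -
      have "\<psi> w \<inter> \<psi> (u @ t) = {}" if "length w \<le> n" "\<nexists>u. w = u @ t" "length u \<le> n - l" for w u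
        using that t l by (intro tmodelD(3)[OF T]) auto
      then show ?thesis unfolding R_def V_def subtree_def by blast
    qed
    have RK: "R t \<subseteq> K" for t using tmodelD(2)[OF T] by (auto simp: R_def)
    have R_up: "\<psi> w \<subseteq> R t" if "length w \<le> n" "\<nexists>u. w = u @ t" for w t
      unfolding R_def using that by (intro UN_upper) simp
    have inR: "\<psi> w \<subseteq> R t" if "length w < l" "length t = l" for w t
    proof -
      have "w \<noteq> u @ t" for u using that by auto
      then show ?thesis using that l by (intro R_up) auto
    qed
    have VR: "V s \<subseteq> R t" if "length s = l" "length t = l" "s \<noteq> t" for s t
    proof -
      have "u @ s \<noteq> u' @ t" for u u' using that by auto
      then show ?thesis unfolding V_def subtree_def using that l by (intro UN_least R_up) auto
    qed
    \<comment> \<open>\<open>J\<close> is a component of \<open>K - {c t}\<close> other than the one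
      that contains \<open>R t\<close>, the part of the tree not below \<open>t\<close>.\<close>
    have "\<exists>J. conn E J \<and> J \<subseteq> K - {c t} \<and> J \<inter> R t = {} \<and>
        (\<forall>u\<in>J. \<forall>v\<in>K - {c t}. (u, v) \<in> E \<longrightarrow> v \<in> J)" if t: "length t = l" for t
    proof -
      have RKc: "R t \<subseteq> K - {c t}" using RK RV[OF t] c[OF t] by blast
      obtain x where x: "x \<in> R t" using conn_nonempty[OF R[OF t]] by blast
      then have xK: "x \<in> K - {c t}" using RKc by blast
      have "R t \<subseteq> comp_of E (K - {c t}) x"
        using R[OF t] RKc x comp_of_refl by (intro conn_subset_comp_of[of _ _ _ x]) auto
      moreover have "comp_of E (K - {c t}) x \<noteq> K - {c t}"
        using conn_comp_of[OF xK] c[OF t] by metis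
      then obtain z where z: "z \<in> K - {c t}" "z \<notin> comp_of E (K - {c t}) x"
        using comp_of_subset[OF xK] by blast
      moreover have "comp_of E (K - {c t}) z \<inter> comp_of E (K - {c t}) x = {}"
        using comp_of_eq[OF _ _ z(1) xK] z(2) comp_of_refl by (metis disjoint_iff)
      ultimately show ?thesis
        using conn_comp_of[OF z(1)] comp_of_subset[OF z(1)] comp_of_step[OF _ _ _ z(1)]
        by (intro exI[of _ "comp_of E (K - {c t}) z"]) blast
    qed
    then obtain J where J: "\<And>t. length t = l \<Longrightarrow> conn E (J t)" "\<And>t. length t = l \<Longrightarrow> J t \<subseteq> K - {c t}"
      "\<And>t. length t = l \<Longrightarrow> J t \<inter> R t = {}"
      "\<And>t u v. length t = l \<Longrightarrow> u \<in> J t \<Longrightarrow> v \<in> K - {c t} \<Longrightarrow> (u, v) \<in> E \<Longrightarrow> v \<in> J t"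
      by metis
    have cK: "c t \<in> K" if "length t = l" for t using c[OF that] V(1)[OF that] by blast
    \<comment> \<open>\<open>S - {c t}\<close> is connected, so an edge leaves \<open>J t\<close> in
      it. As \<open>J t\<close> is closed inside \<open>K - {c t}\<close> and \<open>K\<close>
      inside \<open>S - X\<close>, this edge ends in \<open>X\<close>.\<close>
    have JX: "touches E (J t) X" if t: "length t = l" for t
    proof -
      obtain x where x: "x \<in> X" using conn_nonempty[OF X(1)] by blast
      have "\<exists>u\<in>J t. \<exists>v\<in>(S - {c t}) - J t. (u, v) \<in> E"
      proof (rule conn_edge_out)
        show "conn E (S - {c t})" using S(2) by (simp add: biconn_def)
        show "J t \<subseteq> S - {c t}" using J(2)[OF t] KS by blast
        show "J t \<noteq> {}" using conn_nonempty[OF J(1)[OF t]] .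
        show "J t \<noteq> S - {c t}" using x X(2) cK[OF t] KS(1) J(2)[OF t] by blast
      qed
      then obtain u v where uv: "u \<in> J t" "v \<in> S - {c t} - J t" "(u, v) \<in> E" by blast
      have "v \<in> X"
      proof (rule ccontr)
        assume "v \<notin> X"
        then have "v \<in> K" using K uv J(2)[OF t] by (auto simp: piece_def)
        then show False using J(4)[OF t uv(1) _ uv(3)] uv(2) by blast
      qed
      then show ?thesis using uv by (auto simp: touches_def)
    qed
    have Jc: "\<exists>u\<in>J t. (u, c t) \<in> E" if t: "length t = l" for t
    proof -
      have "\<exists>u\<in>J t. \<exists>v\<in>K - J t. (u, v) \<in> E"
        using KS(2) J(2)[OF t] conn_nonempty[OF J(1)[OF t]] cK[OF t] by (intro conn_edge_out) auto
      then show ?thesis using J(4)[OF t] by blast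
    qed
    \<comment> \<open>\<open>c s\<close> lies in \<open>R t\<close> and hence outside
      \<open>J t\<close>. So two of these sets that meet would absorb each other and be equal; but
      then \<open>c t\<close>, a neighbour of \<open>J t\<close>, would belong to
      \<open>J s\<close>.\<close>
    have JJ: "J s \<inter> J t = {}" if st: "length s = l" "length t = l" "s \<noteq> t" for s t
    proof (rule ccontr)
      assume "J s \<inter> J t \<noteq> {}"
      then obtain y where y: "y \<in> J s" "y \<in> J t" by blast
      have sub: "J b \<subseteq> J a" if ab: "length a = l" "length b = l" "a \<noteq> b" "y \<in> J a" "y \<in> J b" for a b
      proof -
        have "c a \<notin> J b" using c[OF ab(1)] VR[OF ab(1,2,3)] J(3)[OF ab(2)] by blast
        show ?thesis
        proof
          fix z assume "z \<in> J b"
          then have "(y, z) \<in> (E \<inter> J b \<times> J b)\<^sup>*" using J(1)[OF ab(2)] ab(5) by (auto simp: conn_def)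
          then show "z \<in> J a"
          proof (induction rule: rtrancl_induct)
            case (step u v)
            then show ?case using J(4)[OF ab(1), of u v] J(2)[OF ab(2)] \<open>c a \<notin> J b\<close> by blast
          qed (rule ab(4))
        qed
      qed
      have eq: "J s = J t" using sub[of s t] sub[of t s] st y by blast
      obtain u where u: "u \<in> J t" "(u, c t) \<in> E" using Jc[OF st(2)] by blast
      have "c s \<in> R t" "c t \<in> V t" using c[OF st(1)] c[OF st(2)] VR[OF st] by auto
      then have "c t \<noteq> c s" using RV[OF st(2)] by (metis disjoint_iff)
      then have "c t \<in> J s" using J(4)[OF st(1), of u "c t"] u eq cK[OF st(2)] by blast
      then show False using eq J(2)[OF st(2)] by blast
    qed
    \<comment> \<open>Only the leaves are enlarged: a whole subtree at depth \<open>l\<close>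
      together with its \<open>J\<close> becomes one branch set, which reaches
      \<open>X\<close>.\<close>
    define \<phi> where "\<phi> u = (if length u < l then \<psi> u else V u \<union> J u)" for u
    have "tmodel E (words l) \<phi> S"
      unfolding tmodel_def
    proof (intro conjI ballI allI impI)
      fix w assume w: "w \<in> words l"
      show "conn E (\<phi> w)"
      proof (cases "length w < l")
        case True
        then show ?thesis using tmodelD(1)[OF T] l by (simp add: \<phi>_def)
      next
        case False
        then have wl: "length w = l" using w by simp
        have "touches E (V w) (J w)"
          using Jc[OF wl] c[OF wl] sym by (auto simp: touches_def)
        then show ?thesis using V(2)[OF wl] J(1)[OF wl] wl by (simp add: \<phi>_def conn_Un_touches)
      qed
      show "\<phi> w \<subseteq> S"
      proof (cases "length w < l")
        case True
        then show ?thesis using tmodelD(2)[OF T, of w] l KS(1) by (auto simp: \<phi>_def)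
      next
        case False
        then have wl: "length w = l" using w by simp
        then show ?thesis using V(1)[OF wl] J(2)[OF wl] KS(1) by (auto simp: \<phi>_def)
      qed
    next
      fix w w' assume w: "w \<in> words l" "w' \<in> words l" "w \<noteq> w'"
      have mixed: "\<psi> a \<inter> (V b \<union> J b) = {}" if "length a < l" "length b = l" for a b
        using inR[OF that] RV[OF that(2)] J(3)[OF that(2)] by blast
      consider "length w < l" "length w' < l" | "length w < l" "length w' = l"
        | "length w = l" "length w' < l" | "length w = l" "length w' = l"
        using w by force
      then show "\<phi> w \<inter> \<phi> w' = {}"
      proof cases
        case 1
        then show ?thesis using tmodelD(3)[OF T, of w w'] w l by (simp add: \<phi>_def)
      next
        case 2
        then show ?thesis using mixed[of w w'] by (simp add: \<phi>_def)
      next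
        case 3
        then show ?thesis using mixed[of w' w] by (auto simp: \<phi>_def)
      next
        case 4
        have "V w \<inter> V w' = {}" using VR[OF 4 w(3)] RV[OF 4(2)] by blast
        moreover have "J w' \<inter> V w = {}" using VR[OF 4 w(3)] J(3)[OF 4(2)] by blast
        moreover have "J w \<inter> V w' = {}" using VR[OF 4(2,1)] w(3) J(3)[OF 4(1)] by blast
        ultimately show ?thesis using JJ[OF 4 w(3)] 4 by (auto simp: \<phi>_def)
      qed
    next
      fix w b assume w: "w \<in> words l" "b # w \<in> words l"
      then have "touches E (\<psi> w) (\<psi> (b # w))" using tmodelD(4)[OF T, of w b] l by simp
      then show "touches E (\<phi> w) (\<phi> (b # w))"
        by (rule touches_mono) (use w V(3)[of "b # w"] in \<open>auto simp: \<phi>_def\<close>)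
    qed
    moreover have "\<phi> w \<inter> X = {}" if "length w \<le> l" for w
    proof (cases "length w < l")
      case True
      then show ?thesis using tmodelD(2)[OF T, of w] l KS(1) by (auto simp: \<phi>_def)
    next
      case False
      then have wl: "length w = l" using that by simp
      then show ?thesis using V(1)[OF wl] J(2)[OF wl] KS(1) by (auto simp: \<phi>_def)
    qed
    moreover have "touches E (\<phi> w) X" if "length w = l" for w
      using JX[OF that] by (rule touches_mono) (use that in \<open>auto simp: \<phi>_def\<close>)
    ultimately have "gplus E l S" using X by (intro gplusI[of E l \<phi> S X]) auto
    with no show ?thesis ..
  qed
qed

end

section \<open>Linking two blocks\<close>

text \<open>
  The two ways in which \<open>a\<close> and \<open>b\<close> can be linked to \<open>B1\<close> and \<open>B2\<close>: through \<open>B1\<close> and \<open>B2\<close> one after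
  the other, with an additional edge between the two ends, or through \<open>B1\<close> and \<open>B2\<close> in parallel.
\<close>

definition series_link :: "('a \<times> 'a) set \<Rightarrow> 'a set \<Rightarrow> 'a set \<Rightarrow> 'a set \<Rightarrow> 'a \<Rightarrow> 'a \<Rightarrow> bool" where
  "series_link E S B1 B2 a b \<longleftrightarrow> (\<exists>p1 p2 q1 q2 A C D.
     p1 \<in> B1 \<and> p2 \<in> B1 \<and> p1 \<noteq> p2 \<and> q1 \<in> B2 \<and> q2 \<in> B2 \<and> q1 \<noteq> q2 \<and>
     A \<union> C \<union> D \<subseteq> S - B1 - B2 \<and> A \<inter> C = {} \<and> A \<inter> D = {} \<and> C \<inter> D = {} \<and>
     conn E (insert p1 A) \<and> a \<in> insert p1 A \<and> conn E (C \<union> {p2, q2}) \<and>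
     conn E (insert q1 D) \<and> b \<in> insert q1 D \<and> touches E (insert p1 A) (insert q1 D))"

definition par_link :: "('a \<times> 'a) set \<Rightarrow> 'a set \<Rightarrow> 'a set \<Rightarrow> 'a set \<Rightarrow> 'a \<Rightarrow> 'a \<Rightarrow> bool" where
  "par_link E S B1 B2 a b \<longleftrightarrow> (\<exists>p1 p2 q1 q2 R Q.
     p1 \<in> B1 \<and> p2 \<in> B1 \<and> p1 \<noteq> p2 \<and> q1 \<in> B2 \<and> q2 \<in> B2 \<and> q1 \<noteq> q2 \<and>
     R \<union> Q \<subseteq> S - B1 - B2 \<and> R \<inter> Q = {} \<and>
     conn E R \<and> a \<in> R \<and> touches E R {p1} \<and> touches E R {q1} \<and>
     conn E (Q \<union> {p2, q2}) \<and> b \<in> Q \<union> {p2, q2})"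

text \<open>\<open>par_link\<close> is symmetric in the blocks, but distinguishes \<open>a\<close>,
  in the set that will become a tree root, from \<open>b\<close>. Exchanging the blocks in
  \<open>series_link\<close> amounts to exchanging \<open>a\<close> and \<open>b\<close>. So the
  disjunction is closed under both exchanges.\<close>

definition linked :: "('a \<times> 'a) set \<Rightarrow> 'a set \<Rightarrow> 'a set \<Rightarrow> 'a set \<Rightarrow> 'a \<Rightarrow> 'a \<Rightarrow> bool" where
  "linked E S B1 B2 a b \<longleftrightarrow> series_link E S B1 B2 a b \<or> series_link E S B2 B1 a b \<or>
     par_link E S B1 B2 a b \<or> par_link E S B1 B2 b a"

text \<open>\<open>Z1\<close>, \<open>Z2\<close> and the two blocks stand for the cycle through the
  blocks. \<open>X\<close> is the connected set that every path entering \<open>K1\<close> or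
  \<open>K2\<close> has to pass, and the source of all detours.\<close>

definition cfg where
  "cfg E S X K1 K2 B1 B2 Z1 Z2 \<longleftrightarrow>
     conn E X \<and> X \<subseteq> S \<and> piece E S X K1 \<and> piece E S X K2 \<and> K1 \<inter> K2 = {} \<and> B1 \<subseteq> K1 \<and> B2 \<subseteq> K2 \<and>
     gpath E S Z1 \<and> gpath E S Z2 \<and> set Z1 \<inter> set Z2 = {} \<and>
     set Z1 \<inter> B1 = {hd Z1} \<and> set Z1 \<inter> B2 = {last Z1} \<and>
     set Z2 \<inter> B1 = {hd Z2} \<and> set Z2 \<inter> B2 = {last Z2}"

lemma cfgD:
  assumes "cfg E S X K1 K2 B1 B2 Z1 Z2"
  shows "conn E X" "X \<subseteq> S" "piece E S X K1" "piece E S X K2" "K1 \<inter> K2 = {}" "B1 \<subseteq> K1" "B2 \<subseteq> K2"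
    "gpath E S Z1" "gpath E S Z2" "set Z1 \<inter> set Z2 = {}"
    "set Z1 \<inter> B1 = {hd Z1}" "set Z1 \<inter> B2 = {last Z1}"
    "set Z2 \<inter> B1 = {hd Z2}" "set Z2 \<inter> B2 = {last Z2}"
  using assms unfolding cfg_def by - (elim conjE, assumption)+

lemma cfg_mem:
  assumes "cfg E S X K1 K2 B1 B2 Z1 Z2"
  shows "v \<in> set Z1 \<Longrightarrow> v \<in> B1 \<Longrightarrow> v = hd Z1" "v \<in> set Z1 \<Longrightarrow> v \<in> B2 \<Longrightarrow> v = last Z1"
    "v \<in> set Z2 \<Longrightarrow> v \<in> B1 \<Longrightarrow> v = hd Z2" "v \<in> set Z2 \<Longrightarrow> v \<in> B2 \<Longrightarrow> v = last Z2"
    "v \<in> set Z1 \<Longrightarrow> v \<notin> set Z2"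
  using cfgD(10-14)[OF assms] by (metis IntI singletonD, metis IntI singletonD, metis IntI singletonD,
      metis IntI singletonD, metis disjoint_iff)

definition tail_to :: "('a \<times> 'a) set \<Rightarrow> 'a set \<Rightarrow> 'a set \<Rightarrow> 'a \<Rightarrow> 'a list \<Rightarrow> bool" where
  "tail_to E S W a t \<longleftrightarrow> gpath E S t \<and> hd t = a \<and> set t \<inter> W = {last t}"

lemma piece_path:
  assumes "gpath E S p" "piece E S X K" "hd p \<notin> K" "last p \<in> K" "sym E"
  shows "set p \<inter> X \<noteq> {}"
proof -
  interpret ugraph E using assms(5) by unfold_locales
  have "\<exists>x\<in>set p \<inter> K. \<exists>y\<in>set p - set p \<inter> K. (x, y) \<in> E"
    using conn_gpath[OF assms(1)] gpathD(5,6)[OF assms(1)] assms(3,4) by (intro conn_edge_out) auto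
  then obtain x y where xy: "x \<in> K" "y \<in> set p" "y \<notin> K" "(x, y) \<in> E" by blast
  then have "y \<in> X" using assms(2) gpathD(3)[OF assms(1)] unfolding piece_def by blast
  with xy show ?thesis by blast
qed

lemma gpath_interior:
  assumes "gpath E S p" "x \<in> set p" "x \<noteq> hd p" "x \<noteq> last p"
  shows "\<exists>m. p = hd p # m @ [last p] \<and> x \<in> set m"
proof -
  obtain h r where p: "p = h # r" using gpathD(1)[OF assms(1)] by (cases p) auto
  then have "r \<noteq> []" using assms by auto
  then have "p = hd p # butlast r @ [last p]" using p by simp
  moreover have "x \<in> set (butlast r)"
    using assms(2-4) p \<open>r \<noteq> []\<close> by (metis append_butlast_last_id in_set_conv_decomp_last last.simps
        list.sel(1) rotate1.simps(2) set_ConsD set_rotate1)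
  ultimately show ?thesis by blast
qed

context ugraph
begin

section \<open>Symmetries of links and configurations\<close>

lemma gpath_rev: "gpath E S p \<Longrightarrow> gpath E S (rev p)"
proof -
  assume p: "gpath E S p"
  have "successively (\<lambda>x y. (y, x) \<in> E) p"
    using gpathD(4)[OF p] by (rule successively_mono) (simp add: sym)
  then show ?thesis using p by (simp add: gpath_def successively_rev)
qed

lemma series_link_sym: "series_link E S B1 B2 a b \<Longrightarrow> series_link E S B2 B1 b a"
proof -
  assume "series_link E S B1 B2 a b"
  then obtain p1 p2 q1 q2 A C D where *:
     "p1 \<in> B1" "p2 \<in> B1" "p1 \<noteq> p2" "q1 \<in> B2" "q2 \<in> B2" "q1 \<noteq> q2"
     "A \<union> C \<union> D \<subseteq> S - B1 - B2" "A \<inter> C = {}" "A \<inter> D = {}" "C \<inter> D = {}"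
     "conn E (insert p1 A)" "a \<in> insert p1 A" "conn E (C \<union> {p2, q2})"
     "conn E (insert q1 D)" "b \<in> insert q1 D" "touches E (insert p1 A) (insert q1 D)"
    unfolding series_link_def by blast
  have "D \<union> C \<union> A \<subseteq> S - B2 - B1" "D \<inter> C = {}" "D \<inter> A = {}" "C \<inter> A = {}"
    "conn E (C \<union> {q2, p2})" "touches E (insert q1 D) (insert p1 A)"
    using * touches_sym by (auto simp: insert_commute)
  with * show ?thesis unfolding series_link_def
    by (intro exI[of _ q1] exI[of _ q2] exI[of _ p1] exI[of _ p2] exI[of _ D] exI[of _ C] exI[of _ A] conjI)
qed

lemma par_link_sym: "par_link E S B1 B2 a b \<Longrightarrow> par_link E S B2 B1 a b"
proof -
  assume "par_link E S B1 B2 a b"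
  then obtain p1 p2 q1 q2 R Q where *:
     "p1 \<in> B1" "p2 \<in> B1" "p1 \<noteq> p2" "q1 \<in> B2" "q2 \<in> B2" "q1 \<noteq> q2"
     "R \<union> Q \<subseteq> S - B1 - B2" "R \<inter> Q = {}" "conn E R" "a \<in> R" "touches E R {p1}" "touches E R {q1}"
     "conn E (Q \<union> {p2, q2})" "b \<in> Q \<union> {p2, q2}"
    unfolding par_link_def by blast
  have "R \<union> Q \<subseteq> S - B2 - B1" "conn E (Q \<union> {q2, p2})" "b \<in> Q \<union> {q2, p2}"
    using * by (auto simp: insert_commute)
  with * show ?thesis unfolding par_link_def
    by (intro exI[of _ q1] exI[of _ q2] exI[of _ p1] exI[of _ p2] exI[of _ R] exI[of _ Q] conjI)
qed

lemma linked_sym: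
  "linked E S B1 B2 b a \<Longrightarrow> linked E S B1 B2 a b" "linked E S B2 B1 a b \<Longrightarrow> linked E S B1 B2 a b"
  unfolding linked_def using series_link_sym par_link_sym by blast+

lemma cfg_swap:
  assumes "cfg E S X K1 K2 B1 B2 Z1 Z2"
  shows "cfg E S X K1 K2 B1 B2 Z2 Z1" "cfg E S X K2 K1 B2 B1 (rev Z1) (rev Z2)"
proof -
  note c = cfgD[OF assms]
  show "cfg E S X K1 K2 B1 B2 Z2 Z1" unfolding cfg_def using c by (intro conjI) auto
  have "hd (rev Z1) = last Z1" "last (rev Z1) = hd Z1" "hd (rev Z2) = last Z2" "last (rev Z2) = hd Z2"
    using gpathD(1)[OF c(8)] gpathD(1)[OF c(9)] by (auto simp: hd_rev last_rev)
  then show "cfg E S X K2 K1 B2 B1 (rev Z1) (rev Z2)"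
    unfolding cfg_def using c gpath_rev by (intro conjI) auto
qed

lemma cfg_ends:
  assumes "cfg E S X K1 K2 B1 B2 Z1 Z2"
  shows "hd Z1 \<in> B1" "hd Z2 \<in> B1" "last Z1 \<in> B2" "last Z2 \<in> B2" "hd Z1 \<noteq> hd Z2" "last Z1 \<noteq> last Z2"
    "B1 \<inter> B2 = {}" "X \<inter> B1 = {}" "X \<inter> B2 = {}" "set Z1 \<subseteq> S" "set Z2 \<subseteq> S"
    "X \<inter> set Z1 \<noteq> {}" "X \<inter> set Z2 \<noteq> {}"
proof -
  note c = cfgD[OF assms]
  show e: "hd Z1 \<in> B1" "hd Z2 \<in> B1" "last Z1 \<in> B2" "last Z2 \<in> B2" using c(11-14) by blast+
  show "hd Z1 \<noteq> hd Z2" "last Z1 \<noteq> last Z2"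
    using gpathD(5,6)[OF c(8)] gpathD(5,6)[OF c(9)] c(10) by (metis disjoint_iff)+
  show d: "B1 \<inter> B2 = {}" using c(5-7) by blast
  show "X \<inter> B1 = {}" "X \<inter> B2 = {}" using c(3,4,6,7) unfolding piece_def by blast+
  show "set Z1 \<subseteq> S" "set Z2 \<subseteq> S" using gpathD(3) c(8,9) by auto
  \<comment> \<open>A path from one component of \<open>S - X\<close> to another passes
    \<open>X\<close>.\<close>
  show "X \<inter> set Z1 \<noteq> {}"
    using piece_path[OF c(8) c(4) _ _ sym_E] e(1,3) c(5-7) by blast
  show "X \<inter> set Z2 \<noteq> {}"
    using piece_path[OF c(9) c(4) _ _ sym_E] e(2,4) c(5-7) by blast
qed

section \<open>Links read off from the ends of the two tails\<close>

lemma series_on_path: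
  assumes cfg: "cfg E S X K1 K2 B1 B2 Z1 Z2"
    and T: "conn E Ta" "conn E Tb" "Ta \<union> Tb \<subseteq> S" "Ta \<inter> Tb = {}" "a \<in> Ta" "b \<in> Tb"
    and W: "Ta \<inter> (B1 \<union> B2 \<union> set Z1 \<union> set Z2) = {x}" "Tb \<inter> (B1 \<union> B2 \<union> set Z1 \<union> set Z2) = {y}"
    and Z: "Z1 = xs @ ys" "x \<in> set xs" "y \<in> set ys"
  shows "series_link E S B1 B2 a b"
proof -
  note c = cfgD[OF cfg] and e = cfg_ends[OF cfg] and mem = cfg_mem[OF cfg]
  have ne: "xs \<noteq> []" "ys \<noteq> []" using Z by auto
  have h: "hd Z1 = hd xs" "last Z1 = last ys" using ne Z(1) by auto
  have pxs: "gpath E S xs" and pys: "gpath E S ys"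
    using gpath_append_left gpath_append_right c(8) Z(1) ne by blast+
  have dxy: "set xs \<inter> set ys = {}" using gpathD(2)[OF c(8)] Z(1) by auto
  have Zs: "set Z1 = set xs \<union> set ys" using Z(1) by simp
  \<comment> \<open>\<open>Z1\<close> is cut between \<open>xs\<close> and \<open>ys\<close>. The
    cut edge becomes the direct connection between the two ends, and \<open>Z2\<close> is the
    passage between the blocks.\<close>
  define A where "A = Ta \<union> set xs - {hd Z1}"
  define D where "D = Tb \<union> set ys - {last Z1}"
  define C where "C = set Z2 - {hd Z2, last Z2}"
  have hx: "hd xs \<in> set xs" "last ys \<in> set ys" using ne by auto
  have iA: "insert (hd Z1) A = Ta \<union> set xs" using h hx by (auto simp: A_def)
  have iD: "insert (last Z1) D = Tb \<union> set ys" using h hx by (auto simp: D_def)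
  have iC: "C \<union> {hd Z2, last Z2} = set Z2" using gpathD(5,6)[OF c(9)] by (auto simp: C_def)
  have xsB: "v = hd Z1" if "v \<in> set xs" "v \<in> B1 \<union> B2" for v
  proof (rule ccontr)
    assume "v \<noteq> hd Z1"
    then have "v = last Z1" using that mem(1,2)[of v] Zs by blast
    then show False using that(1) dxy h hx by auto
  qed
  have ysB: "v = last Z1" if "v \<in> set ys" "v \<in> B1 \<union> B2" for v
  proof (rule ccontr)
    assume "v \<noteq> last Z1"
    then have "v = hd Z1" using that mem(1,2)[of v] Zs by blast
    then show False using that(1) dxy h hx by auto
  qed
  have TaW: "v \<in> set xs" if "v \<in> Ta" "v \<in> B1 \<union> B2 \<union> set Z1 \<union> set Z2" for v
    using that W(1) Z(2) by (metis IntI singletonD)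
  have TbW: "v \<in> set ys" if "v \<in> Tb" "v \<in> B1 \<union> B2 \<union> set Z1 \<union> set Z2" for v
    using that W(2) Z(3) by (metis IntI singletonD)
  have "conn E (insert (hd Z1) A)"
    unfolding iA using T(1) conn_gpath[OF pxs] W(1) Z(2) by (intro conn_Un) auto
  moreover have "conn E (insert (last Z1) D)"
    unfolding iD using T(2) conn_gpath[OF pys] W(2) Z(3) by (intro conn_Un) auto
  moreover have "conn E (C \<union> {hd Z2, last Z2})" unfolding iC by (rule conn_gpath[OF c(9)])
  moreover have "(last xs, hd ys) \<in> E"
    using gpathD(4)[OF c(8)] Z(1) ne by (simp add: successively_append_iff)
  then have "touches E (insert (hd Z1) A) (insert (last Z1) D)"
    unfolding iA iD touches_def using ne by (meson UnI2 hd_in_set last_in_set)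
  moreover have "A \<union> C \<union> D \<subseteq> S - B1 - B2"
  proof -
    have "v \<notin> B1 \<union> B2" if "v \<in> A" for v using that xsB[of v] TaW[of v] unfolding A_def by blast
    moreover have "v \<notin> B1 \<union> B2" if "v \<in> D" for v using that ysB[of v] TbW[of v] unfolding D_def by blast
    moreover have "v \<notin> B1 \<union> B2" if "v \<in> C" for v using that mem(3,4)[of v] unfolding C_def by blast
    moreover have "A \<union> C \<union> D \<subseteq> S" using T(3) e(10,11) Zs by (auto simp: A_def C_def D_def)
    ultimately show ?thesis by blast
  qed
  moreover have "Ta \<inter> set Z2 = {}" "Tb \<inter> set Z2 = {}" "Ta \<inter> set ys = {}" "Tb \<inter> set xs = {}"
    using TaW TbW Zs c(10) dxy by blast+
  then have "A \<inter> C = {}" "A \<inter> D = {}" "C \<inter> D = {}"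
    using T(4) dxy c(10) Zs unfolding A_def C_def D_def by blast+
  moreover have "a \<in> insert (hd Z1) A" "b \<in> insert (last Z1) D" using T iA iD by auto
  ultimately show ?thesis unfolding series_link_def using e(1-6)
    by (intro exI[of _ "hd Z1"] exI[of _ "hd Z2"] exI[of _ "last Z1"] exI[of _ "last Z2"]
        exI[of _ A] exI[of _ C] exI[of _ D] conjI)
qed

lemma linked_same_path:
  assumes cfg: "cfg E S X K1 K2 B1 B2 Z1 Z2"
    and T: "conn E Ta" "conn E Tb" "Ta \<union> Tb \<subseteq> S" "Ta \<inter> Tb = {}" "a \<in> Ta" "b \<in> Tb"
    and W: "Ta \<inter> (B1 \<union> B2 \<union> set Z1 \<union> set Z2) = {x}" "Tb \<inter> (B1 \<union> B2 \<union> set Z1 \<union> set Z2) = {y}"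
    and xy: "x \<in> set Z1" "y \<in> set Z1"
  shows "linked E S B1 B2 a b"
proof -
  have "x \<noteq> y" using W T(4) by blast
  obtain u v where uv: "Z1 = u @ x # v" using split_list[OF xy(1)] by blast
  show ?thesis
  proof (cases "y \<in> set v")
    case True
    have "series_link E S B1 B2 a b"
      by (rule series_on_path[OF cfg T W, of "u @ [x]" v]) (use uv True in auto)
    then show ?thesis by (simp add: linked_def)
  next
    case False
    then have "y \<in> set u" using xy(2) uv \<open>x \<noteq> y\<close> by auto
    moreover have "Tb \<union> Ta \<subseteq> S" "Tb \<inter> Ta = {}" using T by auto
    ultimately have "series_link E S B1 B2 b a"
      using series_on_path[OF cfg T(2,1) _ _ T(6,5) W(2,1) uv] by auto
    then show ?thesis using linked_sym(1) by (simp add: linked_def)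
  qed
qed

text \<open>The interior of \<open>Z1\<close> with \<open>a\<close> attached touches both blocks
  from outside, as a new tree root should. \<open>Z2\<close> with \<open>b\<close> attached joins
  the vertices around which the apexes will lie.\<close>

lemma par_on_paths:
  assumes cfg: "cfg E S X K1 K2 B1 B2 Z1 Z2"
    and T: "conn E Ta" "conn E Tb" "Ta \<union> Tb \<subseteq> S" "Ta \<inter> Tb = {}" "a \<in> Ta" "b \<in> Tb"
    and W: "Ta \<inter> (B1 \<union> B2 \<union> set Z1 \<union> set Z2) = {x}" "Tb \<inter> (B1 \<union> B2 \<union> set Z1 \<union> set Z2) = {y}"
    and xy: "x \<in> set Z1 - B1 - B2" "y \<in> set Z2"
  shows "par_link E S B1 B2 a b"
proof -
  note c = cfgD[OF cfg] and e = cfg_ends[OF cfg] and mem = cfg_mem[OF cfg]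
  obtain m where m: "Z1 = hd Z1 # m @ [last Z1]" "x \<in> set m"
    using gpath_interior[OF c(8), of x] xy(1) e(1,3) by blast
  have mne: "m \<noteq> []" using m(2) by auto
  have "gpath E S (m @ [last Z1])" using gpath_append_right[of E S "[hd Z1]"] c(8) m(1) by fastforce
  then have pm: "gpath E S m" using gpath_append_left mne by blast
  have dm: "distinct (hd Z1 # m @ [last Z1])" using gpathD(2)[OF c(8)] m(1) by metis
  have sm: "successively (\<lambda>x y. (x, y) \<in> E) (hd Z1 # m @ [last Z1])" using gpathD(4)[OF c(8)] m(1) by metis
  have Zs: "set Z1 = {hd Z1, last Z1} \<union> set m" using arg_cong[OF m(1), of set] by auto
  have mB: "v \<notin> B1 \<union> B2" if "v \<in> set m" for v
    using that mem(1,2)[of v] Zs dm by auto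
  have TaW: "v \<in> set m" if "v \<in> Ta" "v \<in> B1 \<union> B2 \<union> set Z1 \<union> set Z2" for v
    using that W(1) m(2) by (metis IntI singletonD)
  have TbW: "v \<in> set Z2" if "v \<in> Tb" "v \<in> B1 \<union> B2 \<union> set Z1 \<union> set Z2" for v
    using that W(2) xy(2) by (metis IntI singletonD)
  define R where "R = Ta \<union> set m"
  define Q where "Q = Tb \<union> set Z2 - {hd Z2, last Z2}"
  have iQ: "Q \<union> {hd Z2, last Z2} = Tb \<union> set Z2" using gpathD(5,6)[OF c(9)] by (auto simp: Q_def)
  have "conn E R" unfolding R_def using T(1) conn_gpath[OF pm] W(1) m(2) by (intro conn_Un) auto
  moreover have "conn E (Q \<union> {hd Z2, last Z2})"
    unfolding iQ using T(2) conn_gpath[OF c(9)] W(2) xy(2) by (intro conn_Un) auto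
  moreover have "(hd Z1, hd m) \<in> E" "(last m, last Z1) \<in> E"
    using sm mne by (auto simp: successively_append_iff successively_Cons hd_append)
  then have "touches E R {hd Z1}" "touches E R {last Z1}"
    using mne sym unfolding touches_def R_def by (meson UnI2 hd_in_set last_in_set singletonI)+
  moreover have "R \<inter> Q = {}"
  proof -
    have "Ta \<inter> set Z2 = {}" "Tb \<inter> set m = {}" using TaW TbW mem(5) Zs by blast+
    then show ?thesis using T(4) c(10) Zs unfolding R_def Q_def by blast
  qed
  moreover have "R \<union> Q \<subseteq> S - B1 - B2"
  proof -
    have "v \<notin> B1 \<union> B2" if "v \<in> R" for v using that mB[of v] TaW[of v] unfolding R_def by blast
    moreover have "v \<notin> B1 \<union> B2" if "v \<in> Q" for v
      using that mem(3,4)[of v] TbW[of v] unfolding Q_def by blast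
    moreover have "R \<union> Q \<subseteq> S" using T(3) e(10,11) Zs by (auto simp: R_def Q_def)
    ultimately show ?thesis by blast
  qed
  moreover have "a \<in> R" "b \<in> Q \<union> {hd Z2, last Z2}" using T iQ by (auto simp: R_def)
  ultimately show ?thesis unfolding par_link_def using e(1-6)
    by (intro exI[of _ "hd Z1"] exI[of _ "hd Z2"] exI[of _ "last Z1"] exI[of _ "last Z2"]
        exI[of _ R] exI[of _ Q] conjI)
qed

text \<open>Here \<open>a\<close> enters \<open>B1\<close> at \<open>x\<close>, so the part of
  \<open>Z1\<close> before \<open>y\<close> is discarded, and an edge between \<open>Ta\<close> and
  \<open>Tb\<close> replaces the cut edge of \<open>Z1\<close> as direct connection. By
  \<open>x \<noteq> hd Z2\<close> the two ends in \<open>B1\<close> differ.\<close>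

lemma series_from_block:
  assumes cfg: "cfg E S X K1 K2 B1 B2 Z1 Z2"
    and T: "conn E Ta" "conn E Tb" "Ta \<union> Tb \<subseteq> S" "Ta \<inter> Tb = {}" "a \<in> Ta" "b \<in> Tb"
    and W: "Ta \<inter> (B1 \<union> B2 \<union> set Z1 \<union> set Z2) = {x}" "Tb \<inter> (B1 \<union> B2 \<union> set Z1 \<union> set Z2) = {y}"
    and xy: "x \<in> B1" "x \<noteq> hd Z2" "y \<in> set Z1 - B1" and tch: "touches E Ta Tb"
  shows "series_link E S B1 B2 a b"
proof -
  note c = cfgD[OF cfg] and e = cfg_ends[OF cfg] and mem = cfg_mem[OF cfg]
  obtain u v where uv: "Z1 = u @ y # v" using split_list[of y Z1] xy(3) by blast
  have une: "u \<noteq> []" using uv xy(3) e(1) by (metis DiffD2 append_Nil list.sel(1))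
  have p: "gpath E S (y # v)" using gpath_append_right c(8) uv by blast
  have lv: "last Z1 = last (y # v)" using uv by simp
  have lin: "last Z1 \<in> set (y # v)" unfolding lv by (rule last_in_set) simp
  have "hd Z1 \<in> set u" using uv une by simp
  then have "hd Z1 \<notin> set (y # v)" using gpathD(2)[OF c(8)] uv by auto
  moreover have vZ: "set (y # v) \<subseteq> set Z1" using uv by auto
  ultimately have vB: "z \<notin> B1" if "z \<in> set (y # v)" for z
    using mem(1)[of z] that by blast
  have vB2: "z = last Z1" if "z \<in> set (y # v)" "z \<in> B2" for z using mem(2)[of z] vZ that by blast
  have TaW: "z = x" if "z \<in> Ta" "z \<in> B1 \<union> B2 \<union> set Z1 \<union> set Z2" for z
    using that W(1) by (metis IntI singletonD)
  have TbW: "z \<in> set (y # v)" if "z \<in> Tb" "z \<in> B1 \<union> B2 \<union> set Z1 \<union> set Z2" for z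
    using that W(2) by (metis IntI singletonD list.set_intros(1))
  define A where "A = Ta - {x}"
  define D where "D = Tb \<union> set (y # v) - {last Z1}"
  define C where "C = set Z2 - {hd Z2, last Z2}"
  have iA: "insert x A = Ta" using W(1) by (auto simp: A_def)
  have iD: "insert (last Z1) D = Tb \<union> set (y # v)" using lin by (auto simp: D_def)
  have iC: "C \<union> {hd Z2, last Z2} = set Z2" using gpathD(5,6)[OF c(9)] by (auto simp: C_def)
  have "conn E (insert x A)" unfolding iA by (rule T(1))
  moreover have "conn E (insert (last Z1) D)"
    unfolding iD using T(2) conn_gpath[OF p] W(2) by (intro conn_Un) auto
  moreover have "conn E (C \<union> {hd Z2, last Z2})" unfolding iC by (rule conn_gpath[OF c(9)])
  moreover have "touches E (insert x A) (insert (last Z1) D)"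
    unfolding iA iD using tch by (rule touches_mono) auto
  moreover have "A \<union> C \<union> D \<subseteq> S - B1 - B2"
  proof -
    have "z \<notin> B1 \<union> B2" if "z \<in> A" for z using that TaW[of z] unfolding A_def by blast
    moreover have "z \<notin> B1 \<union> B2" if "z \<in> D" for z
      using that TbW[of z] vB[of z] vB2[of z] unfolding D_def by blast
    moreover have "z \<notin> B1 \<union> B2" if "z \<in> C" for z using that mem(3,4)[of z] unfolding C_def by blast
    moreover have "A \<union> C \<union> D \<subseteq> S" using T(3) e(10,11) vZ unfolding A_def C_def D_def by blast
    ultimately show ?thesis by blast
  qed
  moreover have xZ2: "x \<notin> set Z2" using mem(3)[of x] xy(1,2) by blast
  have "Ta \<inter> set Z2 = {}"
  proof (rule ccontr)
    assume "Ta \<inter> set Z2 \<noteq> {}"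
    then obtain z where "z \<in> Ta" "z \<in> set Z2" by blast
    then show False using TaW[of z] xZ2 by blast
  qed
  moreover have "Ta \<inter> set (y # v) = {}"
  proof (rule ccontr)
    assume "Ta \<inter> set (y # v) \<noteq> {}"
    then obtain z where z: "z \<in> Ta" "z \<in> set (y # v)" by blast
    then have "z = x" using TaW[of z] vZ by blast
    then show False using vB[OF z(2)] xy(1) by blast
  qed
  moreover have "Tb \<inter> set Z2 = {}" using TbW vZ mem(5) by blast
  ultimately have "A \<inter> C = {}" "A \<inter> D = {}" "C \<inter> D = {}"
    using T(4) c(10) vZ unfolding A_def C_def D_def by blast+
  moreover have "a \<in> insert x A" "b \<in> insert (last Z1) D" using T iA iD by auto
  moreover note \<open>conn E (insert x A)\<close> \<open>conn E (insert (last Z1) D)\<close> \<open>conn E (C \<union> {hd Z2, last Z2})\<close>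
    \<open>touches E (insert x A) (insert (last Z1) D)\<close> \<open>A \<union> C \<union> D \<subseteq> S - B1 - B2\<close>
  ultimately show ?thesis unfolding series_link_def using e(2,3,4,6) xy(1,2)
    by (intro exI[of _ x] exI[of _ "hd Z2"] exI[of _ "last Z1"] exI[of _ "last Z2"]
        exI[of _ A] exI[of _ C] exI[of _ D] conjI)
qed

section \<open>Detours through \<open>X\<close>\<close>

lemma tail_reroute:
  assumes t: "tail_to E S W a t" and p: "gpath E S p" "set p \<inter> set t = {hd p}" "set p \<inter> W = {last p}"
  shows "\<exists>t'. tail_to E S W a t' \<and> last t' = last p \<and> set t' \<subseteq> set t \<union> set p"
proof -
  have t': "gpath E S t" "hd t = a" "set t \<inter> W = {last t}" using t by (auto simp: tail_to_def)
  have "hd p \<in> set t" using p(2) by blast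
  then obtain u v where uv: "t = u @ hd p # v" using split_list by metis
  have "last t \<in> set (hd p # v)" using uv by (metis last_appendR last_in_set list.distinct(1))
  then have "last t \<notin> set u" using gpathD(2)[OF t'(1)] uv by auto
  moreover have "z = last t" if "z \<in> set u" "z \<in> W" for z
    using t'(3) uv that by (metis IntI Un_iff set_append singletonD)
  ultimately have uW: "set u \<inter> W = {}" by blast
  have "hd p \<notin> set u" using gpathD(2)[OF t'(1)] uv by auto
  moreover have "z = hd p" if "z \<in> set u" "z \<in> set p" for z
    using p(2) uv that by (metis IntI Un_iff set_append singletonD)
  ultimately have up: "set u \<inter> set p = {}" by blast
  have "gpath E S (u @ p)"
    using gpathD[OF t'(1)] gpathD[OF p(1)] uv up
    by (auto simp: gpath_def successively_append_iff)
  moreover have "hd (u @ p) = a" using uv t'(2) gpathD(1)[OF p(1)] by (cases u) auto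
  moreover have "last (u @ p) = last p" using gpathD(1)[OF p(1)] by simp
  moreover have "set (u @ p) \<inter> W = {last p}" using uW p(3) by auto
  ultimately show ?thesis using uv by (intro exI[of _ "u @ p"]) (auto simp: tail_to_def)
qed

text \<open>Tails that end on the same path give a series link, tails that end on different paths a
  parallel one.\<close>

lemma linked_interior:
  assumes cfg: "cfg E S X K1 K2 B1 B2 Z1 Z2"
    and ta: "tail_to E S (B1 \<union> B2 \<union> set Z1 \<union> set Z2) a ta"
    and tb: "tail_to E S (B1 \<union> B2 \<union> set Z1 \<union> set Z2) b tb"
    and dis: "set ta \<inter> set tb = {}"
    and la: "last ta \<in> set Z1 \<union> set Z2 - B1 - B2" and lb: "last tb \<in> set Z1 \<union> set Z2 - B1 - B2"
  shows "linked E S B1 B2 a b"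
proof -
  have aux: "linked E S B1 B2 a b"
    if "cfg E S X K1 K2 B1 B2 Z1 Z2" "tail_to E S (B1 \<union> B2 \<union> set Z1 \<union> set Z2) a ta"
      "tail_to E S (B1 \<union> B2 \<union> set Z1 \<union> set Z2) b tb" "last ta \<in> set Z1" "last ta \<notin> B1" "last ta \<notin> B2"
      "last tb \<in> set Z1 \<union> set Z2" for Z1 Z2
  proof -
    have t: "gpath E S ta" "a \<in> set ta" "set ta \<inter> (B1 \<union> B2 \<union> set Z1 \<union> set Z2) = {last ta}"
      "gpath E S tb" "b \<in> set tb" "set tb \<inter> (B1 \<union> B2 \<union> set Z1 \<union> set Z2) = {last tb}"
      using that(2,3) gpathD(5) by (auto simp: tail_to_def)
    have s: "set ta \<union> set tb \<subseteq> S" using gpathD(3) t(1,4) by auto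
    note T = conn_gpath[OF t(1)] conn_gpath[OF t(4)] s dis t(2,5)
    show ?thesis
    proof (cases "last tb \<in> set Z1")
      case True
      show ?thesis by (rule linked_same_path[OF that(1) T t(3,6) that(4) True])
    next
      case False
      then have "par_link E S B1 B2 a b"
        using par_on_paths[OF that(1) T t(3,6)] that(4-7) by blast
      then show ?thesis by (simp add: linked_def)
    qed
  qed
  show ?thesis
  proof (cases "last ta \<in> set Z1")
    case True
    show ?thesis using aux[OF cfg ta tb True] la lb by blast
  next
    case False
    have "B1 \<union> B2 \<union> set Z1 \<union> set Z2 = B1 \<union> B2 \<union> set Z2 \<union> set Z1" by auto
    then show ?thesis using aux[OF cfg_swap(1)[OF cfg]] ta tb la lb False by auto
  qed
qed

text \<open>If \<open>ta\<close> ends in \<open>B1\<close> off both paths, it has passed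
  \<open>X\<close>, as \<open>a\<close> is outside \<open>K1\<close>. A shortest path in
  \<open>X\<close> from \<open>ta\<close> to \<open>Z1\<close>, \<open>Z2\<close> or
  \<open>tb\<close> avoids the blocks. If it ends on \<open>Z1\<close> or \<open>Z2\<close>, it
  reroutes \<open>ta\<close> to the interior of a path; if it ends on \<open>tb\<close>, its last
  edge is a direct connection between the tails.\<close>

lemma linked_one_in_block:
  assumes cfg: "cfg E S X K1 K2 B1 B2 Z1 Z2"
    and ta: "tail_to E S (B1 \<union> B2 \<union> set Z1 \<union> set Z2) a ta"
    and tb: "tail_to E S (B1 \<union> B2 \<union> set Z1 \<union> set Z2) b tb"
    and dis: "set ta \<inter> set tb = {}" and aK: "a \<notin> K1"
    and la: "last ta \<in> B1" and lb: "last tb \<in> set Z1 - B1 - B2"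
  shows "linked E S B1 B2 a b"
proof -
  note c = cfgD[OF cfg] and e = cfg_ends[OF cfg] and mem = cfg_mem[OF cfg]
  define W where "W = B1 \<union> B2 \<union> set Z1 \<union> set Z2"
  have t: "gpath E S ta" "a \<in> set ta" "set ta \<inter> W = {last ta}"
    "gpath E S tb" "b \<in> set tb" "set tb \<inter> W = {last tb}" "hd ta = a"
    using ta tb gpathD(5) by (auto simp: tail_to_def W_def)
  have s: "set ta \<union> set tb \<subseteq> S" using gpathD(3) t(1,4) by auto
  note T = conn_gpath[OF t(1)] conn_gpath[OF t(4)] s dis t(2,5)
  have s': "set tb \<union> set ta \<subseteq> S" "set tb \<inter> set ta = {}" using s dis by auto
  note T' = conn_gpath[OF t(4)] conn_gpath[OF t(1)] s' t(5,2)
  consider "last ta = hd Z1" | "last ta = hd Z2" | "last ta \<noteq> hd Z1" "last ta \<noteq> hd Z2" by blast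
  then show ?thesis
  proof cases
    case 1
    then have "last ta \<in> set Z1" using gpathD(5)[OF c(8)] by simp
    with lb show ?thesis using linked_same_path[OF cfg T t(3,6)[unfolded W_def]] by blast
  next
    case 2
    \<comment> \<open>Only \<open>tb\<close> is known to end in the interior of its path, so it is
      \<open>b\<close> that takes the root in this parallel link.\<close>
    then have "last ta \<in> set Z2" using gpathD(5)[OF c(9)] by simp
    with lb have "par_link E S B1 B2 b a" using par_on_paths[OF cfg T' t(6,3)[unfolded W_def]] by blast
    then show ?thesis by (simp add: linked_def)
  next
    case 3
    have laZ: "last ta \<notin> set Z1 \<union> set Z2" using 3 la c(11,13) by blast
    have "set ta \<inter> X \<noteq> {}" using piece_path[OF t(1) c(3) _ _ sym_E] t(7) aK la c(6) by blast
    then obtain p where p: "gpath E X p" "set p \<inter> set ta = {hd p}"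
      "set p \<inter> (set Z1 \<union> set Z2 \<union> set tb) = {last p}"
      using conn_link[OF c(1), of "set ta" "set Z1 \<union> set Z2 \<union> set tb"] e(12) by blast
    have pX: "set p \<subseteq> X" using gpathD(3)[OF p(1)] .
    have pS: "gpath E S p" using gpath_mono[OF p(1)] pX c(2) by blast
    have pB: "set p \<inter> (B1 \<union> B2) = {}" using pX e(8,9) by blast
    have hpta: "hd p \<in> set ta" using p(2) by blast
    have pQ: "z = last p" if "z \<in> set p" "z \<in> set Z1 \<union> set Z2 \<union> set tb" for z
      using p(3) that by (metis IntI singletonD)
    show ?thesis
    proof (cases "last p \<in> set tb")
      case True
      \<comment> \<open>The last vertex of the detour belongs to \<open>tb\<close>. Without it, the
        detour enlarges \<open>ta\<close> to a set that is disjoint from \<open>tb\<close> but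
        adjacent to it.\<close>
      obtain p' where p': "p = p' @ [last p]" using gpathD(1)[OF p(1)] by (metis append_butlast_last_id)
      have "p' \<noteq> []"
      proof
        assume "p' = []"
        then have "hd p = last p" using p' by (metis append_Nil list.sel(1))
        then have "last p \<in> set ta" using hpta by simp
        with True dis show False by blast
      qed
      have "distinct (p' @ [last p])" using gpathD(2)[OF p(1)] p' by metis
      then have lp': "last p \<notin> set p'" by simp
      have sp: "set p = insert (last p) (set p')" using arg_cong[OF p', of set] by auto
      have gp': "gpath E S p'" using gpath_append_left[of E S p' "[last p]"] pS p' \<open>p' \<noteq> []\<close> by simp
      have hp': "hd p' = hd p" using p' \<open>p' \<noteq> []\<close> by (metis hd_append2)
      have p'W: "set p' \<inter> (set Z1 \<union> set Z2 \<union> set tb) = {}"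
      proof (rule ccontr)
        assume "set p' \<inter> (set Z1 \<union> set Z2 \<union> set tb) \<noteq> {}"
        then obtain z where "z \<in> set p'" "z \<in> set Z1 \<union> set Z2 \<union> set tb" by blast
        then show False using pQ[of z] sp lp' by auto
      qed
      have "(last p', last p) \<in> E"
        using gpathD(4)[OF p(1)] p' \<open>p' \<noteq> []\<close> by (metis successively_append_iff list.sel(1) list.distinct(1))
      then have tch: "touches E (set ta \<union> set p') (set tb)"
        unfolding touches_def using True \<open>p' \<noteq> []\<close> by (meson UnI2 last_in_set)
      have "hd p \<in> set p'" using hp' hd_in_set[OF \<open>p' \<noteq> []\<close>] by simp
      with hpta have cT: "conn E (set ta \<union> set p')"
        using conn_gpath[OF t(1)] conn_gpath[OF gp'] by (intro conn_Un) auto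
      have "(set ta \<union> set p') \<union> set tb \<subseteq> S" using s gpathD(3)[OF gp'] by blast
      moreover have "(set ta \<union> set p') \<inter> set tb = {}" using dis p'W by blast
      moreover have "(set ta \<union> set p') \<inter> (B1 \<union> B2 \<union> set Z1 \<union> set Z2) = {last ta}"
      proof -
        have "set p' \<inter> W = {}" using p'W pB sp unfolding W_def by blast
        then have "(set ta \<union> set p') \<inter> W = {last ta}" using t(3) by blast
        then show ?thesis by (simp only: W_def)
      qed
      ultimately have "series_link E S B1 B2 a b"
        using series_from_block[OF cfg cT T(2) _ _ _ t(5) _ t(6)[unfolded W_def] la 3(2) _ tch, of a] t(2) lb
        by blast
      then show ?thesis by (simp add: linked_def)
    next
      case False
      have "last p \<in> set Z1 \<union> set Z2 \<union> set tb" using p(3) by blast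
      with False have lpZ: "last p \<in> set Z1 \<union> set Z2 - B1 - B2" using pB gpathD(6)[OF p(1)] by blast
      have "z = last p" if "z \<in> set p" "z \<in> B1 \<union> B2 \<union> set Z1 \<union> set Z2" for z
        using that pB pQ[of z] by blast
      then have "set p \<inter> (B1 \<union> B2 \<union> set Z1 \<union> set Z2) = {last p}"
        using lpZ gpathD(6)[OF p(1)] by blast
      then obtain ta' where ta': "tail_to E S (B1 \<union> B2 \<union> set Z1 \<union> set Z2) a ta'" "last ta' = last p"
        "set ta' \<subseteq> set ta \<union> set p"
        using tail_reroute[OF ta pS p(2)] by blast
      have "set p \<inter> set tb = {}"
      proof (rule ccontr)
        assume "set p \<inter> set tb \<noteq> {}"
        then obtain z where "z \<in> set p" "z \<in> set tb" by blast
        then show False using pQ[of z] False by auto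
      qed
      then have "set ta' \<inter> set tb = {}" using ta'(3) dis by blast
      then show ?thesis using linked_interior[OF cfg ta'(1) tb] ta'(2) lpZ lb by simp
    qed
  qed
qed

text \<open>Exchanging the two paths, and reversing both so as to exchange the blocks, reduces every
  position with a tail ending in a block to \<open>linked_one_in_block\<close>.\<close>

lemma linked_one_interior:
  assumes cfg: "cfg E S X K1 K2 B1 B2 Z1 Z2"
    and ta: "tail_to E S (B1 \<union> B2 \<union> set Z1 \<union> set Z2) a ta"
    and tb: "tail_to E S (B1 \<union> B2 \<union> set Z1 \<union> set Z2) b tb"
    and dis: "set ta \<inter> set tb = {}" and aK: "a \<notin> K1 \<union> K2"
    and lb: "last tb \<in> set Z1 \<union> set Z2 - B1 - B2"
  shows "linked E S B1 B2 a b"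
proof -
  have W1: "B1 \<union> B2 \<union> set Z1 \<union> set Z2 = B1 \<union> B2 \<union> set Z2 \<union> set Z1"
    and W2: "B1 \<union> B2 \<union> set Z1 \<union> set Z2 = B2 \<union> B1 \<union> set (rev Z1) \<union> set (rev Z2)"
    and W3: "B1 \<union> B2 \<union> set Z1 \<union> set Z2 = B2 \<union> B1 \<union> set (rev Z2) \<union> set (rev Z1)" by auto
  have tW: "tail_to E S W a ta" "tail_to E S W b tb"
    if "B1 \<union> B2 \<union> set Z1 \<union> set Z2 = W" for W
    using ta tb that by simp_all
  have "last ta \<in> B1 \<union> B2 \<union> set Z1 \<union> set Z2" using ta by (auto simp: tail_to_def)
  then consider "last ta \<in> set Z1 \<union> set Z2 - B1 - B2" | "last ta \<in> B1" | "last ta \<in> B2" by blast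
  then show ?thesis
  proof cases
    case 1
    then show ?thesis using linked_interior[OF cfg ta tb dis _ lb] by blast
  next
    case 2
    show ?thesis
    proof (cases "last tb \<in> set Z1")
      case True
      then show ?thesis using linked_one_in_block[OF cfg ta tb dis _ 2] aK lb by blast
    next
      case False
      then show ?thesis
        using linked_one_in_block[OF cfg_swap(1)[OF cfg] tW(1)[OF W1] tW(2)[OF W1] dis _ 2] aK lb by blast
    qed
  next
    case 3
    have "linked E S B2 B1 a b"
    proof (cases "last tb \<in> set Z1")
      case True
      then have "last tb \<in> set (rev Z1) - B2 - B1" using lb by auto
      then show ?thesis
        using linked_one_in_block[OF cfg_swap(2)[OF cfg] tW(1)[OF W2] tW(2)[OF W2] dis _ 3] aK by blast
    next
      case False
      then have "last tb \<in> set (rev Z2) - B2 - B1" using lb by auto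
      then show ?thesis
        using linked_one_in_block[OF cfg_swap(1)[OF cfg_swap(2)[OF cfg]] tW(1)[OF W3] tW(2)[OF W3] dis _ 3] aK
        by blast
    qed
    then show ?thesis by (rule linked_sym(2))
  qed
qed

text \<open>If both tails end in blocks, a shortest path in \<open>X\<close> from their union to
  \<open>Z1\<close> or \<open>Z2\<close> starts on one tail and avoids the other. Rerouting the
  former along it gives an end in the interior of a path.\<close>

lemma linked_tails:
  assumes cfg: "cfg E S X K1 K2 B1 B2 Z1 Z2"
    and ta: "tail_to E S (B1 \<union> B2 \<union> set Z1 \<union> set Z2) a ta"
    and tb: "tail_to E S (B1 \<union> B2 \<union> set Z1 \<union> set Z2) b tb"
    and dis: "set ta \<inter> set tb = {}" and aK: "a \<notin> K1 \<union> K2" and bK: "b \<notin> K1 \<union> K2"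
  shows "linked E S B1 B2 a b"
proof -
  note c = cfgD[OF cfg] and e = cfg_ends[OF cfg] and mem = cfg_mem[OF cfg]
  have dis': "set tb \<inter> set ta = {}" using dis by blast
  have l: "last ta \<in> B1 \<union> B2 \<union> set Z1 \<union> set Z2" "last tb \<in> B1 \<union> B2 \<union> set Z1 \<union> set Z2"
    using ta tb by (auto simp: tail_to_def)
  consider "last tb \<in> set Z1 \<union> set Z2 - B1 - B2" | "last ta \<in> set Z1 \<union> set Z2 - B1 - B2"
    | "last ta \<in> B1 \<union> B2" "last tb \<in> B1 \<union> B2" using l by blast
  then show ?thesis
  proof cases
    case 1
    show ?thesis by (rule linked_one_interior[OF cfg ta tb dis aK 1])
  next
    case 2
    show ?thesis by (rule linked_sym(1), rule linked_one_interior[OF cfg tb ta dis' bK 2])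
  next
    case 3
    have t: "gpath E S ta" "hd ta = a" using ta by (auto simp: tail_to_def)
    have "set ta \<inter> X \<noteq> {}"
    proof (cases "last ta \<in> B1")
      case True
      then show ?thesis using piece_path[OF t(1) c(3) _ _ sym_E] t(2) aK c(6) by blast
    next
      case False
      then show ?thesis using piece_path[OF t(1) c(4) _ _ sym_E] t(2) aK c(7) 3(1) by blast
    qed
    then obtain p where p: "gpath E X p" "set p \<inter> (set ta \<union> set tb) = {hd p}"
      "set p \<inter> (set Z1 \<union> set Z2) = {last p}"
      using conn_link[OF c(1), of "set ta \<union> set tb" "set Z1 \<union> set Z2"] e(12) by blast
    have pX: "set p \<subseteq> X" using gpathD(3)[OF p(1)] .
    have pS: "gpath E S p" using gpath_mono[OF p(1)] pX c(2) by blast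
    have pB: "set p \<inter> (B1 \<union> B2) = {}" using pX e(8,9) by blast
    have lp: "last p \<in> set Z1 \<union> set Z2 - B1 - B2"
      using p(3) pB gpathD(6)[OF p(1)] by (metis Diff_iff Diff_triv IntD2 UnCI singletonI)
    have pW: "set p \<inter> (B1 \<union> B2 \<union> set Z1 \<union> set Z2) = {last p}"
    proof -
      have "set p \<inter> (B1 \<union> B2 \<union> set Z1 \<union> set Z2) = (set p \<inter> (B1 \<union> B2)) \<union> (set p \<inter> (set Z1 \<union> set Z2))" by blast
      then show ?thesis using p(3) pB by simp
    qed
    have pQ: "z = hd p" if "z \<in> set p" "z \<in> set ta \<union> set tb" for z
      using p(2) that by (metis IntI singletonD)
    consider "hd p \<in> set ta" | "hd p \<in> set tb" using p(2) by blast
    then show ?thesis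
    proof cases
      case 1
      have "set p \<inter> set tb = {}"
      proof (rule ccontr)
        assume "set p \<inter> set tb \<noteq> {}"
        then obtain z where "z \<in> set p" "z \<in> set tb" by blast
        then show False using pQ[of z] 1 dis by auto
      qed
      moreover have "set p \<inter> set ta = {hd p}" using p(2) calculation by blast
      ultimately obtain ta' where
        ta': "tail_to E S (B1 \<union> B2 \<union> set Z1 \<union> set Z2) a ta'" "last ta' = last p"
        "set tb \<inter> set ta' = {}"
        using tail_reroute[OF ta pS _ pW] dis by blast
      show ?thesis
        by (rule linked_sym(1), rule linked_one_interior[OF cfg tb ta'(1,3) bK]) (use ta'(2) lp in simp)
    next
      case 2
      have "set p \<inter> set ta = {}"
      proof (rule ccontr)
        assume "set p \<inter> set ta \<noteq> {}"
        then obtain z where "z \<in> set p" "z \<in> set ta" by blast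
        then show False using pQ[of z] 2 dis by auto
      qed
      moreover have "set p \<inter> set tb = {hd p}" using p(2) calculation by blast
      ultimately obtain tb' where
        tb': "tail_to E S (B1 \<union> B2 \<union> set Z1 \<union> set Z2) b tb'" "last tb' = last p"
        "set ta \<inter> set tb' = {}"
        using tail_reroute[OF tb pS _ pW] dis by blast
      show ?thesis
        by (rule linked_one_interior[OF cfg ta tb'(1,3) aK]) (use tb'(2) lp in simp)
    qed
  qed
qed

lemma biconn_card:
  assumes "biconn E B" "finite B" shows "2 \<le> card B"
proof -
  obtain x where x: "x \<in> B" using assms(1) by (auto simp: biconn_def conn_def)
  have "B - {x} \<noteq> {}" using assms(1) conn_nonempty by (metis biconn_def)
  then obtain y where "y \<in> B" "y \<noteq> x" by blast
  then have "card {x, y} \<le> card B" using x assms(2) by (intro card_mono) auto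
  then show ?thesis using \<open>y \<noteq> x\<close> by simp
qed

lemma linked_blocks:
  assumes S: "finite S" "biconn E S" and X: "conn E X" "X \<subseteq> S"
    and K: "piece E S X K1" "piece E S X K2" "K1 \<inter> K2 = {}"
    and B: "B1 \<subseteq> K1" "B2 \<subseteq> K2" "biconn E B1" "biconn E B2"
    and ab: "a \<in> S" "b \<in> S" "a \<noteq> b" "a \<notin> K1 \<union> K2" "b \<notin> K1 \<union> K2"
  shows "linked E S B1 B2 a b"
proof -
  have BS: "B1 \<subseteq> S" "B2 \<subseteq> S" using B(1,2) K(1,2) by (auto simp: piece_def)
  then have fB: "finite B1" "finite B2" using S(1) finite_subset by auto
  obtain Z1 Z2 where Z: "gpath E S Z1" "gpath E S Z2" "set Z1 \<inter> set Z2 = {}" "set Z1 \<inter> B1 = {hd Z1}"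
    "set Z1 \<inter> B2 = {last Z1}" "set Z2 \<inter> B1 = {hd Z2}" "set Z2 \<inter> B2 = {last Z2}"
    using biconn_two_paths[OF S BS biconn_card[OF B(3) fB(1)] biconn_card[OF B(4) fB(2)]]
    by (elim exE conjE) (rule that, assumption+)
  have cfg: "cfg E S X K1 K2 B1 B2 Z1 Z2" unfolding cfg_def using X K B(1,2) Z by simp
  define W where "W = B1 \<union> B2 \<union> set Z1 \<union> set Z2"
  have WS: "W \<subseteq> S" using BS gpathD(3)[OF Z(1)] gpathD(3)[OF Z(2)] by (auto simp: W_def)
  then have "finite W" using S(1) finite_subset by blast
  then have cW: "2 \<le> card W"
    using biconn_card[OF B(3) fB(1)] card_mono[of W B1] unfolding W_def by (meson Un_upper1 order_trans)
  have pab: "{a, b} \<subseteq> S" "2 \<le> card {a, b}" using ab by auto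
  obtain p q where pq: "gpath E S p" "gpath E S q" "set p \<inter> set q = {}" "set p \<inter> {a, b} = {hd p}"
    "set p \<inter> W = {last p}" "set q \<inter> {a, b} = {hd q}" "set q \<inter> W = {last q}"
    using biconn_two_paths[OF S pab(1) WS pab(2) cW]
    by (elim exE conjE) (rule that, assumption+)
  have "hd p \<in> {a, b}" "hd q \<in> {a, b}" "hd p \<noteq> hd q"
    using pq(3,4,6) gpathD(5)[OF pq(1)] gpathD(5)[OF pq(2)] by blast+
  then consider "hd p = a" "hd q = b" | "hd p = b" "hd q = a" by auto
  then show ?thesis
  proof cases
    case 1
    have "tail_to E S W a p" "tail_to E S W b q" using 1 pq by (auto simp: tail_to_def)
    then show ?thesis using linked_tails[OF cfg _ _ pq(3) ab(4,5)] by (simp add: W_def)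
  next
    case 2
    have "tail_to E S W b p" "tail_to E S W a q" using 2 pq by (auto simp: tail_to_def)
    moreover have "set q \<inter> set p = {}" using pq(3) by blast
    ultimately show ?thesis using linked_tails[OF cfg _ _ _ ab(4,5)] by (simp add: W_def)
  qed
qed

end

section \<open>Rooted models\<close>

text \<open>The edges of \<open>nabla\<close>, each listed once from its smaller to its larger end,
  preceded by a stage 0 that is a lone root edge and starts the induction. In a new triangle two
  edges are the root edges of the copies, so only the third is added.\<close>

fun nab_arcs :: "nat \<Rightarrow> (nat \<times> nat) set" where
  "nab_arcs 0 = {(0, 1)}"
| "nab_arcs (Suc i) = nab_arcs i \<union> map_prod ((+) (2 ^ i)) ((+) (2 ^ i)) ` nab_arcs i \<union> {(0, 2 ^ Suc i)}"

lemma nab_arcs_le: "(m, m') \<in> nab_arcs i \<Longrightarrow> m \<le> 2 ^ i \<and> m' \<le> 2 ^ i"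
  by (induction i arbitrary: m m') (fastforce simp: map_prod_def)+

text \<open>The reflection behind \<open>rnabla_sym\<close>; it exchanges the two copies of the
  previous stage.\<close>

lemma nab_arcs_rev: "(m, m') \<in> nab_arcs i \<Longrightarrow> (2 ^ i - m', 2 ^ i - m) \<in> nab_arcs i"
proof (induction i arbitrary: m m')
  case (Suc i)
  define n :: nat where "n = 2 ^ i"
  consider "(m, m') \<in> nab_arcs i" | k k' where "(k, k') \<in> nab_arcs i" "m = n + k" "m' = n + k'"
    | "m = 0" "m' = n + n" using Suc.prems by (auto simp: n_def)
  then show ?case
  proof cases
    case 1
    then have "(n + (n - m'), n + (n - m)) \<in> map_prod ((+) n) ((+) n) ` nab_arcs i"
      using Suc.IH[of m m'] by (auto simp: n_def intro!: image_eqI[of _ _ "(2 ^ i - m', 2 ^ i - m)"])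
    moreover have "m \<le> n" "m' \<le> n" using nab_arcs_le[OF 1] by (auto simp: n_def)
    ultimately show ?thesis by (simp add: n_def mult_2)
  next
    case 2
    then have "(n - k', n - k) \<in> nab_arcs i" using Suc.IH by (simp add: n_def)
    then show ?thesis using 2 by (simp add: n_def mult_2)
  qed (simp add: n_def mult_2)
qed simp

definition rnabla :: "('a \<times> 'a) set \<Rightarrow> nat \<Rightarrow> 'a \<Rightarrow> 'a \<Rightarrow> 'a set \<Rightarrow> bool" where
  "rnabla E i a b S \<longleftrightarrow> (\<exists>\<phi>. (\<forall>m\<le>2 ^ i. conn E (\<phi> m) \<and> \<phi> m \<subseteq> S) \<and>
     (\<forall>m\<le>2 ^ i. \<forall>m'\<le>2 ^ i. m \<noteq> m' \<longrightarrow> \<phi> m \<inter> \<phi> m' = {}) \<and>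
     (\<forall>m m'. (m, m') \<in> nab_arcs i \<longrightarrow> touches E (\<phi> m) (\<phi> m')) \<and> a \<in> \<phi> 0 \<and> b \<in> \<phi> (2 ^ i))"

lemma rnablaE:
  assumes "rnabla E i a b S"
  obtains \<phi> where "\<And>m. m \<le> 2 ^ i \<Longrightarrow> conn E (\<phi> m)" "\<And>m. m \<le> 2 ^ i \<Longrightarrow> \<phi> m \<subseteq> S"
    "\<And>m m'. m \<le> 2 ^ i \<Longrightarrow> m' \<le> 2 ^ i \<Longrightarrow> m \<noteq> m' \<Longrightarrow> \<phi> m \<inter> \<phi> m' = {}"
    "\<And>m m'. (m, m') \<in> nab_arcs i \<Longrightarrow> touches E (\<phi> m) (\<phi> m')" "a \<in> \<phi> 0" "b \<in> \<phi> (2 ^ i)"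
proof -
  obtain \<phi> where \<phi>: "\<forall>m\<le>2 ^ i. conn E (\<phi> m) \<and> \<phi> m \<subseteq> S"
     "\<forall>m\<le>2 ^ i. \<forall>m'\<le>2 ^ i. m \<noteq> m' \<longrightarrow> \<phi> m \<inter> \<phi> m' = {}"
     "\<forall>m m'. (m, m') \<in> nab_arcs i \<longrightarrow> touches E (\<phi> m) (\<phi> m')" "a \<in> \<phi> 0" "b \<in> \<phi> (2 ^ i)"
    using assms unfolding rnabla_def by (elim exE conjE) (rule that)
  show thesis by (rule that[of \<phi>]) (use \<phi> in \<open>simp_all\<close>)
qed

context ugraph
begin

lemma conn_absorb:
  assumes "conn E P" "p \<in> P" "conn E (insert p A)"
  shows "conn E (P \<union> A)"
proof -
  have "conn E (P \<union> insert p A)" using assms by (rule_tac conn_Un) auto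
  moreover have "P \<union> insert p A = P \<union> A" using assms(2) by auto
  ultimately show ?thesis by simp
qed

lemma rnabla_sym:
  assumes "rnabla E i a b S" shows "rnabla E i b a S"
proof -
  obtain \<phi> where \<phi>: "\<And>m. m \<le> 2 ^ i \<Longrightarrow> conn E (\<phi> m)" "\<And>m. m \<le> 2 ^ i \<Longrightarrow> \<phi> m \<subseteq> S"
    "\<And>m m'. m \<le> 2 ^ i \<Longrightarrow> m' \<le> 2 ^ i \<Longrightarrow> m \<noteq> m' \<Longrightarrow> \<phi> m \<inter> \<phi> m' = {}"
    "\<And>m m'. (m, m') \<in> nab_arcs i \<Longrightarrow> touches E (\<phi> m) (\<phi> m')" "a \<in> \<phi> 0" "b \<in> \<phi> (2 ^ i)"
    by (rule rnablaE[OF assms]) (rule that, simp_all)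
  have "\<phi> (2 ^ i - m) \<inter> \<phi> (2 ^ i - m') = {}" if "m \<le> 2 ^ i" "m' \<le> 2 ^ i" "m \<noteq> m'" for m m'
    using that by (intro \<phi>(3)) auto
  moreover have "touches E (\<phi> (2 ^ i - m)) (\<phi> (2 ^ i - m'))" if "(m, m') \<in> nab_arcs i" for m m'
    using touches_sym[OF \<phi>(4)[OF nab_arcs_rev[OF that]]] .
  ultimately show ?thesis unfolding rnabla_def using \<phi>(1,2,5,6)
    by (intro exI[of _ "\<lambda>m. \<phi> (2 ^ i - m)"]) simp
qed

text \<open>For a block that contains the full model already: whatever leads from \<open>p\<close>
  to \<open>a\<close> and from \<open>q\<close> to \<open>b\<close> outside the block is absorbed
  into the two root sets.\<close>

lemma rnabla_extend:
  assumes N: "rnabla E i p q B" and B: "B \<union> A \<union> D \<subseteq> S" "(A \<union> D) \<inter> B = {}" "A \<inter> D = {}"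
    and A: "conn E (insert p A)" "a \<in> insert p A" and D: "conn E (insert q D)" "b \<in> insert q D"
  shows "rnabla E i a b S"
proof -
  obtain \<phi> where \<phi>: "\<And>m. m \<le> 2 ^ i \<Longrightarrow> conn E (\<phi> m)" "\<And>m. m \<le> 2 ^ i \<Longrightarrow> \<phi> m \<subseteq> B"
    "\<And>m m'. m \<le> 2 ^ i \<Longrightarrow> m' \<le> 2 ^ i \<Longrightarrow> m \<noteq> m' \<Longrightarrow> \<phi> m \<inter> \<phi> m' = {}"
    "\<And>m m'. (m, m') \<in> nab_arcs i \<Longrightarrow> touches E (\<phi> m) (\<phi> m')" "p \<in> \<phi> 0" "q \<in> \<phi> (2 ^ i)"
    by (rule rnablaE[OF N]) (rule that, simp_all)
  define \<theta> where "\<theta> m = (if m = 0 then \<phi> 0 \<union> A else if m = 2 ^ i then \<phi> m \<union> D else \<phi> m)" for m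
  have n0: "(2::nat) ^ i \<noteq> 0" by simp
  have sub: "\<phi> m \<subseteq> \<theta> m" for m by (simp add: \<theta>_def)
  have "conn E (\<theta> m)" if "m \<le> 2 ^ i" for m
    using \<phi>(1)[OF that] conn_absorb[OF \<phi>(1) \<phi>(5) A(1)] conn_absorb[OF \<phi>(1) \<phi>(6) D(1)]
    by (simp add: \<theta>_def)
  moreover have "\<theta> m \<subseteq> S" if "m \<le> 2 ^ i" for m
    using \<phi>(2)[OF that] B(1) by (auto simp: \<theta>_def)
  moreover have "\<theta> m \<inter> \<theta> m' = {}" if m: "m \<le> 2 ^ i" "m' \<le> 2 ^ i" "m \<noteq> m'" for m m'
  proof -
    have "\<phi> m \<inter> \<phi> m' = {}" by (rule \<phi>(3)[OF m])
    moreover have "\<phi> m \<inter> (A \<union> D) = {}" "\<phi> m' \<inter> (A \<union> D) = {}" using \<phi>(2) m B(2) by blast+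
    ultimately show ?thesis using m(3) B(3) n0 unfolding \<theta>_def by auto
  qed
  moreover have "touches E (\<theta> m) (\<theta> m')" if "(m, m') \<in> nab_arcs i" for m m'
    using \<phi>(4)[OF that] sub sub by (rule touches_mono)
  moreover have "a \<in> \<theta> 0" "b \<in> \<theta> (2 ^ i)" using A(2) D(2) \<phi>(5,6) n0 by (auto simp: \<theta>_def)
  ultimately show ?thesis unfolding rnabla_def by (intro exI[of _ \<theta>]) simp
qed

lemma rgplus_extend:
  assumes N: "rgplus E j p q B" and B: "B \<union> A \<union> D \<subseteq> S" "(A \<union> D) \<inter> B = {}" "A \<inter> D = {}"
    and A: "conn E (insert p A)" "a \<in> insert p A" and D: "conn E (insert q D)" "b \<in> insert q D"
  shows "rgplus E j a b S"
proof -
  obtain \<psi> Q where \<psi>: "tmodel E (words j) \<psi> B" "conn E Q" "Q \<subseteq> B"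
     "\<And>w. w \<in> words j \<Longrightarrow> \<psi> w \<inter> Q = {}" "\<And>w. length w = j \<Longrightarrow> touches E (\<psi> w) Q" "p \<in> \<psi> []" "q \<in> Q"
    using N unfolding rgplus_def by blast
  define \<theta> where "\<theta> w = (if w = [] then \<psi> w \<union> A else \<psi> w)" for w
  note T = tmodelD[OF \<psi>(1)]
  have sub: "\<psi> w \<subseteq> \<theta> w" for w by (simp add: \<theta>_def)
  have nil: "[] \<in> words j" by simp
  have "tmodel E (words j) \<theta> S"
    unfolding tmodel_def
  proof (intro conjI ballI allI impI)
    fix w assume w: "w \<in> words j"
    show "conn E (\<theta> w)" using T(1)[OF w] conn_absorb[OF T(1)[OF nil] \<psi>(6) A(1)] by (simp add: \<theta>_def)
    show "\<theta> w \<subseteq> S" using T(2)[OF w] B(1) by (auto simp: \<theta>_def)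
  next
    fix w w' assume w: "w \<in> words j" "w' \<in> words j" "w \<noteq> w'"
    have "\<psi> w \<inter> A = {}" "\<psi> w' \<inter> A = {}" using T(2) w B(2) by blast+
    then show "\<theta> w \<inter> \<theta> w' = {}" using T(3)[OF w] w(3) unfolding \<theta>_def by auto
  next
    fix w b assume w: "w \<in> words j" "b # w \<in> words j"
    show "touches E (\<theta> w) (\<theta> (b # w))" using T(4)[OF w] sub sub by (rule touches_mono)
  qed
  moreover have "conn E (Q \<union> D)" by (rule conn_absorb[OF \<psi>(2,7) D(1)])
  moreover have "Q \<union> D \<subseteq> S" using \<psi>(3) B(1) by blast
  moreover have "\<theta> w \<inter> (Q \<union> D) = {}" if w: "w \<in> words j" for w
  proof -
    have "\<psi> w \<inter> D = {}" "A \<inter> Q = {}" using T(2)[OF w] B(2) \<psi>(3) by blast+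
    then show ?thesis using \<psi>(4)[OF w] B(3) by (auto simp: \<theta>_def)
  qed
  moreover have "touches E (\<theta> w) (Q \<union> D)" if "length w = j" for w
    using \<psi>(5)[OF that] sub Un_upper1 by (rule touches_mono)
  moreover have "a \<in> \<theta> []" "b \<in> Q \<union> D" using A(2) D(2) \<psi>(6,7) by (auto simp: \<theta>_def)
  ultimately show ?thesis unfolding rgplus_def by (intro exI[of _ \<theta>] exI[of _ "Q \<union> D"]) blast
qed

text \<open>The copies use the indices from \<open>0\<close> to \<open>n\<close> and from
  \<open>n\<close> to \<open>n + n\<close>. The shared index \<open>n\<close> receives the last set
  of the first copy, the first set of the second, and \<open>C\<close> in between; this is why the
  second model is rooted in the order \<open>q2\<close>, \<open>q1\<close>. The new root edge comes
  from \<open>AD\<close>.\<close>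

lemma rnabla_series:
  assumes N1: "rnabla E i p1 p2 B1" and N2: "rnabla E i q2 q1 B2"
    and B: "B1 \<union> B2 \<subseteq> S" "B1 \<inter> B2 = {}"
    and ACD: "A \<union> C \<union> D \<subseteq> S - B1 - B2" "A \<inter> C = {}" "A \<inter> D = {}" "C \<inter> D = {}"
    and A: "conn E (insert p1 A)" "a \<in> insert p1 A" and C: "conn E (C \<union> {p2, q2})"
    and D: "conn E (insert q1 D)" "b \<in> insert q1 D" and AD: "touches E (insert p1 A) (insert q1 D)"
  shows "rnabla E (Suc i) a b S"
proof -
  define n :: nat where "n = 2 ^ i"
  have n0: "n \<noteq> 0" by (simp add: n_def)
  have Sn: "(2::nat) ^ Suc i = n + n" by (simp add: n_def)
  obtain \<phi> where \<phi>0: "\<And>m. m \<le> 2 ^ i \<Longrightarrow> conn E (\<phi> m)" "\<And>m. m \<le> 2 ^ i \<Longrightarrow> \<phi> m \<subseteq> B1"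
    "\<And>m m'. m \<le> 2 ^ i \<Longrightarrow> m' \<le> 2 ^ i \<Longrightarrow> m \<noteq> m' \<Longrightarrow> \<phi> m \<inter> \<phi> m' = {}"
    "\<And>m m'. (m, m') \<in> nab_arcs i \<Longrightarrow> touches E (\<phi> m) (\<phi> m')" "p1 \<in> \<phi> 0" "p2 \<in> \<phi> (2 ^ i)"
    by (rule rnablaE[OF N1]) (rule that, simp_all)
  note \<phi> = \<phi>0[folded n_def]
  obtain \<chi> where \<chi>0: "\<And>m. m \<le> 2 ^ i \<Longrightarrow> conn E (\<chi> m)" "\<And>m. m \<le> 2 ^ i \<Longrightarrow> \<chi> m \<subseteq> B2"
    "\<And>m m'. m \<le> 2 ^ i \<Longrightarrow> m' \<le> 2 ^ i \<Longrightarrow> m \<noteq> m' \<Longrightarrow> \<chi> m \<inter> \<chi> m' = {}"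
    "\<And>m m'. (m, m') \<in> nab_arcs i \<Longrightarrow> touches E (\<chi> m) (\<chi> m')" "q2 \<in> \<chi> 0" "q1 \<in> \<chi> (2 ^ i)"
    by (rule rnablaE[OF N2]) (rule that, simp_all)
  note \<chi> = \<chi>0[folded n_def]
  \<comment> \<open>\<open>L\<close>, \<open>R\<close> and \<open>M\<close> are the shares of the
    first block, the second block and the middle. They live in disjoint regions, so disjointness is
    checked share by share.\<close>
  define L where "L m = (if m \<le> n then \<phi> m \<union> (if m = 0 then A else {}) else {})" for m
  define R where "R m = (if n \<le> m then \<chi> (m - n) \<union> (if m = n + n then D else {}) else {})" for m
  define M where "M m = (if m = n then C else {})" for m
  define \<theta> where "\<theta> m = L m \<union> R m \<union> M m" for m
  have LB: "L m \<subseteq> B1 \<union> A" for m using \<phi>(2)[of m] by (auto simp: L_def)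
  have RB: "R m \<subseteq> B2 \<union> D" if "m \<le> n + n" for m
  proof (cases "n \<le> m")
    case True
    then have "\<chi> (m - n) \<subseteq> B2" using that by (intro \<chi>(2)) simp
    then show ?thesis by (auto simp: R_def)
  qed (simp add: R_def)
  have MC: "M m \<subseteq> C" for m by (simp add: M_def)
  have LL: "L m \<inter> L m' = {}" if "m \<noteq> m'" for m m'
  proof (cases "m \<le> n \<and> m' \<le> n")
    case True
    then have "\<phi> m \<inter> \<phi> m' = {}" using that by (intro \<phi>(3)) auto
    moreover have "\<phi> m \<inter> A = {}" "\<phi> m' \<inter> A = {}" using True \<phi>(2) ACD(1) by blast+
    ultimately show ?thesis using that by (auto simp: L_def)
  qed (auto simp: L_def)
  have RR: "R m \<inter> R m' = {}" if "m \<noteq> m'" "m \<le> n + n" "m' \<le> n + n" for m m'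
  proof (cases "n \<le> m \<and> n \<le> m'")
    case True
    then have "\<chi> (m - n) \<inter> \<chi> (m' - n) = {}" using that by (intro \<chi>(3)) auto
    moreover have "\<chi> (m - n) \<subseteq> B2" "\<chi> (m' - n) \<subseteq> B2" using True that by (auto intro!: \<chi>(2))
    then have "\<chi> (m - n) \<inter> D = {}" "\<chi> (m' - n) \<inter> D = {}" using ACD(1) by blast+
    ultimately show ?thesis using that by (auto simp: R_def)
  qed (auto simp: R_def)
  have reg: "(B1 \<union> A) \<inter> (B2 \<union> D) = {}" "(B1 \<union> A) \<inter> C = {}" "(B2 \<union> D) \<inter> C = {}"
    using ACD B(2) by blast+
  have "\<theta> m \<inter> \<theta> m' = {}" if m: "m \<le> n + n" "m' \<le> n + n" "m \<noteq> m'" for m m'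
  proof -
    have "L m \<inter> L m' = {}" "R m \<inter> R m' = {}" "M m \<inter> M m' = {}"
      using LL[OF m(3)] RR[OF m(3,1,2)] m(3) by (auto simp: M_def)
    moreover have "L m \<inter> R m' = {}" "R m \<inter> L m' = {}" "L m \<inter> M m' = {}" "M m \<inter> L m' = {}"
      "R m \<inter> M m' = {}" "M m \<inter> R m' = {}"
      using LB[of m] LB[of m'] RB[OF m(1)] RB[OF m(2)] MC[of m] MC[of m'] reg by blast+
    ultimately show ?thesis unfolding \<theta>_def by (simp add: Int_Un_distrib Int_Un_distrib2)
  qed
  moreover have "conn E (\<theta> m)" if m: "m \<le> n + n" for m
  proof -
    have cL: "conn E (\<phi> 0 \<union> A)" by (rule conn_absorb[OF \<phi>(1) \<phi>(5) A(1)]) simp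
    have cR: "conn E (\<chi> n \<union> D)" by (rule conn_absorb[OF \<chi>(1) \<chi>(6) D(1)]) simp
    consider "m < n" | "m = n" | "n < m" "m < n + n" | "m = n + n" using m by linarith
    then show ?thesis
    proof cases
      case 1
      then have "\<theta> m = (if m = 0 then \<phi> 0 \<union> A else \<phi> m)" by (auto simp: \<theta>_def L_def R_def M_def)
      then show ?thesis using cL \<phi>(1)[of m] 1 by simp
    next
      case 2
      have "conn E (\<phi> n \<union> (C \<union> {p2, q2}))" using \<phi>(1)[of n] \<phi>(6) C by (rule_tac conn_Un) auto
      then have "conn E ((\<phi> n \<union> (C \<union> {p2, q2})) \<union> \<chi> 0)" using \<chi>(1)[of 0] \<chi>(5) by (rule_tac conn_Un) auto
      moreover have "\<theta> m = (\<phi> n \<union> (C \<union> {p2, q2})) \<union> \<chi> 0"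
        using 2 n0 \<phi>(6) \<chi>(5) by (auto simp: \<theta>_def L_def R_def M_def)
      ultimately show ?thesis by simp
    next
      case 3
      then have "\<theta> m = \<chi> (m - n)" by (auto simp: \<theta>_def L_def R_def M_def)
      then show ?thesis using \<chi>(1)[of "m - n"] 3 by simp
    next
      case 4
      then have "\<theta> m = \<chi> n \<union> D" using n0 by (auto simp: \<theta>_def L_def R_def M_def)
      then show ?thesis using cR by simp
    qed
  qed
  moreover have "\<theta> m \<subseteq> S" if "m \<le> n + n" for m
    using LB[of m] RB[OF that] MC[of m] B(1) ACD(1) unfolding \<theta>_def by blast
  moreover have \<phi>\<theta>: "\<phi> m \<subseteq> \<theta> m" if "m \<le> n" for m using that by (auto simp: \<theta>_def L_def)
  have \<chi>\<theta>: "\<chi> m \<subseteq> \<theta> (n + m)" if "m \<le> n" for m using that by (auto simp: \<theta>_def R_def)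
  have 0: "insert p1 A \<subseteq> \<theta> 0" using \<phi>(5) by (auto simp: \<theta>_def L_def)
  have 1: "insert q1 D \<subseteq> \<theta> (n + n)" using \<chi>(6) by (auto simp: \<theta>_def R_def)
  have "touches E (\<theta> m) (\<theta> m')" if arc: "(m, m') \<in> nab_arcs (Suc i)" for m m'
  proof -
    consider "(m, m') \<in> nab_arcs i" | k k' where "(k, k') \<in> nab_arcs i" "m = n + k" "m' = n + k'"
      | "m = 0" "m' = n + n" using arc by (auto simp: n_def)
    then show ?thesis
    proof cases
      case 1
      then show ?thesis using \<phi>(4) nab_arcs_le[of m m' i] \<phi>\<theta> touches_mono unfolding n_def by metis
    next
      case 2
      then show ?thesis using \<chi>(4) nab_arcs_le[of k k' i] \<chi>\<theta> touches_mono unfolding n_def by metis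
    next
      case 3
      then show ?thesis using touches_mono[OF AD 0 1] by simp
    qed
  qed
  moreover have "a \<in> \<theta> 0" "b \<in> \<theta> (n + n)" using A(2) D(2) 0 1 by blast+
  ultimately show ?thesis unfolding rnabla_def Sn by (intro exI[of _ \<theta>]) simp
qed

text \<open>\<open>R\<close> becomes a root above the two old roots, which it touches in
  \<open>p1\<close> and \<open>q1\<close>; the two old apexes are merged through
  \<open>Q\<close>.\<close>

lemma rgplus_par:
  assumes N1: "rgplus E j p1 p2 B1" and N2: "rgplus E j q1 q2 B2"
    and B: "B1 \<union> B2 \<subseteq> S" "B1 \<inter> B2 = {}"
    and RQ: "R \<union> Q \<subseteq> S - B1 - B2" "R \<inter> Q = {}"
    and R: "conn E R" "a \<in> R" "touches E R {p1}" "touches E R {q1}"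
    and Q: "conn E (Q \<union> {p2, q2})" "b \<in> Q \<union> {p2, q2}"
  shows "rgplus E (Suc j) a b S"
proof -
  obtain \<psi>1 Q1 where \<psi>1: "tmodel E (words j) \<psi>1 B1" "conn E Q1" "Q1 \<subseteq> B1"
     "\<forall>w\<in>words j. \<psi>1 w \<inter> Q1 = {}" "\<forall>w. length w = j \<longrightarrow> touches E (\<psi>1 w) Q1" "p1 \<in> \<psi>1 []" "p2 \<in> Q1"
    using N1 unfolding rgplus_def by (elim exE conjE) (rule that)
  obtain \<psi>2 Q2 where \<psi>2: "tmodel E (words j) \<psi>2 B2" "conn E Q2" "Q2 \<subseteq> B2"
     "\<forall>w\<in>words j. \<psi>2 w \<inter> Q2 = {}" "\<forall>w. length w = j \<longrightarrow> touches E (\<psi>2 w) Q2" "q1 \<in> \<psi>2 []" "q2 \<in> Q2"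
    using N2 unfolding rgplus_def by (elim exE conjE) (rule that)
  \<comment> \<open>Children are formed at the front of a word, so its last letter tells below which
    child of the root it lies, and \<open>butlast\<close> gives its place in that subtree.\<close>
  define \<psi> where "\<psi> w = (if w = [] then R else if last w then \<psi>2 (butlast w) else \<psi>1 (butlast w))" for w
  define A where "A = Q \<union> Q1 \<union> Q2"
  note T1 = tmodelD[OF \<psi>1(1)] and T2 = tmodelD[OF \<psi>2(1)]
  have bl: "butlast w \<in> words j" if "w \<in> words (Suc j)" for w using that by simp
  have sub: "\<psi> w \<subseteq> (if w = [] then R else if last w then B2 else B1)" if "w \<in> words (Suc j)" for w
    using T1(2)[OF bl[OF that]] T2(2)[OF bl[OF that]] by (simp add: \<psi>_def)
  have "tmodel E (words (Suc j)) \<psi> S"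
    unfolding tmodel_def
  proof (intro conjI ballI allI impI)
    fix w assume w: "w \<in> words (Suc j)"
    show "conn E (\<psi> w)" using R(1) T1(1)[OF bl[OF w]] T2(1)[OF bl[OF w]] by (simp add: \<psi>_def)
    show "\<psi> w \<subseteq> S" using sub[OF w] B(1) RQ(1) by (auto split: if_splits)
  next
    fix w w' assume w: "w \<in> words (Suc j)" "w' \<in> words (Suc j)" "w \<noteq> w'"
    show "\<psi> w \<inter> \<psi> w' = {}"
    proof (cases "w \<noteq> [] \<and> w' \<noteq> [] \<and> last w = last w'")
      case True
      have "butlast w \<noteq> butlast w'"
      proof
        assume eq: "butlast w = butlast w'"
        have "w = butlast w @ [last w]" by (rule append_butlast_last_id[symmetric]) (use True in blast)
        also have "\<dots> = butlast w' @ [last w']" using eq True by simp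
        also have "\<dots> = w'" by (rule append_butlast_last_id) (use True in blast)
        finally show False using w(3) by simp
      qed
      then show ?thesis using True T1(3)[OF bl[OF w(1)] bl[OF w(2)]] T2(3)[OF bl[OF w(1)] bl[OF w(2)]]
        by (simp add: \<psi>_def)
    next
      case False
      have "R \<inter> B1 = {}" "R \<inter> B2 = {}" using RQ(1) by blast+
      then show ?thesis using sub[OF w(1)] sub[OF w(2)] False w(3) B(2)
        by (cases "w = []"; cases "w' = []"; cases "last w"; cases "last w'") auto
    qed
  next
    fix w b assume w: "w \<in> words (Suc j)" "b # w \<in> words (Suc j)"
    show "touches E (\<psi> w) (\<psi> (b # w))"
    proof (cases "w = []")
      case True
      then show ?thesis
        using touches_mono[OF R(3), of R "\<psi>1 []"] touches_mono[OF R(4), of R "\<psi>2 []"] \<psi>1(6) \<psi>2(6)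
        by (simp add: \<psi>_def)
    next
      case False
      then have "butlast (b # w) = b # butlast w" "last (b # w) = last w" by auto
      then show ?thesis using False T1(4)[OF bl[OF w(1)], of b] T2(4)[OF bl[OF w(1)], of b] bl[OF w(2)]
        by (simp add: \<psi>_def)
    qed
  qed
  moreover have "conn E A"
  proof -
    have "conn E ((Q \<union> {p2, q2}) \<union> Q1)" using Q(1) \<psi>1(2,7) by (rule_tac conn_Un) auto
    then have "conn E (((Q \<union> {p2, q2}) \<union> Q1) \<union> Q2)" using \<psi>2(2,7) by (rule_tac conn_Un) auto
    moreover have "((Q \<union> {p2, q2}) \<union> Q1) \<union> Q2 = A" using \<psi>1(7) \<psi>2(7) by (auto simp: A_def)
    ultimately show ?thesis by simp
  qed
  moreover have "A \<subseteq> S" using \<psi>1(3) \<psi>2(3) RQ(1) B(1) unfolding A_def by blast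
  moreover have "\<psi> w \<inter> A = {}" if w: "w \<in> words (Suc j)" for w
  proof -
    have d: "R \<inter> A = {}" using RQ \<psi>1(3) \<psi>2(3) unfolding A_def by blast
    have d1: "\<psi>1 (butlast w) \<inter> A = {}"
    proof -
      have "\<psi>1 (butlast w) \<inter> Q1 = {}" using \<psi>1(4) bl[OF w] by blast
      moreover have "\<psi>1 (butlast w) \<inter> (Q \<union> Q2) = {}" using T1(2)[OF bl[OF w]] RQ(1) B(2) \<psi>2(3) by blast
      ultimately show ?thesis unfolding A_def by blast
    qed
    have d2: "\<psi>2 (butlast w) \<inter> A = {}"
    proof -
      have "\<psi>2 (butlast w) \<inter> Q2 = {}" using \<psi>2(4) bl[OF w] by blast
      moreover have "\<psi>2 (butlast w) \<inter> (Q \<union> Q1) = {}" using T2(2)[OF bl[OF w]] RQ(1) B(2) \<psi>1(3) by blast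
      ultimately show ?thesis unfolding A_def by blast
    qed
    show ?thesis using d d1 d2 by (simp add: \<psi>_def)
  qed
  moreover have "touches E (\<psi> w) A" if w: "length w = Suc j" for w
  proof -
    have "length (butlast w) = j" "w \<noteq> []" using w by auto
    then have "touches E (\<psi> w) (if last w then Q2 else Q1)" using \<psi>1(5) \<psi>2(5) by (simp add: \<psi>_def)
    then show ?thesis by (rule touches_mono) (auto simp: A_def)
  qed
  moreover have "a \<in> \<psi> []" using R(2) by (simp add: \<psi>_def)
  moreover have "b \<in> A" using Q(2) \<psi>1(7) \<psi>2(7) by (auto simp: A_def)
  ultimately show ?thesis unfolding rgplus_def by (intro exI[of _ \<psi>] exI[of _ A] conjI) blast+
qed

text \<open>Stage 0 of \<open>nabla\<close> and \<open>Gamma_plus 0\<close> are both a single edge.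
  A path from \<open>a\<close> to \<open>b\<close>, split after its first vertex, is a model of
  it.\<close>

lemma rooted_base:
  assumes "conn E S" "a \<in> S" "b \<in> S" "a \<noteq> b"
  shows "rnabla E 0 a b S" "rgplus E 0 a b S"
proof -
  obtain p where p: "gpath E S p" "hd p = a" "last p = b" using conn_path[OF assms(1-3)] by blast
  obtain r where r: "p = a # r" using p(2) gpathD(1)[OF p(1)] by (cases p) auto
  have rne: "r \<noteq> []" using r p(3) assms(4) by auto
  then have cr: "conn E (set r)" using conn_gpath[OF gpath_append_right[of E S "[a]" r]] p(1) r by simp
  have ar: "a \<notin> set r" "set r \<subseteq> S" "b \<in> set r" using p r rne by (auto simp: gpath_def)
  have "(a, hd r) \<in> E" using gpathD(4)[OF p(1)] r rne by (cases r) auto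
  then have t: "touches E {a} (set r)" using rne by (auto simp: touches_def)
  show "rnabla E 0 a b S" unfolding rnabla_def
    by (intro exI[of _ "\<lambda>m. if m = 0 then {a} else set r"]) (use cr ar t assms(2) in auto)
  show "rgplus E 0 a b S" unfolding rgplus_def tmodel_def
    by (intro exI[of _ "\<lambda>m. {a}"] exI[of _ "set r"]) (use cr ar t assms(2) in auto)
qed

text \<open>\<open>i + j + j' - 2\<close> bounds the number of steps to come, as three positive
  counters have sum at least 3. The additional 1 ensures \<open>l < k - l - 3\<close>, which
  \<open>block_in_piece\<close> requires.\<close>

lemma rooted_recursion:
  assumes "finite S" "biconn E S" "tmodel E (words k) \<psi> S" "1 \<le> l" "\<not> gplus E l S"
    and "(2 * l + 3) * (i + j + j' - 2) + 1 \<le> k" and "a \<in> S" "b \<in> S" "a \<noteq> b"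
  shows "rnabla E i a b S \<or> rgplus E j a b S \<or> rgplus E j' b a S"
  using assms
proof (induction "i + j + j'" arbitrary: i j j' S k \<psi> a b rule: less_induct)
  case less
  note fin = less.prems(1) and bic = less.prems(2) and T = less.prems(3) and l = less.prems(4)
    and no = less.prems(5) and k = less.prems(6) and ab = less.prems(7-9)
  have cS: "conn E S" using bic by (simp add: biconn_def)
  show ?case
  proof (cases "i = 0 \<or> j = 0 \<or> j' = 0")
    case True
    then show ?thesis using rooted_base[OF cS ab] rooted_base[OF cS ab(2,1)] ab(3) by blast
  next
    case False
    obtain i0 j0 j0' where s: "i = Suc i0" "j = Suc j0" "j' = Suc j0'"
      using False by (metis not0_implies_Suc)
    have k2: "(2 * l + 3) * (i0 + j0 + j0') + (2 * l + 3) + 1 \<le> k" using k s by (simp add: algebra_simps)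
    then have kl: "l + 3 \<le> k" "l < k - l - 3" by linarith+
    obtain X K1 K2 \<psi>1 \<psi>2 where X: "conn E X" "X \<subseteq> S" "piece E S X K1" "piece E S X K2" "K1 \<inter> K2 = {}"
      "a \<notin> K1 \<union> K2" "b \<notin> K1 \<union> K2"
      "tmodel E (words (k - l - 3)) \<psi>1 K1" "tmodel E (words (k - l - 3)) \<psi>2 K2"
      using split_pieces[OF T kl(1) no, of a b] by (elim exE conjE) (rule that)
    define k' where "k' = k - l - 3 - l"
    obtain B1 \<chi>1 where B1: "B1 \<subseteq> K1" "biconn E B1" "tmodel E (words k') \<chi>1 B1"
      using block_in_piece[OF fin bic X(1,2,3,8) l kl(2) no, folded k'_def] by (elim exE conjE) (rule that)
    obtain B2 \<chi>2 where B2: "B2 \<subseteq> K2" "biconn E B2" "tmodel E (words k') \<chi>2 B2"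
      using block_in_piece[OF fin bic X(1,2,4,9) l kl(2) no, folded k'_def] by (elim exE conjE) (rule that)
    have BS: "B1 \<subseteq> S" "B2 \<subseteq> S" using B1(1) B2(1) X(3,4) unfolding piece_def by blast+
    have dB: "B1 \<inter> B2 = {}" using B1(1) B2(1) X(5) by blast
    have k3: "(2 * l + 3) * (i0 + j0 + j0') + 1 \<le> k'" unfolding k'_def using k2 by linarith
    \<comment> \<open>Stated for either block and for any counters whose sum is one less, since each
      kind of link lowers a different counter.\<close>
    have IH: "rnabla E x u v B \<or> rgplus E y u v B \<or> rgplus E z v u B"
      if B: "B = B1 \<or> B = B2" and xyz: "x + y + z = i0 + j0 + j0' + 2" and uv: "u \<in> B" "v \<in> B" "u \<noteq> v"
      for x y z u v B
    proof -
      have "x + y + z < i + j + j'" using xyz s by simp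
      moreover have "finite B" using B BS fin finite_subset by blast
      moreover have "biconn E B" using B B1 B2 by blast
      moreover have "\<exists>\<chi>. tmodel E (words k') \<chi> B" using B B1(3) B2(3) by blast
      moreover have "\<not> gplus E l B" using no gplus_mono B BS by blast
      moreover have "(2 * l + 3) * (x + y + z - 2) + 1 \<le> k'" using k3 xyz by simp
      ultimately show ?thesis using less.hyps[of x y z B k'] l uv by blast
    qed
    have ser: ?thesis
      if C: "C1 = B1 \<and> C2 = B2 \<or> C1 = B2 \<and> C2 = B1" and link: "series_link E S C1 C2 a b" for C1 C2
    proof -
      obtain p1 p2 q1 q2 A C D where L:
        "p1 \<in> C1" "p2 \<in> C1" "p1 \<noteq> p2" "q1 \<in> C2" "q2 \<in> C2" "q1 \<noteq> q2"
        "A \<union> C \<union> D \<subseteq> S - C1 - C2" "A \<inter> C = {}" "A \<inter> D = {}" "C \<inter> D = {}"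
        "conn E (insert p1 A)" "a \<in> insert p1 A" "conn E (C \<union> {p2, q2})"
        "conn E (insert q1 D)" "b \<in> insert q1 D" "touches E (insert p1 A) (insert q1 D)"
        using link unfolding series_link_def by (elim exE conjE) (rule that)
      have C12: "C1 \<union> C2 \<subseteq> S" "C1 \<inter> C2 = {}" using C BS dB by blast+
      have cC: "conn E C1" "conn E C2" using C B1(2) B2(2) unfolding biconn_def by blast+
      have r1: "rnabla E i0 p1 p2 C1 \<or> rgplus E j p1 p2 C1 \<or> rgplus E j' p2 p1 C1"
        using C L(1-3) s by (intro IH) auto
      have r2: "rnabla E i0 q2 q1 C2 \<or> rgplus E j q2 q1 C2 \<or> rgplus E j' q1 q2 C2"
        using C L(4-6) s by (intro IH) auto
      \<comment> \<open>If one block alone yields a tree model, the other block is used up as part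
        of the connection from its root vertex to \<open>b\<close> or to \<open>a\<close>.\<close>
      define D1 where "D1 = C \<union> C2 \<union> D"
      define A2 where "A2 = C \<union> C1 \<union> A"
      have D1: "conn E (insert p2 D1)" "b \<in> insert p2 D1"
      proof -
        have "conn E ((C \<union> {p2, q2}) \<union> C2)" using L(13,5) cC by (rule_tac conn_Un) auto
        then have "conn E (((C \<union> {p2, q2}) \<union> C2) \<union> insert q1 D)" using L(14,4) by (rule_tac conn_Un) auto
        moreover have "((C \<union> {p2, q2}) \<union> C2) \<union> insert q1 D = insert p2 D1" using L(4,5) by (auto simp: D1_def)
        ultimately show "conn E (insert p2 D1)" by simp
        show "b \<in> insert p2 D1" using L(15,4) by (auto simp: D1_def)
      qed
      have A2: "conn E (insert q2 A2)" "a \<in> insert q2 A2"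
      proof -
        have "conn E ((C \<union> {p2, q2}) \<union> C1)" using L(13,2) cC by (rule_tac conn_Un) auto
        then have "conn E (((C \<union> {p2, q2}) \<union> C1) \<union> insert p1 A)" using L(11,1) by (rule_tac conn_Un) auto
        moreover have "((C \<union> {p2, q2}) \<union> C1) \<union> insert p1 A = insert q2 A2" using L(1,2) by (auto simp: A2_def)
        ultimately show "conn E (insert q2 A2)" by simp
        show "a \<in> insert q2 A2" using L(12,1) by (auto simp: A2_def)
      qed
      have e1: "C1 \<union> A \<union> D1 \<subseteq> S" "(A \<union> D1) \<inter> C1 = {}" "A \<inter> D1 = {}"
        using C12 L(7-10) unfolding D1_def by blast+
      have e2: "C2 \<union> A2 \<union> D \<subseteq> S" "(A2 \<union> D) \<inter> C2 = {}" "A2 \<inter> D = {}"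
        using C12 L(7-10) unfolding A2_def by blast+
      have e1': "C1 \<union> D1 \<union> A \<subseteq> S" "(D1 \<union> A) \<inter> C1 = {}" "D1 \<inter> A = {}"
        and e2': "C2 \<union> D \<union> A2 \<subseteq> S" "(D \<union> A2) \<inter> C2 = {}" "D \<inter> A2 = {}"
        using e1 e2 by blast+
      consider "rnabla E i0 p1 p2 C1" "rnabla E i0 q2 q1 C2" | "rgplus E j p1 p2 C1" | "rgplus E j' p2 p1 C1"
        | "rgplus E j q2 q1 C2" | "rgplus E j' q1 q2 C2" using r1 r2 by blast
      then show ?thesis
      proof cases
        case 1
        then show ?thesis using rnabla_series[OF 1 C12 L(7-16)] s(1) by blast
      next
        case 2
        then show ?thesis using rgplus_extend[OF 2 e1 L(11,12) D1] by blast
      next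
        case 3
        then show ?thesis using rgplus_extend[OF 3 e1' D1 L(11,12)] by blast
      next
        case 4
        then show ?thesis using rgplus_extend[OF 4 e2 A2 L(14,15)] by blast
      next
        case 5
        then show ?thesis using rgplus_extend[OF 5 e2' L(14,15) A2] by blast
      qed
    qed
    \<comment> \<open>\<open>c\<close> is the vertex attached to the new tree root. \<open>y\<close>
      counts the trees with \<open>c\<close> in the root and \<open>z\<close> those with
      \<open>d\<close>, so both parallel alternatives are instances.\<close>
    have par: "rnabla E i c d S \<or> rgplus E y c d S \<or> rgplus E z d c S"
      if link: "par_link E S B1 B2 c d" and yz: "y = Suc y0" "y0 + z = j0 + j0' + 1" for c d y y0 z
    proof -
      obtain p1 p2 q1 q2 R Q where L:
        "p1 \<in> B1" "p2 \<in> B1" "p1 \<noteq> p2" "q1 \<in> B2" "q2 \<in> B2" "q1 \<noteq> q2"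
        "R \<union> Q \<subseteq> S - B1 - B2" "R \<inter> Q = {}" "conn E R" "c \<in> R" "touches E R {p1}" "touches E R {q1}"
        "conn E (Q \<union> {p2, q2})" "d \<in> Q \<union> {p2, q2}"
        using link unfolding par_link_def by (elim exE conjE) (rule that)
      have r1: "rnabla E i p1 p2 B1 \<or> rgplus E y0 p1 p2 B1 \<or> rgplus E z p2 p1 B1"
        using L(1-3) s yz by (intro IH) auto
      have r2: "rnabla E i q1 q2 B2 \<or> rgplus E y0 q1 q2 B2 \<or> rgplus E z q2 q1 B2"
        using L(4-6) s yz by (intro IH) auto
      have B12: "B1 \<union> B2 \<subseteq> S" using BS by blast
      have A1: "conn E (insert p1 R)" "c \<in> insert p1 R" and A2: "conn E (insert q1 R)" "c \<in> insert q1 R"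
        using conn_Un_touches[OF L(9) _ L(11)] conn_Un_touches[OF L(9) _ L(12)] L(10) by auto
      define D1 where "D1 = insert q2 Q"
      define D2 where "D2 = insert p2 Q"
      have "Q \<union> {p2, q2} = insert p2 D1" "Q \<union> {p2, q2} = insert q2 D2" by (auto simp: D1_def D2_def)
      then have D: "conn E (insert p2 D1)" "d \<in> insert p2 D1" "conn E (insert q2 D2)" "d \<in> insert q2 D2"
        using L(13,14) by simp_all
      have e1: "B1 \<union> R \<union> D1 \<subseteq> S" "(R \<union> D1) \<inter> B1 = {}" "R \<inter> D1 = {}"
        using L(1-8) BS dB unfolding D1_def by blast+
      have e2: "B2 \<union> R \<union> D2 \<subseteq> S" "(R \<union> D2) \<inter> B2 = {}" "R \<inter> D2 = {}"
        using L(1-8) BS dB unfolding D2_def by blast+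
      have e1': "B1 \<union> D1 \<union> R \<subseteq> S" "(D1 \<union> R) \<inter> B1 = {}" "D1 \<inter> R = {}"
        and e2': "B2 \<union> D2 \<union> R \<subseteq> S" "(D2 \<union> R) \<inter> B2 = {}" "D2 \<inter> R = {}"
        using e1 e2 by blast+
      consider "rgplus E y0 p1 p2 B1" "rgplus E y0 q1 q2 B2" | "rnabla E i p1 p2 B1" | "rgplus E z p2 p1 B1"
        | "rnabla E i q1 q2 B2" | "rgplus E z q2 q1 B2" using r1 r2 by blast
      then show ?thesis
      proof cases
        case 1
        then show ?thesis using rgplus_par[OF 1 B12 dB L(7-14)] yz(1) by blast
      next
        case 2
        then show ?thesis using rnabla_extend[OF 2 e1 A1 D(1,2)] by blast
      next
        case 3
        then show ?thesis using rgplus_extend[OF 3 e1' D(1,2) A1] by blast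
      next
        case 4
        then show ?thesis using rnabla_extend[OF 4 e2 A2 D(3,4)] by blast
      next
        case 5
        then show ?thesis using rgplus_extend[OF 5 e2' D(3,4) A2] by blast
      qed
    qed
    have "linked E S B1 B2 a b"
      by (rule linked_blocks[OF fin bic X(1-5) B1(1) B2(1) B1(2) B2(2) ab X(6,7)])
    then consider "series_link E S B1 B2 a b" | "series_link E S B2 B1 a b"
      | "par_link E S B1 B2 a b" | "par_link E S B1 B2 b a" unfolding linked_def by blast
    then show ?thesis
    proof cases
      case 1
      then show ?thesis using ser[of B1 B2] by simp
    next
      case 2
      then show ?thesis using ser[of B2 B1] by simp
    next
      case 3
      then show ?thesis using par[OF 3 s(2), of j'] s by simp
    next
      case 4
      \<comment> \<open>With \<open>b\<close> at the new root it is \<open>j'\<close> that is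
        lowered; the model of \<open>nabla\<close> is turned around afterwards.\<close>
      have "rnabla E i b a S \<or> rgplus E j' b a S \<or> rgplus E j a b S"
        using par[OF 4 s(3), of j] s by simp
      then show ?thesis using rnabla_sym by blast
    qed
  qed
qed

end

section \<open>The path-width theorem\<close>

definition bdry :: "('a \<times> 'a) set \<Rightarrow> 'a set \<Rightarrow> 'a set" where
  "bdry E X = {x \<in> X. \<exists>y. y \<notin> X \<and> (x, y) \<in> E}"

text \<open>A path decomposition of the graph induced on \<open>X\<close>, with the interval
  condition in betweenness form.\<close>

definition bags :: "('a \<times> 'a) set \<Rightarrow> 'a set \<Rightarrow> 'a set list \<Rightarrow> bool" where
  "bags E X Bs \<longleftrightarrow> (\<forall>B\<in>set Bs. B \<subseteq> X) \<and> (\<forall>v\<in>X. \<exists>B\<in>set Bs. v \<in> B) \<and>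
     (\<forall>x\<in>X. \<forall>y\<in>X. (x, y) \<in> E \<longrightarrow> (\<exists>B\<in>set Bs. x \<in> B \<and> y \<in> B)) \<and>
     (\<forall>i j k. i \<le> j \<longrightarrow> j \<le> k \<longrightarrow> k < length Bs \<longrightarrow> Bs ! i \<inter> Bs ! k \<subseteq> Bs ! j)"

text \<open>Only boundary vertices have neighbours outside \<open>X\<close>, so a decomposition with
  the boundary in its last bag can be prolonged to larger sets. For a vertex set that carries all
  edges the boundary is empty, and only the bound on the bags remains.\<close>

definition good :: "('a \<times> 'a) set \<Rightarrow> nat \<Rightarrow> 'a set \<Rightarrow> bool" where
  "good E n X \<longleftrightarrow> (\<exists>Bs. bags E X Bs \<and> Bs \<noteq> [] \<and> (\<forall>B\<in>set Bs. card B \<le> n) \<and> bdry E X \<subseteq> last Bs)"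

lemma bagsD:
  assumes "bags E X Bs"
  shows "B \<in> set Bs \<Longrightarrow> B \<subseteq> X" "v \<in> X \<Longrightarrow> \<exists>B\<in>set Bs. v \<in> B"
    "x \<in> X \<Longrightarrow> y \<in> X \<Longrightarrow> (x, y) \<in> E \<Longrightarrow> \<exists>B\<in>set Bs. x \<in> B \<and> y \<in> B"
    "i \<le> j \<Longrightarrow> j \<le> k \<Longrightarrow> k < length Bs \<Longrightarrow> Bs ! i \<inter> Bs ! k \<subseteq> Bs ! j"
  using assms unfolding bags_def by simp_all

lemma goodE:
  assumes "good E n X"
  obtains Bs where "bags E X Bs" "Bs \<noteq> []" "\<forall>B\<in>set Bs. card B \<le> n" "bdry E X \<subseteq> last Bs"
  using assms unfolding good_def by (elim exE conjE) (rule that)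

lemma bdry_subset: "bdry E X \<subseteq> X"
  by (auto simp: bdry_def)

lemma good_empty: "good E n {}"
  unfolding good_def bags_def by (intro exI[of _ "[{}]"]) (auto simp: bdry_def)

lemma bdry_insert: "bdry E (insert x X) \<subseteq> insert x (bdry E X)"
  by (auto simp: bdry_def)

text \<open>If bag \<open>j\<close> missed \<open>L\<close>, the vertices of \<open>L\<close> in
  earlier bags would occur in no later bag, so no edge could lead from them to the rest of
  \<open>L\<close>.\<close>

lemma bags_conn:
  assumes b: "bags E X Bs" and L: "conn E L" "L \<subseteq> X" and ijk: "i \<le> j" "j \<le> k" "k < length Bs"
    and "L \<inter> Bs ! i \<noteq> {}" "L \<inter> Bs ! k \<noteq> {}"
  shows "L \<inter> Bs ! j \<noteq> {}"
proof
  assume emp: "L \<inter> Bs ! j = {}"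
  define P where "P = {v \<in> L. \<exists>m<j. v \<in> Bs ! m}"
  obtain u where u: "u \<in> L" "u \<in> Bs ! i" using assms(7) by blast
  obtain w where w: "w \<in> L" "w \<in> Bs ! k" using assms(8) by blast
  have "i < j" using u emp ijk by (metis disjoint_iff le_neq_implies_less)
  then have uP: "u \<in> P" using u by (auto simp: P_def)
  have left: "v \<notin> Bs ! m" if "v \<in> P" "j \<le> m" "m < length Bs" for v m
  proof
    assume v: "v \<in> Bs ! m"
    obtain m' where m': "m' < j" "v \<in> Bs ! m'" "v \<in> L" using \<open>v \<in> P\<close> by (auto simp: P_def)
    then have "v \<in> Bs ! j" using bagsD(4)[OF b, of m' j m] that v by auto
    with m' emp show False by blast
  qed
  have "w \<notin> P" using left[of w k] w ijk by blast
  then have "\<exists>x\<in>P. \<exists>y\<in>L - P. (x, y) \<in> E" using L(1) uP w by (intro conn_edge_out) (auto simp: P_def)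
  then obtain x y where xy: "x \<in> P" "y \<in> L" "y \<notin> P" "(x, y) \<in> E" by blast
  then have "x \<in> X" "y \<in> X" using L(2) by (auto simp: P_def)
  then obtain B where "B \<in> set Bs" "x \<in> B" "y \<in> B" using bagsD(3)[OF b _ _ xy(4)] by blast
  then obtain m where m: "m < length Bs" "x \<in> Bs ! m" "y \<in> Bs ! m" by (auto simp: in_set_conv_nth)
  then have "m < j" using left[OF xy(1), of m] by force
  then have "y \<in> P" using m xy(2) by (auto simp: P_def)
  with xy(3) show False ..
qed

text \<open>
  Contracting the connected sets \<open>L y\<close> onto the boundary vertices \<open>y\<close> of \<open>Y\<close> turns a decomposition
  of \<open>X\<close> into one of \<open>Y\<close> without enlarging the bags.
\<close>

lemma good_restrict:
  assumes g: "good E n X" and fin: "finite X" and Y: "Y \<subseteq> X"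
    and L: "\<And>y. y \<in> bdry E Y \<Longrightarrow> conn E (L y) \<and> L y \<subseteq> X \<and> L y \<inter> Y = {y} \<and> L y \<inter> bdry E X \<noteq> {}"
    and dis: "\<And>y y'. y \<in> bdry E Y \<Longrightarrow> y' \<in> bdry E Y \<Longrightarrow> y \<noteq> y' \<Longrightarrow> L y \<inter> L y' = {}"
  shows "good E n Y"
proof -
  obtain Bs where Bs: "bags E X Bs" "Bs \<noteq> []" "\<forall>B\<in>set Bs. card B \<le> n" "bdry E X \<subseteq> last Bs"
    using g by (rule goodE)
  \<comment> \<open>A boundary vertex \<open>y\<close> inherits all bags met by \<open>L y\<close>.
    They form an interval by \<open>bags_conn\<close>, and the last bag is among them because
    \<open>L y\<close> reaches \<open>bdry E X\<close>.\<close>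
  define f where "f B = (B \<inter> Y) \<union> {y \<in> bdry E Y. L y \<inter> B \<noteq> {}}" for B
  have fY: "f B \<subseteq> Y" for B using bdry_subset by (auto simp: f_def bdry_def)
  have yL: "y \<in> L y" if "y \<in> bdry E Y" for y using L[OF that] by blast
  have "card (f B) \<le> n" if B: "B \<in> set Bs" for B
  proof -
    \<comment> \<open>An injection of the new bag into the old one: each boundary vertex picks a
      vertex of its \<open>L\<close>. Two picks differ as these sets are disjoint, and no pick is
      another vertex of \<open>Y\<close>, as \<open>L y\<close> meets \<open>Y\<close> only in
      \<open>y\<close>.\<close>
    define g where "g v = (if v \<in> bdry E Y then SOME u. u \<in> L v \<inter> B else v)" for v
    have g1: "g v \<in> L v \<inter> B" if "v \<in> f B" "v \<in> bdry E Y" for v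
    proof -
      have "L v \<inter> B \<noteq> {}" using that yL[OF that(2)] by (auto simp: f_def)
      then have "(SOME u. u \<in> L v \<inter> B) \<in> L v \<inter> B" by (rule some_in_eq[THEN iffD2])
      then show ?thesis using that(2) by (simp add: g_def)
    qed
    have g2: "g v = v" "v \<in> B \<inter> Y" if "v \<in> f B" "v \<notin> bdry E Y" for v
      using that by (auto simp: g_def f_def)
    have no: "False" if "v \<in> f B" "v \<in> bdry E Y" "v' \<in> f B" "v' \<notin> bdry E Y" "g v = g v'" for v v'
    proof -
      have "v' \<in> L v \<inter> Y" using g1[OF that(1,2)] g2[OF that(3,4)] that(5) by auto
      then have "v' = v" using L[OF that(2)] by auto
      then show False using that by simp
    qed
    have "inj_on g (f B)"
    proof (rule inj_onI)
      fix v v' assume v: "v \<in> f B" "v' \<in> f B" "g v = g v'"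
      consider "v \<in> bdry E Y" "v' \<in> bdry E Y" | "v \<in> bdry E Y" "v' \<notin> bdry E Y"
        | "v \<notin> bdry E Y" "v' \<in> bdry E Y" | "v \<notin> bdry E Y" "v' \<notin> bdry E Y" by blast
      then show "v = v'"
      proof cases
        case 1
        have "g v \<in> L v" "g v \<in> L v'" using g1[OF v(1) 1(1)] g1[OF v(2) 1(2)] v(3) by auto
        then show ?thesis using dis[OF 1] by blast
      next
        case 2
        then show ?thesis using no[of v v'] v by blast
      next
        case 3
        then show ?thesis using no[of v' v] v by simp
      next
        case 4
        then show ?thesis using g2[OF v(1) 4(1)] g2[OF v(2) 4(2)] v(3) by metis
      qed
    qed
    moreover have "g v \<in> B" if v: "v \<in> f B" for v
    proof (cases "v \<in> bdry E Y")
      case True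
      then show ?thesis using g1[OF v] by blast
    next
      case False
      then show ?thesis using g2[OF v] by (metis IntD1)
    qed
    then have "g ` f B \<subseteq> B" by (rule image_subsetI)
    moreover have "finite B" using bagsD(1)[OF Bs(1) B] fin finite_subset by blast
    ultimately have "card (f B) \<le> card B" by (rule card_inj_on_le)
    then show ?thesis using Bs(3) B by fastforce
  qed
  moreover have "bags E Y (map f Bs)"
    unfolding bags_def
  proof (intro conjI ballI allI impI)
    fix B assume "B \<in> set (map f Bs)"
    then show "B \<subseteq> Y" using fY by auto
  next
    fix v assume "v \<in> Y"
    then show "\<exists>B\<in>set (map f Bs). v \<in> B" using bagsD(2)[OF Bs(1), of v] Y by (auto simp: f_def)
  next
    fix x y assume "x \<in> Y" "y \<in> Y" "(x, y) \<in> E"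
    then show "\<exists>B\<in>set (map f Bs). x \<in> B \<and> y \<in> B" using bagsD(3)[OF Bs(1), of x y] Y by (auto simp: f_def)
  next
    fix i j k assume ijk: "i \<le> j" "j \<le> k" "k < length (map f Bs)"
    then have ijk': "i < length Bs" "j < length Bs" "k < length Bs" by auto
    show "map f Bs ! i \<inter> map f Bs ! k \<subseteq> map f Bs ! j"
    proof
      fix v assume "v \<in> map f Bs ! i \<inter> map f Bs ! k"
      then have v: "v \<in> f (Bs ! i)" "v \<in> f (Bs ! k)" using ijk' by auto
      have "v \<in> f (Bs ! j)"
      proof (cases "v \<in> bdry E Y")
        case True
        have "L v \<inter> Bs ! i \<noteq> {}" "L v \<inter> Bs ! k \<noteq> {}" using v yL[OF True] by (auto simp: f_def)
        then have "L v \<inter> Bs ! j \<noteq> {}"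
          using bags_conn[OF Bs(1), of "L v" i j k] L[OF True] ijk ijk' by blast
        then show ?thesis using True by (simp add: f_def)
      next
        case False
        then have "v \<in> Bs ! i \<inter> Bs ! k" "v \<in> Y" using v by (auto simp: f_def)
        then show ?thesis using bagsD(4)[OF Bs(1) ijk(1,2) ijk'(3)] by (auto simp: f_def)
      qed
      then show "v \<in> map f Bs ! j" using ijk' by simp
    qed
  qed
  moreover have "bdry E Y \<subseteq> last (map f Bs)"
  proof
    fix y assume y: "y \<in> bdry E Y"
    then have "L y \<inter> last Bs \<noteq> {}" using L[OF y] Bs(4) by blast
    then show "y \<in> last (map f Bs)" using y Bs(2) by (simp add: last_map f_def)
  qed
  ultimately show ?thesis unfolding good_def using Bs(2) by (intro exI[of _ "map f Bs"]) auto
qed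

lemma good_maximal:
  assumes "finite V" "X0 \<subseteq> V" "good E n X0" "card (bdry E X0) \<le> m"
  shows "\<exists>X. X0 \<subseteq> X \<and> X \<subseteq> V \<and> good E n X \<and> card (bdry E X) \<le> m \<and>
    (\<forall>Y. X \<subseteq> Y \<longrightarrow> Y \<subseteq> V \<longrightarrow> good E n Y \<longrightarrow> card (bdry E Y) \<le> m \<longrightarrow> Y = X)"
proof -
  define F where "F = {X. X \<subseteq> V \<and> good E n X \<and> card (bdry E X) \<le> m}"
  have "finite F" using assms(1) by (auto simp: F_def)
  moreover have "X0 \<in> F" using assms by (simp add: F_def)
  ultimately obtain X where X: "X \<in> F" "X0 \<subseteq> X" "\<forall>Y\<in>F. X \<subseteq> Y \<longrightarrow> X = Y"
    using finite_has_maximal2 by metis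
  then show ?thesis by (intro exI[of _ X]) (auto simp: F_def)
qed

context ugraph
begin

text \<open>A new last bag \<open>insert x (bdry E X)\<close> takes care of all edges between
  \<open>x\<close> and \<open>X\<close>, and it contains the new boundary.\<close>

lemma good_insert:
  assumes g: "good E n X" and x: "x \<notin> X" and c: "card (bdry E X) + 1 \<le> n" and fin: "finite X"
  shows "good E n (insert x X)"
proof -
  obtain Bs where Bs: "bags E X Bs" "Bs \<noteq> []" "\<forall>B\<in>set Bs. card B \<le> n" "bdry E X \<subseteq> last Bs"
    using g by (rule goodE)
  define N where "N = insert x (bdry E X)"
  have bX: "B \<subseteq> X" if "B \<in> set Bs" for B using bagsD(1)[OF Bs(1) that] .
  have "card N \<le> n"
    using c x bdry_subset[of E X] finite_subset[OF bdry_subset fin] by (auto simp: N_def card_insert_if)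
  moreover have "bags E (insert x X) (Bs @ [N])"
    unfolding bags_def
  proof (intro conjI ballI allI impI)
    fix B assume "B \<in> set (Bs @ [N])"
    then show "B \<subseteq> insert x X" using bX bdry_subset[of E X] by (auto simp: N_def)
  next
    fix v assume "v \<in> insert x X"
    then show "\<exists>B\<in>set (Bs @ [N]). v \<in> B" using bagsD(2)[OF Bs(1), of v] by (auto simp: N_def)
  next
    fix u v assume uv: "u \<in> insert x X" "v \<in> insert x X" "(u, v) \<in> E"
    show "\<exists>B\<in>set (Bs @ [N]). u \<in> B \<and> v \<in> B"
    proof (cases "u \<in> X \<and> v \<in> X")
      case True
      then show ?thesis using bagsD(3)[OF Bs(1) _ _ uv(3)] by auto
    next
      case False
      then have "u \<in> N" "v \<in> N" using uv x sym[OF uv(3)] by (auto simp: N_def bdry_def)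
      then show ?thesis by auto
    qed
  next
    fix i j k assume ijk: "i \<le> j" "j \<le> k" "k < length (Bs @ [N])"
    show "(Bs @ [N]) ! i \<inter> (Bs @ [N]) ! k \<subseteq> (Bs @ [N]) ! j"
    proof (cases "k < length Bs")
      case True
      then show ?thesis using bagsD(4)[OF Bs(1) ijk(1,2)] ijk by (simp add: nth_append)
    next
      case False
      then have k: "k = length Bs" using ijk by simp
      show ?thesis
      proof (cases "j < length Bs")
        case True
        show ?thesis
        proof
          fix v assume "v \<in> (Bs @ [N]) ! i \<inter> (Bs @ [N]) ! k"
          then have v: "v \<in> Bs ! i" "v \<in> N" using k True ijk by (auto simp: nth_append)
          then have "v \<in> X" using bX[of "Bs ! i"] True ijk by auto
          then have "v \<in> last Bs" using v x Bs(4) by (auto simp: N_def)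
          then have "v \<in> Bs ! (length Bs - 1)" using Bs(2) by (simp add: last_conv_nth)
          moreover have "j \<le> length Bs - 1" "length Bs - 1 < length Bs" using True by auto
          ultimately have "v \<in> Bs ! j" using bagsD(4)[OF Bs(1) ijk(1)] v(1) by blast
          then show "v \<in> (Bs @ [N]) ! j" using True by (simp add: nth_append)
        qed
      next
        case False
        then have "j = k" using ijk k by simp
        then show ?thesis by simp
      qed
    qed
  qed
  moreover have "bdry E (insert x X) \<subseteq> last (Bs @ [N])" using bdry_insert[of E x X] by (simp add: N_def)
  ultimately show ?thesis unfolding good_def using Bs(3) by (intro exI[of _ "Bs @ [N]"]) auto
qed

text \<open>Menger in the strip between \<open>Y\<close> and \<open>X\<close>. Given a separator
  \<open>Z\<close>, removing from \<open>X\<close> all that is reachable from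
  \<open>bdry E X\<close> off \<open>Z\<close> leaves a set between \<open>Y\<close> and
  \<open>X\<close> whose boundary lies in \<open>Z\<close>. So \<open>min\<close> bounds the size of
  \<open>Z\<close> from below.\<close>

lemma bdry_linkage:
  assumes fin: "finite X" and Y: "Y \<subseteq> X"
    and min: "\<And>Y'. Y \<subseteq> Y' \<Longrightarrow> Y' \<subseteq> X \<Longrightarrow> card (bdry E Y) \<le> card (bdry E Y')"
  shows "\<exists>L. (\<forall>y\<in>bdry E Y. conn E (L y) \<and> L y \<subseteq> X \<and> L y \<inter> Y = {y} \<and> L y \<inter> bdry E X \<noteq> {}) \<and>
    (\<forall>y\<in>bdry E Y. \<forall>y'\<in>bdry E Y. y \<noteq> y' \<longrightarrow> L y \<inter> L y' = {})"
proof -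
  define S where "S = (X - Y) \<union> bdry E Y"
  define E0 where "E0 = E \<inter> S \<times> S"
  have SX: "S \<subseteq> X" using Y bdry_subset[of E Y] by (auto simp: S_def)
  have SY: "S \<inter> Y = bdry E Y" using bdry_subset[of E Y] by (auto simp: S_def)
  have XS: "bdry E X \<subseteq> S" using Y by (auto simp: S_def bdry_def)
  have finS: "finite S" using SX fin finite_subset by blast
  have fins: "finite E0" "finite (bdry E Y)" "finite (bdry E X)"
    using finS finite_subset[OF XS] finite_subset[of "bdry E Y" S] by (auto simp: E0_def S_def)
  have symE0: "sym E0" using sym_E by (auto simp: E0_def sym_def)
  interpret E0: ugraph E0 using symE0 by unfold_locales
  have sep: "card (bdry E Y) \<le> card Z" if Z: "finite Z" "separates E0 (bdry E Y) (bdry E X) Z" for Z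
  proof -
    define R where "R = E0 \<inter> (- Z) \<times> (- Z)"
    define D where "D = {v. \<exists>w\<in>bdry E X - Z. (w, v) \<in> R\<^sup>*}"
    have DS: "v \<in> S - Z" if v: "v \<in> D" for v
    proof -
      obtain w where w: "w \<in> bdry E X - Z" "(w, v) \<in> R\<^sup>*" using v by (auto simp: D_def)
      from w(2) show ?thesis
        by (induction rule: rtrancl_induct) (use w(1) XS in \<open>auto simp: R_def E0_def\<close>)
    qed
    have Dstep: "v \<in> D" if "u \<in> D" "(u, v) \<in> R" for u v
      using that by (auto simp: D_def intro: rtrancl_into_rtrancl)
    have DY: "D \<inter> Y = {}"
    proof (rule ccontr)
      assume "D \<inter> Y \<noteq> {}"
      then obtain y where y: "y \<in> D" "y \<in> Y" by blast
      then have yb: "y \<in> bdry E Y - Z" using DS[OF y(1)] SY by blast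
      obtain w where w: "w \<in> bdry E X - Z" "(w, y) \<in> R\<^sup>*" using y(1) by (auto simp: D_def)
      have "(y, w) \<in> R\<^sup>*" using E0.reach_sym w(2) unfolding R_def by blast
      then show False using Z(2) yb w(1) unfolding separates_def R_def by blast
    qed
    have "bdry E (X - D) \<subseteq> Z"
    proof
      fix v assume "v \<in> bdry E (X - D)"
      then obtain u where v: "v \<in> X" "v \<notin> D" "u \<notin> X - D" "(v, u) \<in> E" by (auto simp: bdry_def)
      show "v \<in> Z"
      proof (rule ccontr)
        assume vZ: "v \<notin> Z"
        show False
        proof (cases "u \<in> X")
          case False
          then have "v \<in> bdry E X - Z" using v vZ by (auto simp: bdry_def)
          then show False using v(2) by (auto simp: D_def)
        next
          case True
          then have uD: "u \<in> D" using v(3) by blast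
          then have uS: "u \<in> S - Z" "u \<notin> Y" using DS DY by blast+
          have "v \<in> S" using v(1,4) uS(2) by (auto simp: S_def bdry_def)
          then have "(u, v) \<in> R" using sym[OF v(4)] uS vZ by (auto simp: R_def E0_def)
          then show False using Dstep[OF uD] v(2) by blast
        qed
      qed
    qed
    then have "card (bdry E (X - D)) \<le> card Z" using Z(1) card_mono by blast
    moreover have "card (bdry E Y) \<le> card (bdry E (X - D))" using DY Y by (intro min) auto
    ultimately show ?thesis by simp
  qed
  obtain P where P: "linkage E0 (bdry E Y) (bdry E X) P" "card P = card (bdry E Y)"
    using menger[OF fins(1) symE0 fins(2,3) sep] by blast
  have "bij_betw hd P (bdry E Y)" by (rule linkage_hd_bij[OF P(1) fins(2) P(2)])
  then have "\<forall>y\<in>bdry E Y. \<exists>p\<in>P. hd p = y" using bij_betw_imp_surj_on by (metis imageE)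
  then obtain p where p: "\<And>y. y \<in> bdry E Y \<Longrightarrow> p y \<in> P \<and> hd (p y) = y" by metis
  define L where "L y = set (p y)" for y
  have "conn E (L y) \<and> L y \<subseteq> X \<and> L y \<inter> Y = {y} \<and> L y \<inter> bdry E X \<noteq> {}" if y: "y \<in> bdry E Y" for y
  proof -
    have pP: "p y \<in> P" "hd (p y) = y" using p[OF y] by auto
    note lk = linkageD[OF P(1) pP(1)]
    have "hd (p y) \<in> S" using pP(2) y by (simp add: S_def)
    with lk(1) have g: "gpath E S (p y)" unfolding E0_def by (rule gpath_restrict)
    have LS: "L y \<subseteq> S" using gpathD(3)[OF g] by (simp add: L_def)
    have "L y \<inter> Y = L y \<inter> bdry E Y" using LS SY by blast
    then have "L y \<inter> Y = {y}" using lk(2) pP(2) by (simp add: L_def)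
    moreover have "last (p y) \<in> L y \<inter> bdry E X" using lk(5) gpathD(6)[OF g] by (simp add: L_def)
    ultimately show ?thesis using conn_gpath[OF g] LS SX by (auto simp: L_def)
  qed
  moreover have "L y \<inter> L y' = {}" if y: "y \<in> bdry E Y" "y' \<in> bdry E Y" "y \<noteq> y'" for y y'
  proof -
    have "p y \<noteq> p y'" using p[OF y(1)] p[OF y(2)] y(3) by metis
    then show ?thesis using P(1) p[OF y(1)] p[OF y(2)] by (simp add: linkage_def L_def)
  qed
  ultimately show ?thesis by (intro exI[of _ L]) blast
qed

section \<open>Growing a tree model word by word\<close>

definition tl_closed :: "bool list set \<Rightarrow> bool" where
  "tl_closed W \<longleftrightarrow> (\<forall>b w. b # w \<in> W \<longrightarrow> w \<in> W)"

lemma tl_closed_remove: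
  assumes "finite W" "W \<noteq> {}" "tl_closed W"
  obtains w where "w \<in> W" "tl_closed (W - {w})" "\<And>b. b # w \<notin> W"
proof -
  have "Max (length ` W) \<in> length ` W" using assms(1,2) by (intro Max_in) auto
  then obtain w where w0: "w \<in> W" "length w = Max (length ` W)" by auto
  then have w: "w \<in> W" "\<And>u. u \<in> W \<Longrightarrow> length u \<le> length w" using assms(1) by simp_all
  have n: "b # w \<notin> W" for b using w(2)[of "b # w"] by auto
  have "tl_closed (W - {w})" using assms(3) n unfolding tl_closed_def by blast
  with w(1) n that show thesis by blast
qed

text \<open>
  A neighbour outside \<open>X\<close> of a boundary vertex starts the next branch set. Maximality of \<open>X\<close> excludes
  small separators, so the branch sets can be extended to the boundary of a larger maximal set.
\<close>

definition stage :: "'a set \<Rightarrow> nat \<Rightarrow> bool list set \<Rightarrow> 'a set \<Rightarrow> (bool list \<Rightarrow> 'a set) \<Rightarrow> bool" where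
  "stage V n W X \<psi> \<longleftrightarrow> X \<subseteq> V \<and> good E n X \<and> card (bdry E X) = card W \<and>
     (\<forall>Y. X \<subseteq> Y \<longrightarrow> Y \<subseteq> V \<longrightarrow> good E n Y \<longrightarrow> card (bdry E Y) \<le> card W \<longrightarrow> Y = X) \<and>
     tmodel E W \<psi> X \<and> (\<forall>w\<in>W. \<psi> w \<inter> bdry E X \<noteq> {})"

lemma stage_next_vertex:
  assumes st: "stage V n (W - {w0}) X \<psi>" and W: "tl_closed W" "w0 \<in> W"
    and V: "E \<subseteq> V \<times> V" "\<not> good E n V"
  shows "\<exists>x\<in>V - X. \<forall>b w. w0 = b # w \<longrightarrow> touches E (\<psi> w) {x}"
proof (cases w0)
  case Nil
  have "X \<subseteq> V" "good E n X" using st by (auto simp: stage_def)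
  then have "X \<noteq> V" using V(2) by auto
  with \<open>X \<subseteq> V\<close> obtain x where "x \<in> V - X" by blast
  with Nil show ?thesis by auto
next
  case (Cons b w)
  then have "w \<in> W - {w0}" using W by (auto simp: tl_closed_def)
  then have "\<psi> w \<inter> bdry E X \<noteq> {}" using st by (simp add: stage_def)
  then obtain v x where vx: "v \<in> \<psi> w" "x \<notin> X" "(v, x) \<in> E" by (auto simp: bdry_def)
  then have "x \<in> V - X" using V(1) by auto
  moreover have "touches E (\<psi> w) {x}" using vx by (auto simp: touches_def)
  ultimately show ?thesis using Cons by auto
qed

text \<open>Maximality of \<open>X\<close> forces all boundary sizes: a good set properly containing
  \<open>X\<close> has at least \<open>card W\<close> boundary vertices. So \<open>x\<close>
  enlarges the boundary by exactly one, a maximal set \<open>X2\<close> for the new bound has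
  exactly \<open>card W\<close> boundary vertices, and disjoint paths carry the branch sets from one
  boundary to the other.\<close>

lemma stage_step:
  assumes st: "stage V n (W - {w0}) X \<psi>" and W: "finite W" "tl_closed W" "w0 \<in> W" "\<And>b. b # w0 \<notin> W"
    and n: "card W \<le> n" and V: "finite V" "E \<subseteq> V \<times> V" "\<not> good E n V"
  shows "\<exists>X' \<psi>'. stage V n W X' \<psi>'"
proof -
  define W0 where "W0 = W - {w0}"
  have cW: "card W = Suc (card W0)"
    using card_Suc_Diff1[OF W(1,3)] by (simp add: W0_def)
  have X: "X \<subseteq> V" "good E n X" "card (bdry E X) = card W0"
    "\<And>Y. X \<subseteq> Y \<Longrightarrow> Y \<subseteq> V \<Longrightarrow> good E n Y \<Longrightarrow> card (bdry E Y) \<le> card W0 \<Longrightarrow> Y = X"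
    "tmodel E W0 \<psi> X" "\<And>w. w \<in> W0 \<Longrightarrow> \<psi> w \<inter> bdry E X \<noteq> {}"
    using st unfolding stage_def W0_def by simp_all
  obtain x where x: "x \<in> V" "x \<notin> X" "\<And>b w. w0 = b # w \<Longrightarrow> touches E (\<psi> w) {x}"
    using stage_next_vertex[OF st W(2,3) V(2,3)] by blast
  have finX: "finite X" using X(1) V(1) finite_subset by blast
  define X1 where "X1 = insert x X"
  have X1: "X1 \<subseteq> V" "X \<subseteq> X1" "X1 \<noteq> X" using X(1) x by (auto simp: X1_def)
  have g1: "good E n X1" unfolding X1_def
    by (rule good_insert[OF X(2) x(2) _ finX]) (use X(3) n cW in simp)
  have finb: "finite (insert x (bdry E X))" using finite_subset[OF bdry_subset finX] by simp
  have xb: "x \<notin> bdry E X" using x(2) bdry_subset[of E X] by blast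
  have "\<not> card (bdry E X1) \<le> card W0" using X(4)[OF X1(2,1) g1] X1(3) by blast
  then have "card (insert x (bdry E X)) \<le> card (bdry E X1)"
    using xb finb X(3) by simp
  then have b1: "bdry E X1 = insert x (bdry E X)"
    unfolding X1_def by (intro card_seteq[OF finb bdry_insert])
  then have c1: "card (bdry E X1) = card W" using xb finb X(3) cW by simp
  obtain X2 where X2: "X1 \<subseteq> X2" "X2 \<subseteq> V" "good E n X2" "card (bdry E X2) \<le> card W"
    "\<forall>Y. X2 \<subseteq> Y \<longrightarrow> Y \<subseteq> V \<longrightarrow> good E n Y \<longrightarrow> card (bdry E Y) \<le> card W \<longrightarrow> Y = X2"
    using good_maximal[OF V(1) X1(1) g1 eq_imp_le[OF c1]] by (elim exE conjE) (rule that)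
  have finX2: "finite X2" using X2(2) V(1) finite_subset by blast
  have big: "card W \<le> card (bdry E Y)" if Y: "X1 \<subseteq> Y" "Y \<subseteq> V" "good E n Y" for Y
  proof (rule ccontr)
    assume "\<not> card W \<le> card (bdry E Y)"
    then have "card (bdry E Y) \<le> card W0" using cW by simp
    then have "Y = X" using X(4)[of Y] Y X1(2) by blast
    then show False using Y(1) x(2) by (auto simp: X1_def)
  qed
  have c2: "card (bdry E X2) = card W" using big[OF X2(1-3)] X2(4) by simp
  \<comment> \<open>The linkage from \<open>X1\<close> requires that no set between
    \<open>X1\<close> and \<open>X2\<close> has a smaller boundary, but such a set might not be
    good. A minimiser \<open>Y\<close> can itself be linked to \<open>bdry E X2\<close>; by
    \<open>good_restrict\<close> it is good, and so its boundary is not smaller.\<close>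
  have "\<exists>Y. (X1 \<subseteq> Y \<and> Y \<subseteq> X2) \<and>
      (\<forall>Y'. X1 \<subseteq> Y' \<and> Y' \<subseteq> X2 \<longrightarrow> card (bdry E Y) \<le> card (bdry E Y'))"
    by (rule ex_has_least_nat[of _ X1]) (use X2(1) in simp)
  then obtain Y where Y0: "X1 \<subseteq> Y" "Y \<subseteq> X2"
    "\<forall>Y'. X1 \<subseteq> Y' \<and> Y' \<subseteq> X2 \<longrightarrow> card (bdry E Y) \<le> card (bdry E Y')"
    by (elim exE conjE) (rule that)
  have Y: "X1 \<subseteq> Y" "Y \<subseteq> X2"
    "\<And>Y'. X1 \<subseteq> Y' \<Longrightarrow> Y' \<subseteq> X2 \<Longrightarrow> card (bdry E Y) \<le> card (bdry E Y')"
    by (rule Y0(1), rule Y0(2), rule Y0(3)[rule_format], rule conjI)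
  have "\<exists>L. (\<forall>y\<in>bdry E Y. conn E (L y) \<and> L y \<subseteq> X2 \<and> L y \<inter> Y = {y} \<and> L y \<inter> bdry E X2 \<noteq> {}) \<and>
    (\<forall>y\<in>bdry E Y. \<forall>y'\<in>bdry E Y. y \<noteq> y' \<longrightarrow> L y \<inter> L y' = {})"
    by (rule bdry_linkage[OF finX2 Y(2)]) (use Y in auto)
  then obtain L0 where L0: "\<And>y. y \<in> bdry E Y \<Longrightarrow> conn E (L0 y) \<and> L0 y \<subseteq> X2 \<and> L0 y \<inter> Y = {y} \<and> L0 y \<inter> bdry E X2 \<noteq> {}"
    "\<And>y y'. y \<in> bdry E Y \<Longrightarrow> y' \<in> bdry E Y \<Longrightarrow> y \<noteq> y' \<Longrightarrow> L0 y \<inter> L0 y' = {}" by metis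
  have "good E n Y" by (rule good_restrict[OF X2(3) finX2 Y(2) L0])
  then have cY: "card W \<le> card (bdry E Y)" using big Y(1,2) X2(2) by blast
  have "\<exists>L. (\<forall>y\<in>bdry E X1. conn E (L y) \<and> L y \<subseteq> X2 \<and> L y \<inter> X1 = {y} \<and> L y \<inter> bdry E X2 \<noteq> {}) \<and>
    (\<forall>y\<in>bdry E X1. \<forall>y'\<in>bdry E X1. y \<noteq> y' \<longrightarrow> L y \<inter> L y' = {})"
  proof (rule bdry_linkage[OF finX2 X2(1)])
    fix Y' assume "X1 \<subseteq> Y'" "Y' \<subseteq> X2"
    then have "card (bdry E Y) \<le> card (bdry E Y')" by (rule Y(3))
    then show "card (bdry E X1) \<le> card (bdry E Y')" using cY c1 by simp
  qed
  then obtain L where L':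
    "\<forall>y\<in>bdry E X1. conn E (L y) \<and> L y \<subseteq> X2 \<and> L y \<inter> X1 = {y} \<and> L y \<inter> bdry E X2 \<noteq> {}"
    "\<forall>y\<in>bdry E X1. \<forall>y'\<in>bdry E X1. y \<noteq> y' \<longrightarrow> L y \<inter> L y' = {}"
    by (elim exE conjE) (rule that)
  have L: "\<And>y. y \<in> bdry E X1 \<Longrightarrow> conn E (L y)" "\<And>y. y \<in> bdry E X1 \<Longrightarrow> L y \<subseteq> X2"
    "\<And>y. y \<in> bdry E X1 \<Longrightarrow> L y \<inter> X1 = {y}" "\<And>y. y \<in> bdry E X1 \<Longrightarrow> L y \<inter> bdry E X2 \<noteq> {}"
    "\<And>y y'. y \<in> bdry E X1 \<Longrightarrow> y' \<in> bdry E X1 \<Longrightarrow> y \<noteq> y' \<Longrightarrow> L y \<inter> L y' = {}"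
    using L' by simp_all
  have xin: "x \<in> bdry E X1" and bin: "\<And>y. y \<in> bdry E X \<Longrightarrow> y \<in> bdry E X1" using b1 by auto
  have Lself: "y \<in> L y" if "y \<in> bdry E X1" for y using L(3)[OF that] by blast
  have LX: "v = y" if "y \<in> bdry E X1" "v \<in> L y" "v \<in> X1" for v y
    using L(3)[OF that(1)] that by (metis IntI singletonD)
  define B where "B w = (\<Union>y\<in>\<psi> w \<inter> bdry E X. L y)" for w
  \<comment> \<open>\<open>x\<close> is adjacent to the branch set of the parent of
    \<open>w0\<close>, if there is one, so the path starting in \<open>x\<close> can serve as branch
    set of \<open>w0\<close>. The old sets are prolonged along the paths that start in them and thus
    reach the new boundary.\<close>
  define \<chi> where "\<chi> w = (if w = w0 then L x else \<psi> w \<union> B w)" for w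
  note T = tmodelD[OF X(5)]
  have \<psi>X1: "\<psi> w \<subseteq> X1" if "w \<in> W0" for w using T(2)[OF that] X1(2) by blast
  have d1: "L x \<inter> (\<psi> w \<union> B w) = {}" if w: "w \<in> W0" for w
  proof -
    have "v \<noteq> x" if "v \<in> \<psi> w" for v using T(2)[OF w] x(2) that by blast
    then have "L x \<inter> \<psi> w = {}" using LX[OF xin] \<psi>X1[OF w] by blast
    moreover have "L x \<inter> L y = {}" if "y \<in> bdry E X" for y
      using L(5)[OF xin bin[OF that]] xb that by metis
    then have "L x \<inter> B w = {}" unfolding B_def by blast
    ultimately show ?thesis by blast
  qed
  have d2: "(\<psi> w \<union> B w) \<inter> (\<psi> w' \<union> B w') = {}" if w: "w \<in> W0" "w' \<in> W0" "w \<noteq> w'" for w w'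
  proof -
    have d0: "\<psi> u \<inter> \<psi> u' = {}" if "u \<in> W0" "u' \<in> W0" "u \<noteq> u'" for u u' using T(3)[OF that] .
    have mix: "\<psi> u \<inter> B u' = {}" if u: "u \<in> W0" "u' \<in> W0" "u \<noteq> u'" for u u'
    proof (rule ccontr)
      assume "\<psi> u \<inter> B u' \<noteq> {}"
      then obtain v y where vy: "v \<in> \<psi> u" "y \<in> \<psi> u'" "y \<in> bdry E X" "v \<in> L y" by (auto simp: B_def)
      then have "v = y" using LX[OF bin[OF vy(3)] vy(4)] \<psi>X1[OF u(1)] by blast
      then show False using d0[OF u] vy by blast
    qed
    have "B w \<inter> B w' = {}"
    proof (rule ccontr)
      assume "B w \<inter> B w' \<noteq> {}"
      then obtain v y y' where vy: "y \<in> \<psi> w" "y \<in> bdry E X" "v \<in> L y" "y' \<in> \<psi> w'" "y' \<in> bdry E X" "v \<in> L y'"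
        by (auto simp: B_def)
      have "y \<noteq> y'" using d0[OF w] vy by blast
      then show False using L(5)[OF bin[OF vy(2)] bin[OF vy(5)]] vy by blast
    qed
    moreover have "B w \<inter> \<psi> w' = {}" using mix[of w' w] w by blast
    ultimately show ?thesis using d0[OF w] mix[OF w] by (simp add: Int_Un_distrib Int_Un_distrib2)
  qed
  have inW0: "w \<in> W0" if "w \<in> W" "w \<noteq> w0" for w using that by (simp add: W0_def)
  have "tmodel E W \<chi> X2"
    unfolding tmodel_def
  proof (intro conjI ballI allI impI)
    fix w assume w: "w \<in> W"
    show "conn E (\<chi> w)"
    proof (cases "w = w0")
      case True
      then show ?thesis using L(1)[OF xin] by (simp add: \<chi>_def)
    next
      case False
      have "conn E (\<psi> w \<union> (\<Union>y\<in>\<psi> w \<inter> bdry E X. L y))"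
        using T(1)[OF inW0[OF w False]] L(1) Lself bin by (intro conn_UN) blast+
      then show ?thesis using False by (simp add: \<chi>_def B_def)
    qed
    show "\<chi> w \<subseteq> X2"
    proof (cases "w = w0")
      case True
      then show ?thesis using L(2)[OF xin] by (simp add: \<chi>_def)
    next
      case False
      have "B w \<subseteq> X2" unfolding B_def using L(2) bin by blast
      then show ?thesis using False \<psi>X1[OF inW0[OF w False]] X2(1) by (auto simp: \<chi>_def)
    qed
  next
    fix w w' assume w: "w \<in> W" "w' \<in> W" "w \<noteq> w'"
    consider "w = w0" "w' \<in> W0" | "w' = w0" "w \<in> W0" | "w \<in> W0" "w' \<in> W0" "w \<noteq> w0" "w' \<noteq> w0"
      using w inW0 by blast
    then show "\<chi> w \<inter> \<chi> w' = {}"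
    proof cases
      case 1
      then show ?thesis using d1[OF 1(2)] w(3) by (auto simp: \<chi>_def)
    next
      case 2
      then show ?thesis using d1[OF 2(2)] w(3) by (auto simp: \<chi>_def)
    next
      case 3
      then show ?thesis using d2[OF 3(1,2) w(3)] by (simp add: \<chi>_def)
    qed
  next
    fix w b assume w: "w \<in> W" "b # w \<in> W"
    have ww0: "w \<noteq> w0" using W(4) w(2) by blast
    show "touches E (\<chi> w) (\<chi> (b # w))"
    proof (cases "b # w = w0")
      case True
      have "touches E (\<psi> w) {x}" by (rule x(3)[OF True[symmetric]])
      then show ?thesis by (rule touches_mono) (use ww0 True Lself[OF xin] in \<open>auto simp: \<chi>_def\<close>)
    next
      case False
      then have "touches E (\<psi> w) (\<psi> (b # w))" using T(4) inW0 w ww0 by blast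
      then show ?thesis by (rule touches_mono) (use ww0 False in \<open>auto simp: \<chi>_def\<close>)
    qed
  qed
  moreover have "\<chi> w \<inter> bdry E X2 \<noteq> {}" if w: "w \<in> W" for w
  proof (cases "w = w0")
    case True
    then show ?thesis using L(4)[OF xin] by (simp add: \<chi>_def)
  next
    case False
    obtain y where y: "y \<in> \<psi> w \<inter> bdry E X" using X(6)[OF inW0[OF w False]] by blast
    then have "L y \<subseteq> \<chi> w" using False by (auto simp: \<chi>_def B_def)
    then show ?thesis using L(4)[of y] bin y by blast
  qed
  ultimately have "stage V n W X2 \<chi>" unfolding stage_def using X2(2,3,5) c2 by simp
  then show ?thesis by blast
qed

lemma stage_exists:
  assumes "finite W" "tl_closed W" "card W \<le> n" and V: "finite V" "E \<subseteq> V \<times> V" "\<not> good E n V"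
  shows "\<exists>X \<psi>. stage V n W X \<psi>"
  using assms(1-3)
proof (induction "card W" arbitrary: W)
  case 0
  then have W: "W = {}" by simp
  have c0: "card (bdry E {}) \<le> 0" by (simp add: bdry_def)
  obtain X where X: "X \<subseteq> V" "good E n X" "card (bdry E X) \<le> 0"
    "\<forall>Y. X \<subseteq> Y \<longrightarrow> Y \<subseteq> V \<longrightarrow> good E n Y \<longrightarrow> card (bdry E Y) \<le> 0 \<longrightarrow> Y = X"
    using good_maximal[OF V(1) empty_subsetI good_empty[of E n] c0] by (elim exE conjE) (rule that)
  then have "stage V n W X (\<lambda>_. {})" unfolding stage_def W tmodel_def by simp
  then show ?case by blast
next
  case (Suc m)
  then have ne: "W \<noteq> {}" by auto
  obtain w0 where w0: "w0 \<in> W" "tl_closed (W - {w0})" "\<And>b. b # w0 \<notin> W"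
    using tl_closed_remove[OF Suc.prems(1) ne Suc.prems(2)] by blast
  have "card (W - {w0}) = m" using Suc.hyps(2) w0(1) Suc.prems(1) by simp
  then obtain X \<psi> where "stage V n (W - {w0}) X \<psi>"
    using Suc.hyps(1)[of "W - {w0}"] w0(2) Suc.prems(1,3) Suc.hyps(2) by auto
  then show ?case using stage_step[OF _ Suc.prems(1,2) w0(1,3) Suc.prems(3) V] by blast
qed

text \<open>Stages place \<open>n\<close> of the \<open>n + 1\<close> words. The last word gets a
  single vertex outside \<open>X\<close> and need not be carried on to a boundary, so bags of size
  \<open>n\<close> suffice for \<open>n + 1\<close> words.\<close>

theorem tree_model_exists:
  assumes W: "finite W" "tl_closed W" "card W = Suc n" and V: "finite V" "E \<subseteq> V \<times> V" "\<not> good E n V"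
  shows "\<exists>\<psi>. tmodel E W \<psi> V"
proof -
  have ne: "W \<noteq> {}" using W(3) by auto
  obtain w0 where w0: "w0 \<in> W" "tl_closed (W - {w0})" "\<And>b. b # w0 \<notin> W"
    using tl_closed_remove[OF W(1) ne W(2)] by blast
  have "card (W - {w0}) \<le> n" using W(3) w0(1) W(1) by simp
  then obtain X \<psi> where st: "stage V n (W - {w0}) X \<psi>"
    using stage_exists[of "W - {w0}"] W(1) w0(2) V by blast
  obtain x where x: "x \<in> V" "x \<notin> X" "\<And>b w. w0 = b # w \<Longrightarrow> touches E (\<psi> w) {x}"
    using stage_next_vertex[OF st W(2) w0(1) V(2,3)] by blast
  have X: "X \<subseteq> V" "tmodel E (W - {w0}) \<psi> X" using st by (auto simp: stage_def)
  note T = tmodelD[OF X(2)]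
  have in0: "w \<in> W - {w0}" if "w \<in> W" "w \<noteq> w0" for w using that by simp
  have "tmodel E W (\<psi>(w0 := {x})) V"
    unfolding tmodel_def
  proof (intro conjI ballI allI impI)
    fix w assume w: "w \<in> W"
    show "conn E ((\<psi>(w0 := {x})) w)" using T(1)[OF in0[OF w]] by simp
    show "(\<psi>(w0 := {x})) w \<subseteq> V" using T(2)[OF in0[OF w]] x X(1) by auto
  next
    fix w w' assume w: "w \<in> W" "w' \<in> W" "w \<noteq> w'"
    show "(\<psi>(w0 := {x})) w \<inter> (\<psi>(w0 := {x})) w' = {}"
      using T(2)[OF in0[OF w(1)]] T(2)[OF in0[OF w(2)]] T(3)[OF in0[OF w(1)] in0[OF w(2)] w(3)] x(2) w(3) by auto
  next
    fix w b assume w: "w \<in> W" "b # w \<in> W"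
    have ww0: "w \<noteq> w0" using w0(3) w(2) by blast
    show "touches E ((\<psi>(w0 := {x})) w) ((\<psi>(w0 := {x})) (b # w))"
      using T(4)[of w b] in0 w ww0 x(3)[of b w] by (cases "b # w = w0") auto
  qed
  then show ?thesis by blast
qed

end

section \<open>Models and minors\<close>

lemma contracts_to_trans: "contracts_to H K \<Longrightarrow> contracts_to G H \<Longrightarrow> contracts_to G K"
  by (induction rule: contracts_to.induct) (auto intro: contracts_to.step)

text \<open>While \<open>f\<close> is not injective, some connected fibre has two vertices and hence
  an edge. Contracting it keeps the fibres connected and the image under \<open>f\<close> unchanged
  except for loops. The merged vertex keeps a name from its fibre, so the same \<open>f\<close>
  labels all intermediate graphs.\<close>

lemma contract_fibres:
  fixes f :: "'a \<Rightarrow> 'b"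
  assumes "pair_graph S" and "\<And>c. c \<in> f ` pverts S \<Longrightarrow> conn (parcs S) {v \<in> pverts S. f v = c}"
  shows "\<exists>K. contracts_to S K \<and> pair_graph K \<and> inj_on f (pverts K) \<and> f ` pverts K = f ` pverts S \<and>
    map_prod f f ` parcs K = {e \<in> map_prod f f ` parcs S. fst e \<noteq> snd e}"
  using assms
proof (induction "card (pverts S)" arbitrary: S rule: less_induct)
  case less
  interpret S: pair_graph S by (rule less.prems(1))
  show ?case
  proof (cases "inj_on f (pverts S)")
    case True
    have "f x \<noteq> f y" if "(x, y) \<in> parcs S" for x y
      using that True S.in_arcsD1[OF that] S.in_arcsD2[OF that] S.no_loops'[OF that] by (auto dest: inj_onD)
    then have "map_prod f f ` parcs S = {e \<in> map_prod f f ` parcs S. fst e \<noteq> snd e}" by auto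
    then show ?thesis using True less.prems(1) contracts_to.refl by blast
  next
    case False
    then obtain x y where xy: "x \<in> pverts S" "y \<in> pverts S" "x \<noteq> y" "f x = f y" by (auto simp: inj_on_def)
    have "\<exists>u\<in>{x}. \<exists>v\<in>{v \<in> pverts S. f v = f x} - {x}. (u, v) \<in> parcs S"
      using less.prems(2)[of "f x"] xy by (intro conn_edge_out) auto
    then obtain u v where "u \<in> {x}" "v \<in> {v \<in> pverts S. f v = f x} - {x}" "(u, v) \<in> parcs S" by blast
    then have uv: "(u, v) \<in> parcs S" "f u = f v" by auto
    have uv': "u \<in> pverts S" "v \<in> pverts S" "u \<noteq> v"
      using S.in_arcsD1[OF uv(1)] S.in_arcsD2[OF uv(1)] S.no_loops'[OF uv(1)] by auto
    define g where "g = id(v := u)"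
    define S' where "S' = contract_edge u v S"
    have pS': "pverts S' = pverts S - {v}"
      "parcs S' = {(g x, g y) | x y. (x, y) \<in> parcs S \<and> g x \<noteq> g y}"
      by (simp_all add: S'_def contract_edge_def g_def Let_def)
    have fg: "f (g z) = f z" for z using uv(2) by (simp add: g_def)
    have gV: "g z \<in> pverts S'" if "z \<in> pverts S" for z using that uv' by (auto simp: g_def pS')
    have gid: "g z = z" if "z \<in> pverts S'" for z using that by (auto simp: g_def pS')
    have fib: "{z \<in> pverts S'. f z = c} = g ` {z \<in> pverts S. f z = c}" for c
    proof
      show "g ` {z \<in> pverts S. f z = c} \<subseteq> {z \<in> pverts S'. f z = c}" using gV fg by auto
      show "{z \<in> pverts S'. f z = c} \<subseteq> g ` {z \<in> pverts S. f z = c}"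
      proof
        fix z assume z: "z \<in> {z \<in> pverts S'. f z = c}"
        then have "z = g z" "z \<in> {z \<in> pverts S. f z = c}" using gid[of z] by (auto simp: pS')
        then show "z \<in> g ` {z \<in> pverts S. f z = c}" by (rule image_eqI)
      qed
    qed
    have img: "f ` pverts S' = f ` pverts S"
    proof
      show "f ` pverts S' \<subseteq> f ` pverts S" by (auto simp: pS')
      show "f ` pverts S \<subseteq> f ` pverts S'" using gV fg by (metis image_subsetI imageI)
    qed
    have conn': "conn (parcs S') {z \<in> pverts S'. f z = c}" if c: "c \<in> f ` pverts S'" for c
    proof -
      define F where "F = {z \<in> pverts S. f z = c}"
      have F: "conn (parcs S) F" using less.prems(2) c img by (simp add: F_def)
      have "(g z, g w) \<in> (parcs S' \<inter> g ` F \<times> g ` F)\<^sup>*" if "z \<in> F" "w \<in> F" for z w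
      proof -
        have "(z, w) \<in> (parcs S \<inter> F \<times> F)\<^sup>*" using F that by (simp add: conn_def)
        then show ?thesis
        proof (induction rule: rtrancl_induct)
          case (step s t)
          show ?case
          proof (cases "g s = g t")
            case True
            then show ?thesis using step.IH by simp
          next
            case False
            then have "(g s, g t) \<in> parcs S' \<inter> g ` F \<times> g ` F" using step.hyps(2) by (auto simp: pS')
            with step.IH show ?thesis by (rule rtrancl_into_rtrancl)
          qed
        qed simp
      qed
      then have "conn (parcs S') (g ` F)" using conn_nonempty[OF F] by (auto simp: conn_def)
      then show ?thesis unfolding fib F_def .
    qed
    have arcs: "{e \<in> map_prod f f ` parcs S'. fst e \<noteq> snd e} = {e \<in> map_prod f f ` parcs S. fst e \<noteq> snd e}"
    proof
      show "{e \<in> map_prod f f ` parcs S'. fst e \<noteq> snd e} \<subseteq> {e \<in> map_prod f f ` parcs S. fst e \<noteq> snd e}"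
        using fg by (force simp: pS')
      show "{e \<in> map_prod f f ` parcs S. fst e \<noteq> snd e} \<subseteq> {e \<in> map_prod f f ` parcs S'. fst e \<noteq> snd e}"
      proof
        fix e assume "e \<in> {e \<in> map_prod f f ` parcs S. fst e \<noteq> snd e}"
        then obtain s t where st: "(s, t) \<in> parcs S" "e = (f s, f t)" "f s \<noteq> f t" by auto
        then have "g s \<noteq> g t" using fg by metis
        then have "(g s, g t) \<in> parcs S'" using st(1) by (auto simp: pS')
        moreover have "e = map_prod f f (g s, g t)" using st(2) fg by simp
        ultimately show "e \<in> {e \<in> map_prod f f ` parcs S'. fst e \<noteq> snd e}" using st by auto
      qed
    qed
    have "card (pverts S') < card (pverts S)"
      unfolding pS' using uv'(2) S.pair_finite_verts by (intro card_Diff1_less)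
    moreover have "pair_graph S'" unfolding S'_def by (rule pair_graph_contract_edge[OF less.prems(1) uv(1)])
    ultimately obtain K where K: "contracts_to S' K" "pair_graph K" "inj_on f (pverts K)"
      "f ` pverts K = f ` pverts S'" "map_prod f f ` parcs K = {e \<in> map_prod f f ` parcs S'. fst e \<noteq> snd e}"
      using less.hyps[of S'] conn' by blast
    have "contracts_to S S'" unfolding S'_def using contracts_to.step[OF contracts_to.refl uv(1)] .
    then have "contracts_to S K" using K(1) contracts_to_trans by blast
    then show ?thesis using K arcs img by (intro exI[of _ K]) simp
  qed
qed

lemma digraph_iso_with_proj:
  assumes K: "pair_graph K" and f: "inj_on f (pverts K)" "f ` pverts K = pverts H" "map_prod f f ` parcs K = parcs H"
  shows "digraph_iso (with_proj H) (with_proj K)"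
proof -
  interpret K: pair_graph K by (rule K)
  define h where "h = \<lparr> iso_verts = f, iso_arcs = map_prod f f, iso_head = snd, iso_tail = fst \<rparr>"
  have "inj_on (map_prod f f) (parcs K)"
  proof (rule inj_onI)
    fix e e' assume e: "e \<in> parcs K" "e' \<in> parcs K" "map_prod f f e = map_prod f f e'"
    then show "e = e'"
      using inj_onD[OF f(1)] K.in_arcsD1 K.in_arcsD2 by (cases e, cases e') auto
  qed
  then have "pre_digraph.digraph_isomorphism (with_proj K) h"
    unfolding pre_digraph.digraph_isomorphism_def using f(1) K.wf_digraph_axioms by (auto simp: h_def)
  moreover have "with_proj H = app_iso h (with_proj K)"
    using f(2,3) by (simp add: app_iso_def h_def with_proj_def)
  ultimately have "digraph_iso (with_proj K) (with_proj H)" unfolding digraph_iso_def by blast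
  then show ?thesis by (rule digraph_iso_swap[OF K.wf_digraph_axioms])
qed

lemma model_is_minor:
  assumes H: "pair_graph H" and G: "pair_graph G"
    and \<phi>: "\<And>x. x \<in> pverts H \<Longrightarrow> conn (parcs G) (\<phi> x)" "\<And>x. x \<in> pverts H \<Longrightarrow> \<phi> x \<subseteq> pverts G"
      "\<And>x y. x \<in> pverts H \<Longrightarrow> y \<in> pverts H \<Longrightarrow> x \<noteq> y \<Longrightarrow> \<phi> x \<inter> \<phi> y = {}"
      "\<And>x y. (x, y) \<in> parcs H \<Longrightarrow> touches (parcs G) (\<phi> x) (\<phi> y)"
  shows "is_minor H G"
proof -
  interpret H: pair_graph H by (rule H)
  interpret G: pair_graph G by (rule G)
  define f where "f v = (SOME x. x \<in> pverts H \<and> v \<in> \<phi> x)" for v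
  have f: "f v = x" if "x \<in> pverts H" "v \<in> \<phi> x" for x v
  proof -
    have "f v \<in> pverts H \<and> v \<in> \<phi> (f v)" unfolding f_def by (rule someI[of _ x]) (use that in simp)
    then show ?thesis using \<phi>(3)[of "f v" x] that by blast
  qed
  define V where "V = (\<Union>x\<in>pverts H. \<phi> x)"
  \<comment> \<open>Edges between branch sets of nonadjacent vertices of \<open>H\<close> are left
    out, because the contraction has to yield exactly \<open>H\<close>.\<close>
  define S where "S = \<lparr> pverts = V, parcs = {(u, v) \<in> parcs G. u \<in> V \<and> v \<in> V \<and> (f u = f v \<or> (f u, f v) \<in> parcs H)} \<rparr>"
  have VG: "V \<subseteq> pverts G" using \<phi>(2) by (auto simp: V_def)
  have Hsym: "(y, x) \<in> parcs H" if "(x, y) \<in> parcs H" for x y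
    using that H.pair_sym_arcs by (auto simp: symmetric_def dest: symD)
  have Gsym: "(y, x) \<in> parcs G" if "(x, y) \<in> parcs G" for x y
    using that G.pair_sym_arcs by (auto simp: symmetric_def dest: symD)
  have pS: "pair_graph S"
  proof (rule pair_graphI)
    show "finite (pverts S)" using finite_subset[OF VG G.pair_finite_verts] by (simp add: S_def)
    fix u v assume "(u, v) \<in> parcs S"
    then have uv: "(u, v) \<in> parcs G" "u \<in> V" "v \<in> V" "f u = f v \<or> (f u, f v) \<in> parcs H" by (auto simp: S_def)
    have "u \<noteq> v" using G.no_loops'[OF uv(1)] .
    moreover have "f v = f u \<or> (f v, f u) \<in> parcs H" using uv(4) Hsym by auto
    ultimately show "u \<in> pverts S \<and> u \<noteq> v \<and> (v, u) \<in> parcs S" using uv Gsym[OF uv(1)] by (simp add: S_def)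
  qed
  interpret S: pair_graph S by (rule pS)
  have sub: "subgraph (with_proj S) (with_proj G)"
    unfolding subgraph_def compatible_def
    using VG S.wf_digraph_axioms G.wf_digraph_axioms by (auto simp: S_def)
  have img: "f ` pverts S = pverts H"
  proof
    show "f ` pverts S \<subseteq> pverts H" using f by (auto simp: S_def V_def)
    show "pverts H \<subseteq> f ` pverts S"
    proof
      fix x assume x: "x \<in> pverts H"
      obtain v where v: "v \<in> \<phi> x" using conn_nonempty[OF \<phi>(1)[OF x]] by blast
      then have "v \<in> pverts S" "x = f v" using x f[OF x] by (auto simp: S_def V_def)
      then show "x \<in> f ` pverts S" by blast
    qed
  qed
  have fib: "{v \<in> pverts S. f v = x} = \<phi> x" if x: "x \<in> pverts H" for x
    using f[OF x] f x by (auto simp: S_def V_def)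
  have "conn (parcs S) {v \<in> pverts S. f v = x}" if x: "x \<in> f ` pverts S" for x
  proof -
    have xH: "x \<in> pverts H" using x img by simp
    have "parcs S \<inter> \<phi> x \<times> \<phi> x = parcs G \<inter> \<phi> x \<times> \<phi> x" using f[OF xH] xH by (auto simp: S_def V_def)
    then have "conn (parcs S) (\<phi> x)" using \<phi>(1)[OF xH] by (simp add: conn_def)
    then show ?thesis by (simp only: fib[OF xH])
  qed
  from contract_fibres[OF pS this] obtain K where K: "contracts_to S K" "pair_graph K" "inj_on f (pverts K)"
    "f ` pverts K = f ` pverts S" "map_prod f f ` parcs K = {e \<in> map_prod f f ` parcs S. fst e \<noteq> snd e}"
    by blast
  have "{e \<in> map_prod f f ` parcs S. fst e \<noteq> snd e} = parcs H"
  proof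
    show "{e \<in> map_prod f f ` parcs S. fst e \<noteq> snd e} \<subseteq> parcs H" by (auto simp: S_def)
    show "parcs H \<subseteq> {e \<in> map_prod f f ` parcs S. fst e \<noteq> snd e}"
    proof
      fix e assume e: "e \<in> parcs H"
      obtain x y where xy: "e = (x, y)" by (cases e)
      then have xyH: "(x, y) \<in> parcs H" using e by simp
      have xH: "x \<in> pverts H" "y \<in> pverts H" using H.in_arcsD1[OF xyH] H.in_arcsD2[OF xyH] by auto
      obtain u v where uv: "u \<in> \<phi> x" "v \<in> \<phi> y" "(u, v) \<in> parcs G" using \<phi>(4)[OF xyH] by (auto simp: touches_def)
      have fuv: "f u = x" "f v = y" using f xH uv by auto
      have "(u, v) \<in> parcs S" using uv xH fuv xyH by (auto simp: S_def V_def)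
      moreover have "e = map_prod f f (u, v)" using fuv xy by simp
      ultimately have "e \<in> map_prod f f ` parcs S" by (rule image_eqI[rotated])
      then show "e \<in> {e \<in> map_prod f f ` parcs S. fst e \<noteq> snd e}"
        using xy H.no_loops'[OF xyH] by simp
    qed
  qed
  then have "digraph_iso (with_proj H) (with_proj K)"
    using digraph_iso_with_proj[OF K(2,3)] K(4,5) img by simp
  then show ?thesis unfolding is_minor_def using pS sub K(1) by blast
qed

lemma gplus_is_minor:
  assumes G: "pair_graph G" and g: "gplus (parcs G) l (pverts G)"
  shows "is_minor (Gamma_plus l) G"
proof -
  interpret G: pair_graph G by (rule G)
  interpret ugraph "parcs G" using G.pair_sym_arcs by unfold_locales (simp add: symmetric_def)
  obtain a b where "rgplus (parcs G) l a b (pverts G)" using g by (auto simp: gplus_def)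
  then obtain \<psi> Q where \<psi>: "tmodel (parcs G) (words l) \<psi> (pverts G)" "conn (parcs G) Q" "Q \<subseteq> pverts G"
     "\<forall>w\<in>words l. \<psi> w \<inter> Q = {}" "\<forall>w. length w = l \<longrightarrow> touches (parcs G) (\<psi> w) Q"
    unfolding rgplus_def by (elim exE conjE) (rule that)
  note T = tmodelD[OF \<psi>(1)]
  define \<phi> where "\<phi> x = (case x of None \<Rightarrow> Q | Some w \<Rightarrow> \<psi> w)" for x
  have \<phi>_simps: "\<phi> None = Q" "\<phi> (Some w) = \<psi> w" for w by (simp_all add: \<phi>_def)
  have ver: "x = None \<or> (\<exists>w. x = Some w \<and> w \<in> words l)" if "x \<in> pverts (Gamma_plus l)" for x
    using that by (auto simp: Gamma_plus_def Gamma_def)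
  show ?thesis
  proof (rule model_is_minor[OF pair_graph_Gamma_plus G, of l \<phi>])
    fix x assume x: "x \<in> pverts (Gamma_plus l)"
    show "conn (parcs G) (\<phi> x)"
      using ver[OF x] \<psi>(2) T(1) by (elim disjE exE conjE) (simp_all add: \<phi>_simps)
    show "\<phi> x \<subseteq> pverts G"
      using ver[OF x] \<psi>(3) T(2) by (elim disjE exE conjE) (simp_all add: \<phi>_simps)
  next
    fix x y assume x: "x \<in> pverts (Gamma_plus l)" and y: "y \<in> pverts (Gamma_plus l)" and "x \<noteq> y"
    then show "\<phi> x \<inter> \<phi> y = {}"
      using ver[OF x] ver[OF y] \<psi>(4) T(3) by (elim disjE exE conjE) (simp_all add: \<phi>_simps Int_commute)
  next
    fix x y assume "(x, y) \<in> parcs (Gamma_plus l)"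
    then consider w b where "length w < l" "x = Some w" "y = Some (b # w)"
      | w b where "length w < l" "y = Some w" "x = Some (b # w)"
      | w where "length w = l" "x = None" "y = Some w" | w where "length w = l" "y = None" "x = Some w"
      by (auto simp: Gamma_plus_def Gamma_def symcl_iff)
    then show "touches (parcs G) (\<phi> x) (\<phi> y)"
    proof cases
      case 1
      then show ?thesis using T(4)[of w b] by (simp add: \<phi>_simps)
    next
      case 2
      then show ?thesis using touches_sym[OF T(4)[of w b]] by (simp add: \<phi>_simps)
    next
      case 3
      then show ?thesis using touches_sym \<psi>(5) by (simp add: \<phi>_simps)
    next
      case 4
      then show ?thesis using \<psi>(5) by (simp add: \<phi>_simps)
    qed
  qed
qed

lemma parcs_nabla: "parcs (nabla (Suc k)) \<subseteq> symcl (nab_arcs (Suc k))"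
proof (induction k)
  case 0
  show ?case by (auto simp: triangle_def symcl_iff)
next
  case (Suc k)
  define n :: nat where "n = 2 ^ Suc k"
  have N: "parcs (nabla (Suc (Suc k))) = parcs (nabla (Suc k)) \<union>
      map_prod ((+) n) ((+) n) ` parcs (nabla (Suc k)) \<union> symcl {(0, n), (n, 2 * n), (0, 2 * n)}"
    by (simp only: nabla.simps Let_def n_def triangle_def pair_pre_digraph.simps)
  have A: "nab_arcs (Suc (Suc k)) = nab_arcs (Suc k) \<union> map_prod ((+) n) ((+) n) ` nab_arcs (Suc k) \<union> {(0, 2 * n)}"
    by (simp only: nab_arcs.simps n_def power_Suc)
  have root: "(0, n) \<in> nab_arcs (Suc k)" unfolding n_def by simp
  show ?case
  proof (rule subrelI)
    fix x y assume "(x, y) \<in> parcs (nabla (Suc (Suc k)))"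
    then consider "(x, y) \<in> parcs (nabla (Suc k))"
      | u v where "(u, v) \<in> parcs (nabla (Suc k))" "x = n + u" "y = n + v"
      | "(x, y) \<in> symcl {(0, n), (n, 2 * n), (0, 2 * n)}" unfolding N by auto
    then show "(x, y) \<in> symcl (nab_arcs (Suc (Suc k)))"
    proof cases
      case 1
      then have "(x, y) \<in> symcl (nab_arcs (Suc k))" using Suc.IH by blast
      then show ?thesis unfolding A symcl_iff by blast
    next
      case 2
      then have "(u, v) \<in> symcl (nab_arcs (Suc k))" using Suc.IH by blast
      then have "(x, y) \<in> map_prod ((+) n) ((+) n) ` nab_arcs (Suc k) \<or>
          (y, x) \<in> map_prod ((+) n) ((+) n) ` nab_arcs (Suc k)"
        unfolding symcl_iff 2(2,3) by (force simp del: nab_arcs.simps)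
      then show ?thesis unfolding A symcl_iff by blast
    next
      case 3
      \<comment> \<open>The two triangle edges at \<open>n\<close> are already present as root edges
        of the copies.\<close>
      have m: "(n, 2 * n) \<in> map_prod ((+) n) ((+) n) ` nab_arcs (Suc k)"
        using root by (intro image_eqI[of _ _ "(0, n)"]) auto
      have "{(0, n), (n, 2 * n), (0, 2 * n)} \<subseteq> nab_arcs (Suc (Suc k))"
        unfolding A using root m by (intro insert_subsetI) blast+
      then show ?thesis using 3 unfolding symcl_iff by blast
    qed
  qed
qed

lemma rnabla_is_minor:
  assumes G: "pair_graph G" and l: "1 \<le> l" and r: "rnabla (parcs G) l a b (pverts G)"
  shows "is_minor (nabla l) G"
proof -
  interpret G: pair_graph G by (rule G)
  interpret ugraph "parcs G" using G.pair_sym_arcs by unfold_locales (simp add: symmetric_def)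
  obtain k where k: "l = Suc k" using l by (cases l) auto
  obtain \<phi> where \<phi>: "\<And>m. m \<le> 2 ^ l \<Longrightarrow> conn (parcs G) (\<phi> m)" "\<And>m. m \<le> 2 ^ l \<Longrightarrow> \<phi> m \<subseteq> pverts G"
    "\<And>m m'. m \<le> 2 ^ l \<Longrightarrow> m' \<le> 2 ^ l \<Longrightarrow> m \<noteq> m' \<Longrightarrow> \<phi> m \<inter> \<phi> m' = {}"
    "\<And>m m'. (m, m') \<in> nab_arcs l \<Longrightarrow> touches (parcs G) (\<phi> m) (\<phi> m')"
    "a \<in> \<phi> 0" "b \<in> \<phi> (2 ^ l)"
    by (rule rnablaE[OF r]) (rule that, simp_all)
  have ver: "x \<le> 2 ^ l" if "x \<in> pverts (nabla l)" for x using that unfolding k verts_nabla by simp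
  have "pair_graph (nabla l)" unfolding k by (rule pair_graph_nabla)
  then show ?thesis
  proof (rule model_is_minor[OF _ G, of _ \<phi>])
    fix x y assume "(x, y) \<in> parcs (nabla l)"
    then have "(x, y) \<in> symcl (nab_arcs l)" using parcs_nabla[of k] k by blast
    then show "touches (parcs G) (\<phi> x) (\<phi> y)" using \<phi>(4) touches_sym by (auto simp: symcl_iff)
  qed (use \<phi>(1-3) ver in auto)
qed

section \<open>Path-width, 2-connectedness and the final count\<close>

lemma card_words: "card (words k) = 2 ^ Suc k - 1"
proof -
  have "words k = {xs. set xs \<subseteq> (UNIV :: bool set) \<and> length xs \<le> k}" by simp
  then have "card (words k) = (\<Sum>i\<le>k. 2 ^ i)" using card_lists_length_le[of "UNIV :: bool set" k] by simp
  also have "\<dots> = 2 ^ Suc k - 1" by (induction k) auto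
  finally show ?thesis .
qed

text \<open>Bags of size \<open>Suc n\<close> mean width \<open>n\<close>. By betweenness, the
  indices of the bags containing a vertex fill the interval from the least to the greatest of
  them.\<close>

lemma good_pathwidth:
  assumes G: "pair_graph G" and g: "good (parcs G) (Suc n) (pverts G)"
  shows "pathwidth G \<le> n"
proof -
  interpret G: pair_graph G by (rule G)
  obtain Bs where Bs: "bags (parcs G) (pverts G) Bs" "\<forall>B\<in>set Bs. card B \<le> Suc n"
    using g by (rule goodE)
  have "path_decomposition G Bs"
    unfolding path_decomposition_def
  proof (intro conjI ballI)
    fix B assume "B \<in> set Bs"
    then show "B \<subseteq> pverts G" by (rule bagsD(1)[OF Bs(1)])
  next
    fix v assume v: "v \<in> pverts G"
    define I where "I = {i. i < length Bs \<and> v \<in> Bs ! i}"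
    have fin: "finite I" by (simp add: I_def)
    obtain B where "B \<in> set Bs" "v \<in> B" using bagsD(2)[OF Bs(1) v] by blast
    then have ne: "I \<noteq> {}" by (auto simp: I_def in_set_conv_nth)
    have mm: "Min I \<in> I" "Max I \<in> I" using fin ne by auto
    have "I = {Min I..Max I}"
    proof
      show "I \<subseteq> {Min I..Max I}" using fin by auto
      show "{Min I..Max I} \<subseteq> I"
      proof
        fix j assume j: "j \<in> {Min I..Max I}"
        have "v \<in> Bs ! Min I" "v \<in> Bs ! Max I" "Max I < length Bs" using mm by (auto simp: I_def)
        moreover have "Min I \<le> j" "j \<le> Max I" using j by auto
        ultimately have "v \<in> Bs ! j" "j < length Bs" using bagsD(4)[OF Bs(1)] by (blast, linarith)
        then show "j \<in> I" by (simp add: I_def)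
      qed
    qed
    moreover have "Min I \<le> Max I" using fin mm by simp
    ultimately show "\<exists>a b. a \<le> b \<and> {i. i < length Bs \<and> v \<in> Bs ! i} = {a..b}" unfolding I_def by blast
  next
    fix e assume e: "e \<in> parcs G"
    obtain u v where uv: "e = (u, v)" by (cases e)
    then have "u \<in> pverts G" "v \<in> pverts G" using e G.in_arcsD1 G.in_arcsD2 by auto
    then show "case e of (u, v) \<Rightarrow> \<exists>B\<in>set Bs. u \<in> B \<and> v \<in> B"
      using bagsD(3)[OF Bs(1)] e uv by simp
  qed
  then show ?thesis unfolding pathwidth_def using Bs(2) by (intro Least_le exI[of _ Bs]) simp
qed

text \<open>\<open>connected\<close> refers to the symmetrised digraph, which has no additional arcs
  here. The sets with fewer than two elements are the empty set and the singletons, matching the two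
  clauses of \<open>biconn\<close>.\<close>

lemma k_connected_biconn:
  assumes G: "pair_graph G" and c: "k_connected 2 G"
  shows "biconn (parcs G) (pverts G)"
proof -
  interpret G: pair_graph G by (rule G)
  have conn: "conn (parcs G) (pverts G - X)" if X: "X \<subseteq> pverts G" "card X < 2" for X
  proof -
    define R where "R = parcs (mk_symmetric (with_proj G \<restriction> (pverts G - X)))"
    have RG: "R \<subseteq> parcs G"
      using G.pair_sym_arcs
      by (auto simp: R_def parcs_mk_symmetric symmetric_def dest: symD)
    have "connected (with_proj G \<restriction> (pverts G - X))" using c X by (simp add: k_connected_def)
    then have s: "pverts G - X \<noteq> {}" "\<And>u v. u \<in> pverts G - X \<Longrightarrow> v \<in> pverts G - X \<Longrightarrow>
        (u, v) \<in> rtrancl_on (pverts G - X) R"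
      unfolding connected_def strongly_connected_def reachable_def R_def by auto
    have "(u, v) \<in> (parcs G \<inter> (pverts G - X) \<times> (pverts G - X))\<^sup>*"
      if "(u, v) \<in> rtrancl_on (pverts G - X) R" for u v
      using that
    proof (induction rule: rtrancl_on_induct)
      case (step y z)
      then have "(y, z) \<in> parcs G \<inter> (pverts G - X) \<times> (pverts G - X)" using RG by blast
      with step.IH show ?case by (rule rtrancl_into_rtrancl)
    qed simp
    then show ?thesis using s by (simp add: conn_def)
  qed
  have V: "conn (parcs G) (pverts G)" using conn[of "{}"] by simp
  moreover have "conn (parcs G) (pverts G - {v})" for v
    using conn[of "{v}"] V by (cases "v \<in> pverts G") auto
  ultimately show ?thesis by (simp add: biconn_def)
qed

theorem theorem6p2:
  fixes l :: nat and G :: "'a pair_pre_digraph"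
  assumes "l \<ge> 1"
    and "pair_graph G"
    and "k_connected 2 G"
    and "pathwidth G \<ge> 2 ^ (9 * l\<^sup>2 - 3 * l + 2) - 2"
  shows "is_minor (Gamma_plus l) G \<or> is_minor (nabla l) G"
proof (rule ccontr)
  assume neg: "\<not> ?thesis"
  interpret G: pair_graph G by (rule assms(2))
  interpret ugraph "parcs G" using G.pair_sym_arcs by unfold_locales (simp add: symmetric_def)
  define k where "k = 9 * l\<^sup>2 - 3 * l + 1"
  have bic: "biconn (parcs G) (pverts G)" by (rule k_connected_biconn[OF assms(2,3)])
  have EV: "parcs G \<subseteq> pverts G \<times> pverts G" using G.in_arcsD1 G.in_arcsD2 by auto
  \<comment> \<open>There are \<open>n + 2 = 2 ^ Suc k - 1\<close> words of length at most
    \<open>k\<close>, so \<open>tree_model_exists\<close> asks that bags of size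
    \<open>n + 1\<close> do not suffice, which follows from path-width at least
    \<open>n + 1 = 2 ^ Suc k - 2\<close>.\<close>
  define n :: nat where "n = 2 ^ Suc k - 3"
  \<comment> \<open>This keeps the subtraction of 3 from being truncated.\<close>
  have "2 ^ Suc k \<ge> (2::nat) ^ 2" unfolding k_def by (intro power_increasing) auto
  then have n: "Suc n = 2 ^ Suc k - 2" "card (words k) = Suc (Suc n)"
    unfolding card_words by (simp_all add: n_def)
  have "9 * l\<^sup>2 - 3 * l + 2 = Suc k" by (simp add: k_def)
  then have "\<not> pathwidth G \<le> n" using assms(4) n(1) by simp
  then have "\<not> good (parcs G) (Suc n) (pverts G)" using good_pathwidth[OF assms(2)] by blast
  moreover have "finite (words k)" using finite_lists_length_le[of "UNIV :: bool set" k] by simp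
  moreover have "tl_closed (words k)" by (simp add: tl_closed_def)
  ultimately obtain \<psi> where T: "tmodel (parcs G) (words k) \<psi> (pverts G)"
    using tree_model_exists[of "words k" "Suc n"] n(2) G.pair_finite_verts EV by blast
  have no: "\<not> gplus (parcs G) l (pverts G)" using neg gplus_is_minor[OF assms(2)] by blast
  \<comment> \<open>The left-hand side is \<open>6 l^2 + 5 l - 5\<close>. Its distance to
    \<open>k\<close> is \<open>3 l^2 - 8 l + 6\<close>, a quadratic with negative discriminant,
    hence positive.\<close>
  have kk: "(2 * l + 3) * (l + l + l - 2) + 1 \<le> k"
  proof -
    obtain m where m: "l = Suc m" using assms(1) by (cases l) auto
    have "(2 * l + 3) * (l + l + l - 2) + 1 = 6 * m * m + 17 * m + 6" unfolding m by (simp add: algebra_simps)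
    moreover have "k = 9 * m * m + 15 * m + 7" unfolding k_def m by (simp add: power2_eq_square algebra_simps)
    moreover have "2 * m \<le> 3 * m * m + 1" by (cases m) auto
    ultimately show ?thesis by linarith
  qed
  \<comment> \<open>Any two vertices may serve as roots, since the minors in the conclusion are not
    rooted.\<close>
  have "2 \<le> card (pverts G)" using assms(3) by (simp add: k_connected_def)
  then obtain a b where ab: "a \<in> pverts G" "b \<in> pverts G" "a \<noteq> b"
    by (metis G.pair_finite_verts card_le_Suc0_iff_eq not_less_eq_eq numeral_2_eq_2)
  have "rnabla (parcs G) l a b (pverts G) \<or> rgplus (parcs G) l a b (pverts G) \<or> rgplus (parcs G) l b a (pverts G)"
    by (rule rooted_recursion[OF G.pair_finite_verts bic T assms(1) no kk ab])
  then show False using neg no rnabla_is_minor[OF assms(2,1)] unfolding gplus_def by blast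
qed

end
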